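(* There is an algorithm that solves the Both $k$-near Chain Addition problem in time $O(n^3 k^{4k+4})$, where $n=|S|+|Q|$.
   Context: The input is a bipartite graph $G=(S\cup Q,E)$ (students $S$, questions $Q$; $sq\in E$ means student $s$ answered question $q$ correctly), bijections $\alpha:S\to\{1,\dots,|S|\}$ and $\gamma:Q\to\{1,\dots,|Q|\}$ (initial student and question orderings) and a positive integer $k$. For a vertex $x$, $N(x)$ denotes its neighborhood. An ordering (bijection) $\pi:S\to\{1,\dots,|S|\}$ is nested if $\pi(s_1)\ge \pi(s_2)$ implies $N(s_1)\supseteq N(s_2)$. An ordering $\beta:Q\to\{1,\dots,|Q|\}$ satisfies the interval property if for every $s\in S$, $N(s)=\{\beta^{-1}(1),\dots,\beta^{-1}(j)\}$ for some $j\in\{0,\dots,|Q|\}$. The Both $k$-near Chain Addition problem asks for a minimum-size set of edges (student–question pairs) to add to $G$ (no deletions allowed) such that in the resulting graph there is a nested student ordering $\pi$ with $\pi(s)\in[\alpha(s)-k,\alpha(s)+k]$ for all $s\in S$ and a question ordering $\beta$ satisfying the interval property with $\beta(q)\in[\gamma(q)-k,\gamma(q)+k]$ for all $q\in Q$. *)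

theory Defs
  imports Main
begin

subsection \<open>The Both k-near Chain Addition problem\<close>

text \<open>A bipartite graph on students \<open>S\<close> and questions \<open>Q\<close> is given by its set
  \<open>E \<subseteq> S \<times> Q\<close> of student--question pairs.\<close>

definition nbhd :: "('s \<times> 'q) set \<Rightarrow> 's \<Rightarrow> 'q set" where
  "nbhd E s = {q. (s, q) \<in> E}"

definition is_ordering :: "'a set \<Rightarrow> ('a \<Rightarrow> nat) \<Rightarrow> bool" where
  "is_ordering X \<pi> \<longleftrightarrow> bij_betw \<pi> X {1..card X}"

definition nested :: "'s set \<Rightarrow> ('s \<times> 'q) set \<Rightarrow> ('s \<Rightarrow> nat) \<Rightarrow> bool" where
  "nested S E \<pi> \<longleftrightarrow>
     (\<forall>s\<^sub>1\<in>S. \<forall>s\<^sub>2\<in>S. \<pi> s\<^sub>1 \<ge> \<pi> s\<^sub>2 \<longrightarrow> nbhd E s\<^sub>1 \<supseteq> nbhd E s\<^sub>2)"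

definition interval_property ::
  "'s set \<Rightarrow> 'q set \<Rightarrow> ('s \<times> 'q) set \<Rightarrow> ('q \<Rightarrow> nat) \<Rightarrow> bool" where
  "interval_property S Q E \<beta> \<longleftrightarrow>
     (\<forall>s\<in>S. \<exists>j\<in>{0..card Q}. nbhd E s = inv_into Q \<beta> ` {1..j})"

definition near :: "nat \<Rightarrow> 'a set \<Rightarrow> ('a \<Rightarrow> nat) \<Rightarrow> ('a \<Rightarrow> nat) \<Rightarrow> bool" where
  "near k X \<alpha> \<pi> \<longleftrightarrow>
     (\<forall>x\<in>X. int (\<pi> x) \<in> {int (\<alpha> x) - int k .. int (\<alpha> x) + int k})"

definition chain_instance ::
  "'s set \<Rightarrow> 'q set \<Rightarrow> ('s \<times> 'q) set \<Rightarrow> ('s \<Rightarrow> nat) \<Rightarrow> ('q \<Rightarrow> nat) \<Rightarrow> nat \<Rightarrow> bool" where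
  "chain_instance S Q E \<alpha> \<gamma> k \<longleftrightarrow>
     finite S \<and> finite Q \<and> E \<subseteq> S \<times> Q \<and>
     is_ordering S \<alpha> \<and> is_ordering Q \<gamma> \<and> k > 0"

definition both_near_addition ::
  "'s set \<Rightarrow> 'q set \<Rightarrow> ('s \<times> 'q) set \<Rightarrow> ('s \<Rightarrow> nat) \<Rightarrow> ('q \<Rightarrow> nat) \<Rightarrow> nat
     \<Rightarrow> ('s \<times> 'q) set \<Rightarrow> bool" where
  "both_near_addition S Q E \<alpha> \<gamma> k F \<longleftrightarrow>
     F \<subseteq> S \<times> Q - E \<and>
     (\<exists>\<pi>. is_ordering S \<pi> \<and> nested S (E \<union> F) \<pi> \<and> near k S \<alpha> \<pi>) \<and>
     (\<exists>\<beta>. is_ordering Q \<beta> \<and> interval_property S Q (E \<union> F) \<beta> \<and> near k Q \<gamma> \<beta>)"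

definition min_both_near_addition ::
  "'s set \<Rightarrow> 'q set \<Rightarrow> ('s \<times> 'q) set \<Rightarrow> ('s \<Rightarrow> nat) \<Rightarrow> ('q \<Rightarrow> nat) \<Rightarrow> nat
     \<Rightarrow> ('s \<times> 'q) set \<Rightarrow> bool" where
  "min_both_near_addition S Q E \<alpha> \<gamma> k F \<longleftrightarrow>
     both_near_addition S Q E \<alpha> \<gamma> k F \<and>
     (\<forall>F'. both_near_addition S Q E \<alpha> \<gamma> k F' \<longrightarrow> card F \<le> card F')"

subsection \<open>Algorithms: unit-cost random access programs\<close>

text \<open>
  An algorithm is a program for a unit-cost random access machine on natural numbers whose only
  arithmetic is addition and truncated subtraction. A program can name only finitely many
  registers and arrays; array cells are addressed indirectly, by computed indices. Distinct arrays
  can be interleaved in a single memory, so this is the usual random access machine up to a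
  constant factor. There is no multiplication, because unit-cost multiplication of unbounded
  numbers would make the machine unrealistically fast.
\<close>

type_synonym vname = string

datatype exp =
    Const nat
  | Reg vname
  | Cell vname exp
  | Add exp exp
  | Sub exp exp

datatype com =
    Skip
  | Assign vname exp
  | Store vname exp exp
  | Seq com com
  | Cond exp com com
  | While exp com

record state =
  regs :: "vname \<Rightarrow> nat"
  mem :: "vname \<Rightarrow> nat \<Rightarrow> nat"

fun aval :: "exp \<Rightarrow> state \<Rightarrow> nat" where
  "aval (Const c) \<sigma> = c"
| "aval (Reg x) \<sigma> = regs \<sigma> x"
| "aval (Cell A e) \<sigma> = mem \<sigma> A (aval e \<sigma>)"
| "aval (Add e\<^sub>1 e\<^sub>2) \<sigma> = aval e\<^sub>1 \<sigma> + aval e\<^sub>2 \<sigma>"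
| "aval (Sub e\<^sub>1 e\<^sub>2) \<sigma> = aval e\<^sub>1 \<sigma> - aval e\<^sub>2 \<sigma>"

fun ecost :: "exp \<Rightarrow> nat" where
  "ecost (Const c) = 1"
| "ecost (Reg x) = 1"
| "ecost (Cell A e) = 1 + ecost e"
| "ecost (Add e\<^sub>1 e\<^sub>2) = 1 + ecost e\<^sub>1 + ecost e\<^sub>2"
| "ecost (Sub e\<^sub>1 e\<^sub>2) = 1 + ecost e\<^sub>1 + ecost e\<^sub>2"

text \<open>\<open>exec c \<sigma> t \<tau>\<close>: started in \<open>\<sigma>\<close>, the program \<open>c\<close> halts in state \<open>\<tau>\<close> after exactly \<open>t\<close>
  steps. A nonzero value counts as true.\<close>

inductive exec :: "com \<Rightarrow> state \<Rightarrow> nat \<Rightarrow> state \<Rightarrow> bool" where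
  Skip: "exec Skip \<sigma> 1 \<sigma>"
| Assign: "exec (Assign x e) \<sigma> (1 + ecost e) (\<sigma>\<lparr>regs := (regs \<sigma>)(x := aval e \<sigma>)\<rparr>)"
| Store: "exec (Store A i e) \<sigma> (1 + ecost i + ecost e)
            (\<sigma>\<lparr>mem := (mem \<sigma>)(A := (mem \<sigma> A)(aval i \<sigma> := aval e \<sigma>))\<rparr>)"
| Seq: "exec c\<^sub>1 \<sigma> t\<^sub>1 \<sigma>' \<Longrightarrow> exec c\<^sub>2 \<sigma>' t\<^sub>2 \<tau> \<Longrightarrow> exec (Seq c\<^sub>1 c\<^sub>2) \<sigma> (t\<^sub>1 + t\<^sub>2) \<tau>"
| CondTrue: "aval e \<sigma> \<noteq> 0 \<Longrightarrow> exec c\<^sub>1 \<sigma> t \<tau> \<Longrightarrow> exec (Cond e c\<^sub>1 c\<^sub>2) \<sigma> (1 + ecost e + t) \<tau>"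
| CondFalse: "aval e \<sigma> = 0 \<Longrightarrow> exec c\<^sub>2 \<sigma> t \<tau> \<Longrightarrow> exec (Cond e c\<^sub>1 c\<^sub>2) \<sigma> (1 + ecost e + t) \<tau>"
| WhileFalse: "aval e \<sigma> = 0 \<Longrightarrow> exec (While e c) \<sigma> (1 + ecost e) \<sigma>"
| WhileTrue: "aval e \<sigma> \<noteq> 0 \<Longrightarrow> exec c \<sigma> t\<^sub>1 \<sigma>' \<Longrightarrow> exec (While e c) \<sigma>' t\<^sub>2 \<tau>
     \<Longrightarrow> exec (While e c) \<sigma> (1 + ecost e + t\<^sub>1 + t\<^sub>2) \<tau>"

inductive_cases SkipE: "exec Skip \<sigma> t \<tau>"
inductive_cases AssignE: "exec (Assign x e) \<sigma> t \<tau>"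
inductive_cases StoreE: "exec (Store A i e) \<sigma> t \<tau>"
inductive_cases SeqE: "exec (Seq c\<^sub>1 c\<^sub>2) \<sigma> t \<tau>"
inductive_cases CondE: "exec (Cond e c\<^sub>1 c\<^sub>2) \<sigma> t \<tau>"
inductive_cases WhileE: "exec (While e c) \<sigma> t \<tau>"

text \<open>Executions are deterministic, so a program has at most one result and one running time on
  each input.\<close>

lemma exec_deterministic:
  "exec c \<sigma> t \<tau> \<Longrightarrow> exec c \<sigma> t' \<tau>' \<Longrightarrow> t' = t \<and> \<tau>' = \<tau>"
proof (induction arbitrary: t' \<tau>' rule: exec.induct)
  case (Skip \<sigma>) then show ?case by (auto elim: SkipE)
next
  case (Assign x e \<sigma>) then show ?case by (auto elim: AssignE)
next
  case (Store A i e \<sigma>) then show ?case by (auto elim: StoreE)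
next
  case (Seq c\<^sub>1 \<sigma> t\<^sub>1 \<sigma>' c\<^sub>2 t\<^sub>2 \<tau>)
  from Seq.prems show ?case by (rule SeqE) (auto dest!: Seq.IH)
next
  case (CondTrue e \<sigma> c\<^sub>1 t \<tau> c\<^sub>2)
  from CondTrue.prems show ?case by (rule CondE) (use CondTrue.hyps in \<open>auto dest!: CondTrue.IH\<close>)
next
  case (CondFalse e \<sigma> c\<^sub>2 t \<tau> c\<^sub>1)
  from CondFalse.prems show ?case by (rule CondE) (use CondFalse.hyps in \<open>auto dest!: CondFalse.IH\<close>)
next
  case (WhileFalse e \<sigma> c)
  from WhileFalse.prems show ?case by (rule WhileE) (use WhileFalse.hyps in simp_all)
next
  case (WhileTrue e \<sigma> c t\<^sub>1 \<sigma>' t\<^sub>2 \<tau>)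
  from WhileTrue.prems show ?case by (rule WhileE) (use WhileTrue.hyps in \<open>auto dest!: WhileTrue.IH\<close>)
qed

subsection \<open>Input and output\<close>

text \<open>Students and questions are numbered \<open>0, \<dots>, a - 1\<close> and \<open>0, \<dots>, b - 1\<close> in no particular
  order. Sets of pairs are represented by their \<open>a \<times> b\<close> 0/1 matrix, stored row by row. All
  registers and cells not used for the input are initially zero.\<close>

definition input_state ::
  "nat \<Rightarrow> nat \<Rightarrow> (nat \<times> nat) set \<Rightarrow> (nat \<Rightarrow> nat) \<Rightarrow> (nat \<Rightarrow> nat) \<Rightarrow> nat \<Rightarrow> state" where
  "input_state a b E \<alpha> \<gamma> k =
     \<lparr>regs = (\<lambda>_. 0)(''a'' := a, ''b'' := b, ''k'' := k),
      mem = (\<lambda>_ _. 0)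
        (''alpha'' := (\<lambda>s. if s < a then \<alpha> s else 0),
         ''gamma'' := (\<lambda>q. if q < b then \<gamma> q else 0),
         ''E'' := (\<lambda>i. if i < a * b \<and> (i div b, i mod b) \<in> E then 1 else 0))\<rparr>"

definition output_edges :: "nat \<Rightarrow> nat \<Rightarrow> state \<Rightarrow> (nat \<times> nat) set" where
  "output_edges a b \<tau> = {(s, q). s < a \<and> q < b \<and> mem \<tau> ''F'' (s * b + q) = 1}"

end

theory Submission
  imports Defs
begin

text \<open>
  A solution amounts to an interleaving of the two orderings: students and questions are placed one
  at a time, and each student is joined to exactly the questions placed before it. This is
  admissible iff all neighbours of a student are placed before it, and the resulting graph has as
  many edges as the sum, over all students, of the number of questions preceding it.

  Nearness makes the prefixes of the orderings nearly determined: the set of the first \<open>i\<close> elements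
  contains everything of initial rank at most \<open>i - k\<close> and nothing of initial rank above \<open>i + k\<close>, so it
  is given by \<open>i\<close> and a mask of \<open>2k\<close> bits. A shortest path computation over the quadruples (number
  and mask of the placed students, number and mask of the placed questions) therefore solves the
  problem. For \<open>N = 4\<^sup>k\<close> masks, it takes \<open>O(n\<^sup>3 N\<^sup>4)\<close> steps, and \<open>N\<^sup>4 = 256\<^sup>k\<close> is
  \<open>O(k\<^sup>4\<^sup>k)\<close>.
\<close>

subsection \<open>Prefixes of near orderings\<close>

text \<open>No theory of shortest paths is needed: the final table serves as a pair of certificates.
  Each nonzero cell records a predecessor that accounts for its value (\<open>sound\<close>), which
  yields a path and hence an addition. Each transition obeys a triangle inequality
  (\<open>closed\<close>), so the table is a potential that telescopes along the interleaving of any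
  competing addition.

  Masks that describe no prefix of a near ordering are harmless: paths start at empty sets, and
  every transition is checked to add exactly one element at an admissible position. This check is a
  pass over all elements. It is made in advance, in tables that cost about \<open>n^3 N^2\<close>;
  the main loop then costs about \<open>n^2 N^3\<close>, and \<open>n^3 N^4\<close> covers both.

  The machine can neither multiply nor divide. Hence the tables of multiples, and the extra arrays
  from which the trace reads coordinates that it could not decode from a node index.\<close>

text \<open>Bit \<open>l\<close> of the mask \<open>m\<close> of a prefix of length \<open>i\<close> stands for the element of initial rank
  \<open>i - k + 1 + l\<close>; elements of smaller rank always belong to the prefix, and masks have \<open>2k\<close> bits.\<close>

definition sel :: "(nat \<Rightarrow> nat) \<Rightarrow> nat \<Rightarrow> nat \<Rightarrow> nat \<Rightarrow> nat \<Rightarrow> nat set" where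
  "sel \<omega> k n i m = {x. x < n \<and> (\<omega> x + k \<le> i \<or> bit m (\<omega> x + k - i - 1))}"

text \<open>The last condition compares sets and not masks: bits that stand for ranks outside
  \<open>1..n\<close> are arbitrary, so a prefix has several masks.\<close>

definition step :: "(nat \<Rightarrow> nat) \<Rightarrow> nat \<Rightarrow> nat \<Rightarrow> nat \<Rightarrow> nat \<Rightarrow> nat \<Rightarrow> nat \<Rightarrow> bool" where
  "step \<omega> k n i m' m x \<longleftrightarrow> i > 0 \<and> x < n \<and> \<omega> x \<le> i + k \<and> i \<le> \<omega> x + k \<and>
     x \<notin> sel \<omega> k n (i - 1) m' \<and> sel \<omega> k n i m = insert x (sel \<omega> k n (i - 1) m')"

lemma mask_exists: "X \<subseteq> {..<w} \<Longrightarrow> \<exists>m::nat. m < 2 ^ w \<and> (\<forall>l. bit m l \<longleftrightarrow> l \<in> X)"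
proof (induction w arbitrary: X)
  case 0
  then show ?case by (intro exI[of _ 0]) auto
next
  case (Suc w)
  obtain m :: nat where m: "m < 2 ^ w" "\<forall>l. bit m l \<longleftrightarrow> Suc l \<in> X"
    using Suc.IH[of "{l. Suc l \<in> X}"] Suc.prems by auto
  have "bit (2 * m + of_bool (0 \<in> X)) l \<longleftrightarrow> l \<in> X" for l
    using m(2) by (cases l) (auto simp: bit_Suc bit_0)
  moreover have "2 * m + of_bool (0 \<in> X) < 2 ^ Suc w" using m(1) by auto
  ultimately show ?case by blast
qed

lemma bit_pow2_minus_1: "bit (2 ^ k - 1 :: nat) l \<longleftrightarrow> l < k"
  unfolding mask_eq_exp_minus_1[symmetric] by (simp add: bit_mask_iff)

lemma ordering_range:
  assumes "is_ordering {..<n} \<omega>" "x < n"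
  shows "1 \<le> \<omega> x" "\<omega> x \<le> n"
  using assms bij_betwE[of \<omega> "{..<n}" "{1..n}"] by (auto simp: is_ordering_def)

lemma ordering_inj:
  "is_ordering {..<n} \<omega> \<Longrightarrow> x < n \<Longrightarrow> y < n \<Longrightarrow> \<omega> x = \<omega> y \<Longrightarrow> x = y"
  by (auto simp: is_ordering_def bij_betw_def inj_on_def)

lemma ordering_surj:
  assumes "is_ordering {..<n} \<omega>" "1 \<le> i" "i \<le> n"
  obtains x where "x < n" "\<omega> x = i"
proof -
  have "i \<in> \<omega> ` {..<n}" using assms by (auto simp: is_ordering_def bij_betw_def)
  then show ?thesis using that by auto
qed

text \<open>At length \<open>0\<close> the low \<open>k\<close> bits stand for the ranks
  \<open>1 - k, ..., 0\<close>, which no element has. At full length the same bits stand for the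
  last \<open>k\<close> ranks. Hence one mask serves both ends.\<close>

lemma sel_start:
  assumes "is_ordering {..<n} \<omega>"
  shows "sel \<omega> k n 0 (2 ^ k - 1) = {}"
proof -
  have "\<not> (\<omega> x + k \<le> 0 \<or> \<omega> x + k - 0 - 1 < k)" if "x < n" for x
    using ordering_range[OF assms that] by linarith
  then show ?thesis unfolding sel_def bit_pow2_minus_1 by blast
qed

lemma sel_end:
  assumes "is_ordering {..<n} \<omega>"
  shows "sel \<omega> k n n (2 ^ k - 1) = {..<n}"
proof -
  have "\<omega> x + k \<le> n \<or> \<omega> x + k - n - 1 < k" if "x < n" for x
    using ordering_range[OF assms that] by linarith
  then show ?thesis unfolding sel_def bit_pow2_minus_1 by blast
qed

lemma near_bounds:
  assumes "near k {..<n} \<omega> \<pi>" "x < n"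
  shows "\<pi> x \<le> \<omega> x + k" "\<omega> x \<le> \<pi> x + k"
  using assms(1)[unfolded near_def, THEN bspec, of x] assms(2) by auto

text \<open>Nearness places everything of rank at most \<open>i - k\<close> among the first
  \<open>i\<close> elements, and everything among them has rank at most \<open>i + k\<close>. Only
  the \<open>2k\<close> ranks in between are open, one bit each.\<close>

lemma sel_exists:
  assumes \<omega>: "is_ordering {..<n} \<omega>" and nr: "near k {..<n} \<omega> \<pi>"
  shows "\<exists>m<2 ^ (k + k). sel \<omega> k n i m = {x. x < n \<and> \<pi> x \<le> i}"
proof -
  define X where "X = {l. \<exists>x<n. \<pi> x \<le> i \<and> i < \<omega> x + k \<and> l = \<omega> x + k - i - 1}"
  have "X \<subseteq> {..<k + k}"
  proof
    fix l assume "l \<in> X"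
    then obtain x where "x < n" "\<pi> x \<le> i" "i < \<omega> x + k" "l = \<omega> x + k - i - 1"
      by (auto simp: X_def)
    then show "l \<in> {..<k + k}" using near_bounds[OF nr, of x] by simp
  qed
  then obtain m :: nat where m: "m < 2 ^ (k + k)" "\<And>l. bit m l \<longleftrightarrow> l \<in> X"
    using mask_exists[of X "k + k"] by auto
  have "x \<in> sel \<omega> k n i m \<longleftrightarrow> x < n \<and> \<pi> x \<le> i" for x
  proof (cases "x < n")
    case True
    show ?thesis
    proof (cases "\<omega> x + k \<le> i")
      case True
      then show ?thesis using \<open>x < n\<close> near_bounds[OF nr, of x] by (auto simp: sel_def)
    next
      case False
      \<comment> \<open>Injectivity of \<open>\<omega>\<close> ensures that no two undecided
        elements share a bit.\<close>
      have "\<omega> x + k - i - 1 \<in> X \<longleftrightarrow> \<pi> x \<le> i"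
      proof
        assume "\<omega> x + k - i - 1 \<in> X"
        then obtain y where y: "y < n" "\<pi> y \<le> i" "i < \<omega> y + k"
          "\<omega> x + k - i - 1 = \<omega> y + k - i - 1" unfolding X_def by blast
        then have "\<omega> x = \<omega> y" using False by linarith
        then show "\<pi> x \<le> i" using ordering_inj[OF \<omega>] y \<open>x < n\<close> by blast
      next
        assume "\<pi> x \<le> i"
        then show "\<omega> x + k - i - 1 \<in> X" using \<open>x < n\<close> False by (auto simp: X_def)
      qed
      then show ?thesis using \<open>x < n\<close> False m by (auto simp: sel_def)
    qed
  qed (simp add: sel_def)
  then show ?thesis using m(1) by blast
qed

lemma mask_chain:
  assumes \<omega>: "is_ordering {..<n} \<omega>" and \<pi>: "is_ordering {..<n} \<pi>" and nr: "near k {..<n} \<omega> \<pi>"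
  obtains ms where "ms 0 = 2 ^ k - 1" "ms n = 2 ^ k - 1"
    "\<And>i. ms i < 2 ^ (k + k)"
    "\<And>i. i \<le> n \<Longrightarrow> sel \<omega> k n i (ms i) = {x. x < n \<and> \<pi> x \<le> i}"
proof -
  have "\<forall>i. \<exists>m. m < 2 ^ (k + k) \<and> sel \<omega> k n i m = {x. x < n \<and> \<pi> x \<le> i}"
    using sel_exists[OF \<omega> nr] by blast
  from choice[OF this] obtain f
    where f: "\<And>i. f i < 2 ^ (k + k)" "\<And>i. sel \<omega> k n i (f i) = {x. x < n \<and> \<pi> x \<le> i}"
    by blast
  \<comment> \<open>Masks are not unique, so the empty and the full prefix get the canonical mask;
    this fixes the start node and the end node of the search.\<close>
  define ms where "ms i = (if i = 0 \<or> i = n then 2 ^ k - 1 else f i)" for i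
  have "(1::nat) \<le> 2 ^ k" "(2::nat) ^ k \<le> 2 ^ (k + k)" by (auto intro: power_increasing)
  then have "(2::nat) ^ k - 1 < 2 ^ (k + k)" by linarith
  moreover have "sel \<omega> k n i (ms i) = {x. x < n \<and> \<pi> x \<le> i}" if "i \<le> n" for i
  proof -
    have "{x. x < n \<and> \<pi> x \<le> 0} = {}" "{x. x < n \<and> \<pi> x \<le> n} = {..<n}"
      using ordering_range[OF \<pi>] by force+
    then show ?thesis using sel_start[OF \<omega>, of k] sel_end[OF \<omega>, of k] f by (auto simp: ms_def)
  qed
  ultimately show ?thesis using that[of ms] f by (auto simp: ms_def)
qed

lemma prefix_insert:
  assumes \<pi>: "is_ordering {..<n} \<pi>" and x: "x < n"
  shows "{y. y < n \<and> \<pi> y \<le> \<pi> x} = insert x {y. y < n \<and> \<pi> y \<le> \<pi> x - 1}"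
proof (intro set_eqI iffI)
  fix y assume "y \<in> {y. y < n \<and> \<pi> y \<le> \<pi> x}"
  then show "y \<in> insert x {y. y < n \<and> \<pi> y \<le> \<pi> x - 1}"
    using ordering_inj[OF \<pi> _ x, of y] by (cases "\<pi> y = \<pi> x") auto
qed (use x in auto)

lemma step_of_ordering:
  assumes \<pi>: "is_ordering {..<n} \<pi>" and nr: "near k {..<n} \<omega> \<pi>"
    and ms: "\<And>i. i \<le> n \<Longrightarrow> sel \<omega> k n i (ms i) = {x. x < n \<and> \<pi> x \<le> i}"
    and x: "x < n" "\<pi> x = i"
  shows "step \<omega> k n i (ms (i - 1)) (ms i) x"
proof -
  have i: "1 \<le> i" "i \<le> n" using ordering_range[OF \<pi> x(1)] x(2) by simp_all
  have "sel \<omega> k n i (ms i) = insert x (sel \<omega> k n (i - 1) (ms (i - 1)))"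
    using prefix_insert[OF \<pi> x(1)] ms[of i] ms[of "i - 1"] i x(2) by simp
  moreover have "x \<notin> sel \<omega> k n (i - 1) (ms (i - 1))" using ms[of "i - 1"] i x by simp
  ultimately show ?thesis using near_bounds[OF nr x(1)] x i unfolding step_def by simp
qed

lemma bij_betw_extend:
  assumes "bij_betw f A {1..i}" "x \<notin> A"
  shows "bij_betw (f(x := Suc i)) (insert x A) {1..Suc i}"
proof -
  have "bij_betw (f(x := Suc i)) A {1..i}"
    using assms by (subst bij_betw_cong[of _ _ f]) auto
  then have "bij_betw (f(x := Suc i)) (A \<union> {x}) ({1..i} \<union> {Suc i})"
    using notIn_Un_bij_betw3[of x A "f(x := Suc i)" "{1..i}"] assms(2) by simp
  then show ?thesis by (simp add: atLeastAtMostSuc_conv Un_commute)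
qed

lemma inv_into_image_eq:
  assumes "bij_betw \<beta> Q {1..card Q}" "j \<le> card Q"
  shows "inv_into Q \<beta> ` {1..j} = {q\<in>Q. \<beta> q \<le> j}"
proof (intro set_eqI iffI)
  fix q assume "q \<in> inv_into Q \<beta> ` {1..j}"
  then obtain i where i: "i \<in> {1..j}" "q = inv_into Q \<beta> i" by auto
  then have "i \<in> \<beta> ` Q" using assms by (auto simp: bij_betw_def)
  then show "q \<in> {q\<in>Q. \<beta> q \<le> j}" using i by (auto simp: inv_into_into f_inv_into_f)
next
  fix q assume q: "q \<in> {q\<in>Q. \<beta> q \<le> j}"
  then have "inv_into Q \<beta> (\<beta> q) = q" "\<beta> q \<in> {1..j}"
    using assms by (auto simp: bij_betw_def)
  then show "q \<in> inv_into Q \<beta> ` {1..j}" by (metis image_eqI)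
qed

section \<open>Interleaved placements and edge additions\<close>

locale chain_inst =
  fixes a b :: nat and E :: "(nat \<times> nat) set" and \<alpha> \<gamma> :: "nat \<Rightarrow> nat" and k :: nat
  assumes inst: "chain_instance {..<a} {..<b} E \<alpha> \<gamma> k"
begin

lemma E_sub: "E \<subseteq> {..<a} \<times> {..<b}" and \<alpha>: "is_ordering {..<a} \<alpha>" and \<gamma>: "is_ordering {..<b} \<gamma>"
  and k_pos: "k > 0"
  using inst by (auto simp: chain_instance_def)

lemma finite_E: "finite E" using E_sub finite_subset by blast

text \<open>Interleavings with sets in place of masks, which keeps the argument about orderings
  independent of the encoding. The edge count \<open>c\<close> is carried along because it is the
  quantity compared with the table.\<close>

inductive reach :: "nat \<Rightarrow> nat set \<Rightarrow> nat \<Rightarrow> nat set \<Rightarrow> nat \<Rightarrow> (nat \<times> nat) set \<Rightarrow> bool" where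
  start: "reach 0 {} 0 {} 0 {}"
| student: "reach i A j B c R \<Longrightarrow> s < a \<Longrightarrow> s \<notin> A \<Longrightarrow> \<alpha> s \<le> Suc i + k \<Longrightarrow> Suc i \<le> \<alpha> s + k \<Longrightarrow>
    nbhd E s \<subseteq> B \<Longrightarrow> reach (Suc i) (insert s A) j B (c + j) (R \<union> {s} \<times> B)"
| question: "reach i A j B c R \<Longrightarrow> q < b \<Longrightarrow> q \<notin> B \<Longrightarrow> \<gamma> q \<le> Suc j + k \<Longrightarrow> Suc j \<le> \<gamma> q + k \<Longrightarrow>
    reach i A (Suc j) (insert q B) c R"

text \<open>The interval property appears as thresholds of \<open>\<beta>\<close> on the placed
  questions, a form that survives later placements. The condition
  \<open>E \<inter> A \<times> UNIV \<subseteq> R\<close> says that no given edge of a placed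
  student is lost.\<close>

definition realizes :: "nat \<Rightarrow> nat set \<Rightarrow> nat \<Rightarrow> nat set \<Rightarrow> nat \<Rightarrow> (nat \<times> nat) set \<Rightarrow>
    (nat \<Rightarrow> nat) \<Rightarrow> (nat \<Rightarrow> nat) \<Rightarrow> bool" where
  "realizes i A j B c R \<pi> \<beta> \<longleftrightarrow>
     A \<subseteq> {..<a} \<and> B \<subseteq> {..<b} \<and> card B = j \<and> card R = c \<and> R \<subseteq> A \<times> B \<and> E \<inter> A \<times> UNIV \<subseteq> R \<and>
     bij_betw \<pi> A {1..i} \<and> bij_betw \<beta> B {1..j} \<and> near k A \<alpha> \<pi> \<and> near k B \<gamma> \<beta> \<and>
     nested A R \<pi> \<and> (\<forall>s\<in>A. \<exists>j'\<le>j. nbhd R s = {q\<in>B. \<beta> q \<le> j'})"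

text \<open>The new student takes the last position and all of \<open>B\<close>. Since
  \<open>R \<subseteq> A \<times> B\<close>, all earlier neighbourhoods lie in \<open>B\<close>, so
  nestedness persists; its own threshold is \<open>j\<close>.\<close>

lemma realizes_student:
  assumes real: "realizes i A j B c R \<pi> \<beta>"
    and s: "s < a" "s \<notin> A" "\<alpha> s \<le> Suc i + k" "Suc i \<le> \<alpha> s + k" "nbhd E s \<subseteq> B"
  shows "realizes (Suc i) (insert s A) j B (c + j) (R \<union> {s} \<times> B) (\<pi>(s := Suc i)) \<beta>"
proof -
  note h = real[unfolded realizes_def]
  let ?R = "R \<union> {s} \<times> B" and ?\<pi> = "\<pi>(s := Suc i)"
  have RAB: "R \<subseteq> A \<times> B" and B: "B \<subseteq> {..<b}" and A: "A \<subseteq> {..<a}" using h by simp_all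
  then have fin: "finite R" "finite B"
    using finite_subset[of R "{..<a} \<times> {..<b}"] finite_subset[of B "{..<b}"] by auto
  have "R \<inter> {s} \<times> B = {}" using RAB s by auto
  then have "card ?R = c + j" using h fin by (simp add: card_Un_disjoint)
  moreover have nb: "nbhd ?R s = B" "\<And>t. t \<in> A \<Longrightarrow> nbhd ?R t = nbhd R t"
    using RAB s by (auto simp: nbhd_def)
  have bij: "bij_betw \<pi> A {1..i}" "bij_betw \<beta> B {1..j}" using h by simp_all
  have le: "\<pi> t \<le> i" if "t \<in> A" for t using bij_betwE[OF bij(1)] that by auto
  have "nested (insert s A) ?R ?\<pi>"
    unfolding nested_def
  proof (intro ballI impI)
    fix t u assume tu: "t \<in> insert s A" "u \<in> insert s A" "?\<pi> u \<le> ?\<pi> t"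
    show "nbhd ?R u \<subseteq> nbhd ?R t"
    proof (cases "t = s")
      case True
      then show ?thesis using nb RAB by (auto simp: nbhd_def)
    next
      case False
      then have t: "t \<in> A" using tu by auto
      then have "u \<noteq> s" using tu le[of t] False by auto
      then have "u \<in> A" "\<pi> u \<le> \<pi> t" using tu False by auto
      moreover have "nested A R \<pi>" using h by simp
      ultimately show ?thesis using t nb(2) unfolding nested_def by simp
    qed
  qed
  moreover have "near k (insert s A) \<alpha> ?\<pi>"
  proof -
    have "near k A \<alpha> \<pi>" using h by simp
    then show ?thesis using s by (auto simp: near_def)
  qed
  moreover have "bij_betw ?\<pi> (insert s A) {1..Suc i}"
    using bij_betw_extend[OF bij(1) s(2)] .
  moreover have "\<forall>t\<in>insert s A. \<exists>j'\<le>j. nbhd ?R t = {q\<in>B. \<beta> q \<le> j'}"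
  proof
    fix t assume "t \<in> insert s A"
    then consider "t = s" | "t \<in> A" by blast
    then show "\<exists>j'\<le>j. nbhd ?R t = {q\<in>B. \<beta> q \<le> j'}"
    proof cases
      case 1
      have "{q\<in>B. \<beta> q \<le> j} = B" using bij_betwE[OF bij(2)] by auto
      then show ?thesis using 1 nb by (intro exI[of _ j]) simp
    next
      case 2
      moreover have "\<forall>s\<in>A. \<exists>j'\<le>j. nbhd R s = {q\<in>B. \<beta> q \<le> j'}" using h by simp
      ultimately show ?thesis using nb(2) by simp
    qed
  qed
  moreover have "E \<inter> insert s A \<times> UNIV \<subseteq> ?R"
  proof -
    have "E \<inter> A \<times> UNIV \<subseteq> R" using h by simp
    then show ?thesis using s(5) by (auto simp: nbhd_def)
  qed
  moreover have "insert s A \<subseteq> {..<a}" "?R \<subseteq> insert s A \<times> B" using A RAB s by auto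
  ultimately show ?thesis using h unfolding realizes_def by simp
qed

text \<open>The new question takes position \<open>Suc j\<close>, beyond all earlier thresholds, so
  the neighbourhoods already fixed remain prefixes.\<close>

lemma realizes_question:
  assumes real: "realizes i A j B c R \<pi> \<beta>"
    and q: "q < b" "q \<notin> B" "\<gamma> q \<le> Suc j + k" "Suc j \<le> \<gamma> q + k"
  shows "realizes i A (Suc j) (insert q B) c R \<pi> (\<beta>(q := Suc j))"
proof -
  note h = real[unfolded realizes_def]
  let ?\<beta> = "\<beta>(q := Suc j)"
  have B: "B \<subseteq> {..<b}" "R \<subseteq> A \<times> B" using h by simp_all
  then have fin: "finite B" using finite_subset[of B "{..<b}"] by auto
  have "bij_betw \<beta> B {1..j}" using h by simp
  from bij_betw_extend[OF this q(2)] have "bij_betw ?\<beta> (insert q B) {1..Suc j}" .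
  moreover have "near k (insert q B) \<gamma> ?\<beta>"
  proof -
    have "near k B \<gamma> \<beta>" using h by simp
    then show ?thesis using q by (auto simp: near_def)
  qed
  moreover have "\<forall>s\<in>A. \<exists>j'\<le>Suc j. nbhd R s = {r\<in>insert q B. ?\<beta> r \<le> j'}"
  proof
    fix s assume "s \<in> A"
    moreover have "\<forall>s\<in>A. \<exists>j'\<le>j. nbhd R s = {q\<in>B. \<beta> q \<le> j'}" using h by simp
    ultimately obtain j' where j': "j' \<le> j" "nbhd R s = {q\<in>B. \<beta> q \<le> j'}" by blast
    then have "{q\<in>B. \<beta> q \<le> j'} = {r\<in>insert q B. ?\<beta> r \<le> j'}" using q by auto
    then show "\<exists>j'\<le>Suc j. nbhd R s = {r\<in>insert q B. ?\<beta> r \<le> j'}"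
      using j' by (intro exI[of _ j']) simp
  qed
  moreover have "card (insert q B) = Suc j" "insert q B \<subseteq> {..<b}" "R \<subseteq> A \<times> insert q B"
    using h B fin q by auto
  ultimately show ?thesis using h unfolding realizes_def by simp
qed

lemma reach_realizes: "reach i A j B c R \<Longrightarrow> \<exists>\<pi> \<beta>. realizes i A j B c R \<pi> \<beta>"
proof (induction rule: reach.induct)
  case start
  have "realizes 0 {} 0 {} 0 {} id id" by (simp add: realizes_def near_def nested_def)
  then show ?case by blast
next
  case student
  then show ?case using realizes_student by blast
next
  case question
  then show ?case using realizes_question by blast
qed

lemma reach_final:
  assumes "reach a {..<a} b {..<b} c R"
  shows "both_near_addition {..<a} {..<b} E \<alpha> \<gamma> k (R - E)" "card (R - E) + card E = c"
proof -
  obtain \<pi> \<beta> where "realizes a {..<a} b {..<b} c R \<pi> \<beta>" using reach_realizes[OF assms] by blast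
  then have h: "card R = c" "R \<subseteq> {..<a} \<times> {..<b}"
    "E \<inter> {..<a} \<times> UNIV \<subseteq> R" "bij_betw \<pi> {..<a} {1..a}" "bij_betw \<beta> {..<b} {1..b}"
    "near k {..<a} \<alpha> \<pi>" "near k {..<b} \<gamma> \<beta>" "nested {..<a} R \<pi>"
    "\<forall>s\<in>{..<a}. \<exists>j'\<le>b. nbhd R s = {q\<in>{..<b}. \<beta> q \<le> j'}"
    unfolding realizes_def by simp_all
  have ER: "E \<subseteq> R" using h(3) E_sub by auto
  then have un: "E \<union> (R - E) = R" by auto
  have "interval_property {..<a} {..<b} R \<beta>"
    unfolding interval_property_def
  proof
    fix s assume "s \<in> {..<a}"
    then obtain j' where "j' \<le> b" "nbhd R s = {q\<in>{..<b}. \<beta> q \<le> j'}" using h by blast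
    then show "\<exists>j\<in>{0..card {..<b}}. nbhd R s = inv_into {..<b} \<beta> ` {1..j}"
      using inv_into_image_eq[of \<beta> "{..<b}" j'] h by (intro bexI[of _ j']) auto
  qed
  then show "both_near_addition {..<a} {..<b} E \<alpha> \<gamma> k (R - E)"
    using h un by (auto simp: both_near_addition_def is_ordering_def)
  have "finite R" using h(2) finite_subset by blast
  then show "card (R - E) + card E = c"
    using ER h(1) card_mono[of R E] by (simp add: card_Diff_subset finite_E)
qed

text \<open>Weak duality: \<open>g\<close> is an arbitrary potential that drops by at most the cost
  of each transition. Any admissible addition gives an interleaving, and summing the inequalities
  along it bounds its number of edges from below. Later \<open>g\<close> is the computed table
  itself.\<close>

lemma addition_lower_bound:
  fixes g :: "nat \<Rightarrow> nat \<Rightarrow> nat \<Rightarrow> nat \<Rightarrow> nat"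
  assumes F: "both_near_addition {..<a} {..<b} E \<alpha> \<gamma> k F"
    and start: "I \<le> g 0 (2 ^ k - 1) 0 (2 ^ k - 1)"
    and student: "\<And>i m' m j p s. step \<alpha> k a i m' m s \<Longrightarrow> i \<le> a \<Longrightarrow> j \<le> b \<Longrightarrow> m' < 2 ^ (k + k) \<Longrightarrow>
      m < 2 ^ (k + k) \<Longrightarrow> p < 2 ^ (k + k) \<Longrightarrow> nbhd E s \<subseteq> sel \<gamma> k b j p \<Longrightarrow>
      g (i - 1) m' j p \<le> g i m j p + j"
    and question: "\<And>i m j p' p q. step \<gamma> k b j p' p q \<Longrightarrow> i \<le> a \<Longrightarrow> j \<le> b \<Longrightarrow> p' < 2 ^ (k + k) \<Longrightarrow>
      m < 2 ^ (k + k) \<Longrightarrow> p < 2 ^ (k + k) \<Longrightarrow> g i m (j - 1) p' \<le> g i m j p"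
  shows "I \<le> g a (2 ^ k - 1) b (2 ^ k - 1) + (card E + card F)"
proof -
  let ?H = "E \<union> F"
  obtain \<pi> \<beta> where \<pi>: "is_ordering {..<a} \<pi>" "nested {..<a} ?H \<pi>" "near k {..<a} \<alpha> \<pi>"
    and \<beta>: "is_ordering {..<b} \<beta>" "interval_property {..<a} {..<b} ?H \<beta>" "near k {..<b} \<gamma> \<beta>"
    and Fs: "F \<subseteq> {..<a} \<times> {..<b} - E"
    using F unfolding both_near_addition_def by blast
  \<comment> \<open>As neighbourhoods are prefixes of \<open>\<beta>\<close>, the degree of
    \<open>s\<close> is also its threshold: the number of questions placed before
    \<open>s\<close>.\<close>
  define J where "J s = card (nbhd ?H s)" for s
  have nb: "nbhd ?H s = {q. q < b \<and> \<beta> q \<le> J s}" and Jb: "J s \<le> b" if s: "s < a" for s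
  proof -
    have bij: "bij_betw \<beta> {..<b} {1..b}" using \<beta>(1) by (simp add: is_ordering_def)
    obtain j where j: "j \<le> b" "nbhd ?H s = inv_into {..<b} \<beta> ` {1..j}"
      using \<beta>(2)[unfolded interval_property_def, THEN bspec, of s] s by auto
    then have e: "nbhd ?H s = {q\<in>{..<b}. \<beta> q \<le> j}"
      using inv_into_image_eq[of \<beta> "{..<b}" j] bij by simp
    have "inj_on (inv_into {..<b} \<beta>) {1..j}"
      using bij j(1) by (intro inj_on_inv_into) (auto simp: bij_betw_def)
    then have "J s = j" by (simp add: J_def j(2) card_image)
    then show "nbhd ?H s = {q. q < b \<and> \<beta> q \<le> J s}" "J s \<le> b" using e j by auto
  qed
  have finH: "finite (nbhd ?H s)" if "s < a" for s using nb[OF that] by simp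
  have Jmono: "J s \<le> J t" if "s < a" "t < a" "\<pi> s \<le> \<pi> t" for s t
    unfolding J_def using \<pi>(2) that finH by (intro card_mono) (auto simp: nested_def)
  obtain ms where ms: "ms 0 = 2 ^ k - 1" "ms a = 2 ^ k - 1" "\<And>i. ms i < 2 ^ (k + k)"
    "\<And>i. i \<le> a \<Longrightarrow> sel \<alpha> k a i (ms i) = {x. x < a \<and> \<pi> x \<le> i}"
    using mask_chain[OF \<alpha> \<pi>(1,3)] by blast
  obtain ps where ps: "ps 0 = 2 ^ k - 1" "ps b = 2 ^ k - 1" "\<And>i. ps i < 2 ^ (k + k)"
    "\<And>i. i \<le> b \<Longrightarrow> sel \<gamma> k b i (ps i) = {x. x < b \<and> \<beta> x \<le> i}"
    using mask_chain[OF \<gamma> \<beta>(1,3)] by blast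
  \<comment> \<open>The interleaving is unwound from its end. The side condition says that all
    neighbours of the first \<open>i\<close> students are among the first \<open>j\<close>
    questions; the sum counts the edges at these students.\<close>
  have main: "I \<le> g i (ms i) j (ps j) + (\<Sum>s | s < a \<and> \<pi> s \<le> i. J s)"
    if "i \<le> a" "j \<le> b" "\<And>s. s < a \<Longrightarrow> \<pi> s \<le> i \<Longrightarrow> J s \<le> j" for i j
    using that
  proof (induction "i + j" arbitrary: i j)
    case 0
    then show ?case using start ms ps by simp
  next
    case (Suc n)
    show ?case
    \<comment> \<open>The last question is removed if none of the placed students uses it. Otherwise
      the last student is removed; as \<open>J\<close> is monotone along \<open>\<pi>\<close>, its
      degree is exactly \<open>j\<close>.\<close>
    proof (cases "j > 0 \<and> (\<forall>s. s < a \<longrightarrow> \<pi> s \<le> i \<longrightarrow> J s \<le> j - 1)")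
      case True
      obtain q where q: "q < b" "\<beta> q = j"
        using ordering_surj[OF \<beta>(1), of j] True Suc.prems by auto
      have "step \<gamma> k b j (ps (j - 1)) (ps j) q"
        using step_of_ordering[OF \<beta>(1,3) ps(4) q] by simp
      then have "g i (ms i) (j - 1) (ps (j - 1)) \<le> g i (ms i) j (ps j)"
        using question Suc.prems ms ps by blast
      moreover have "I \<le> g i (ms i) (j - 1) (ps (j - 1)) + (\<Sum>s | s < a \<and> \<pi> s \<le> i. J s)"
        using Suc True by auto
      ultimately show ?thesis by linarith
    next
      case False
      have "i > 0"
      proof (rule ccontr)
        assume "\<not> i > 0"
        then have "\<forall>s. s < a \<longrightarrow> \<not> \<pi> s \<le> i" using ordering_range[OF \<pi>(1)] by fastforce
        then show False using False Suc.hyps(2) \<open>\<not> i > 0\<close> by auto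
      qed
      then obtain t where t: "t < a" "\<pi> t = i"
        using ordering_surj[OF \<pi>(1), of i] Suc.prems by auto
      have Jt: "J t = j"
      proof (cases "j = 0")
        case True
        then show ?thesis using Suc.prems(3)[of t] t by simp
      next
        case j: False
        then obtain s where s: "s < a" "\<pi> s \<le> i" "\<not> J s \<le> j - 1" using False by auto
        then have "J s \<le> J t" using Jmono t by simp
        then show ?thesis using s Suc.prems(3)[of t] t by simp
      qed
      have st: "step \<alpha> k a i (ms (i - 1)) (ms i) t"
        using step_of_ordering[OF \<pi>(1,3) ms(4) t] by simp
      have "nbhd E t \<subseteq> sel \<gamma> k b j (ps j)"
        using nb[OF t(1)] Jt ps(4)[of j] Suc.prems by (auto simp: nbhd_def)
      then have "g (i - 1) (ms (i - 1)) j (ps j) \<le> g i (ms i) j (ps j) + j"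
        using student st Suc.prems ms ps by blast
      moreover have "I \<le> g (i - 1) (ms (i - 1)) j (ps j) + (\<Sum>s | s < a \<and> \<pi> s \<le> i - 1. J s)"
        using Suc \<open>i > 0\<close> by auto
      moreover have "{s. s < a \<and> \<pi> s \<le> i} = insert t {s. s < a \<and> \<pi> s \<le> i - 1}"
        using prefix_insert[OF \<pi>(1) t(1)] t(2) by simp
      then have "(\<Sum>s | s < a \<and> \<pi> s \<le> i. J s) = j + (\<Sum>s | s < a \<and> \<pi> s \<le> i - 1. J s)"
        using t Jt \<open>i > 0\<close> by simp
      ultimately show ?thesis by linarith
    qed
  qed
  have "{s. s < a \<and> \<pi> s \<le> a} = {..<a}" using ordering_range[OF \<pi>(1)] by auto
  then have "I \<le> g a (2 ^ k - 1) b (2 ^ k - 1) + (\<Sum>s<a. J s)"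
    using main[of a b] ms ps Jb by auto
  also have "(\<Sum>s<a. J s) = card (SIGMA s:{..<a}. nbhd ?H s)"
    using finH by (simp add: J_def)
  also have "(SIGMA s:{..<a}. nbhd ?H s) = ?H" using E_sub Fs by (auto simp: nbhd_def)
  also have "card ?H = card E + card F"
    using Fs by (intro card_Un_disjoint finite_E) (auto intro: finite_subset)
  finally show ?thesis .
qed

end

subsection \<open>Programs with counted loops\<close>

text \<open>With counted loops as the only loops, every program terminates, its effect is a function
  \<open>sem\<close>, and its running time is controlled by the loop bounds alone.\<close>

datatype prog =
    PAsg vname exp
  | PSto vname exp exp
  | PSeq prog prog (infixr ";;" 60)
  | PWhen exp prog
  | PFor vname vname prog

definition setr :: "vname \<Rightarrow> nat \<Rightarrow> state \<Rightarrow> state" where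
  "setr x v \<sigma> = \<sigma>\<lparr>regs := (regs \<sigma>)(x := v)\<rparr>"

definition setm :: "vname \<Rightarrow> nat \<Rightarrow> nat \<Rightarrow> state \<Rightarrow> state" where
  "setm A i v \<sigma> = \<sigma>\<lparr>mem := (mem \<sigma>)(A := (mem \<sigma> A)(i := v))\<rparr>"

lemma regs_setr [simp]: "regs (setr x v \<sigma>) y = (if y = x then v else regs \<sigma> y)"
  and mem_setr [simp]: "mem (setr x v \<sigma>) = mem \<sigma>"
  and regs_setm [simp]: "regs (setm A i v \<sigma>) = regs \<sigma>"
  and mem_setm [simp]: "mem (setm A i v \<sigma>) B = (if B = A then (mem \<sigma> A)(i := v) else mem \<sigma> B)"
  by (simp_all add: setr_def setm_def)

primrec compile :: "prog \<Rightarrow> com" where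
  "compile (PAsg x e) = Assign x e"
| "compile (PSto A i e) = Store A i e"
| "compile (p ;; q) = Seq (compile p) (compile q)"
| "compile (PWhen e p) = Cond e (compile p) Skip"
| "compile (PFor i n p) = Seq (Assign i (Const 0))
     (While (Sub (Reg n) (Reg i)) (Seq (compile p) (Assign i (Add (Reg i) (Const 1)))))"

primrec sem :: "prog \<Rightarrow> state \<Rightarrow> state" where
  "sem (PAsg x e) \<sigma> = setr x (aval e \<sigma>) \<sigma>"
| "sem (PSto A i e) \<sigma> = setm A (aval i \<sigma>) (aval e \<sigma>) \<sigma>"
| "sem (p ;; q) \<sigma> = sem q (sem p \<sigma>)"
| "sem (PWhen e p) \<sigma> = (if aval e \<sigma> \<noteq> 0 then sem p \<sigma> else \<sigma>)"
| "sem (PFor i n p) \<sigma> =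
     ((\<lambda>\<tau>. setr i (Suc (regs \<tau> i)) (sem p \<tau>)) ^^ regs \<sigma> n) (setr i 0 \<sigma>)"

primrec wregs :: "prog \<Rightarrow> vname set" where
  "wregs (PAsg x e) = {x}"
| "wregs (PSto A i e) = {}"
| "wregs (p ;; q) = wregs p \<union> wregs q"
| "wregs (PWhen e p) = wregs p"
| "wregs (PFor i n p) = insert i (wregs p)"

primrec warrs :: "prog \<Rightarrow> vname set" where
  "warrs (PAsg x e) = {}"
| "warrs (PSto A i e) = {A}"
| "warrs (p ;; q) = warrs p \<union> warrs q"
| "warrs (PWhen e p) = warrs p"
| "warrs (PFor i n p) = warrs p"

primrec bounds :: "prog \<Rightarrow> vname set" where
  "bounds (PAsg x e) = {}"
| "bounds (PSto A i e) = {}"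
| "bounds (p ;; q) = bounds p \<union> bounds q"
| "bounds (PWhen e p) = bounds p"
| "bounds (PFor i n p) = insert n (bounds p)"

primrec counters_ok :: "prog \<Rightarrow> bool" where
  "counters_ok (PAsg x e) = True"
| "counters_ok (PSto A i e) = True"
| "counters_ok (p ;; q) = (counters_ok p \<and> counters_ok q)"
| "counters_ok (PWhen e p) = counters_ok p"
| "counters_ok (PFor i n p) = (counters_ok p \<and> i \<notin> wregs p)"

text \<open>An upper bound read off the initial registers. In a loop, \<open>6\<close> pays for the
  initialisation (2) and the failing test (4), and \<open>8\<close> for a successful test (4) and
  the increment (4).\<close>

primrec cost :: "prog \<Rightarrow> (vname \<Rightarrow> nat) \<Rightarrow> nat" where
  "cost (PAsg x e) \<rho> = 1 + ecost e"
| "cost (PSto A i e) \<rho> = 1 + ecost i + ecost e"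
| "cost (p ;; q) \<rho> = cost p \<rho> + cost q \<rho>"
| "cost (PWhen e p) \<rho> = 2 + ecost e + cost p \<rho>"
| "cost (PFor i n p) \<rho> = 6 + \<rho> n * (8 + cost p \<rho>)"

section \<open>Frame conditions, loop invariants and cost\<close>

definition frame :: "vname set \<Rightarrow> vname set \<Rightarrow> state \<Rightarrow> state \<Rightarrow> bool" where
  "frame X Y \<sigma> \<tau> \<longleftrightarrow> (\<forall>x. x \<notin> X \<longrightarrow> regs \<tau> x = regs \<sigma> x) \<and> (\<forall>A. A \<notin> Y \<longrightarrow> mem \<tau> A = mem \<sigma> A)"

lemma frame_refl: "frame X Y \<sigma> \<sigma>" by (simp add: frame_def)

lemma frame_trans: "frame X Y \<sigma> \<tau> \<Longrightarrow> frame X Y \<tau> \<upsilon> \<Longrightarrow> frame X Y \<sigma> \<upsilon>" by (simp add: frame_def)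

lemma frame_mono: "frame X Y \<sigma> \<tau> \<Longrightarrow> X \<subseteq> X' \<Longrightarrow> Y \<subseteq> Y' \<Longrightarrow> frame X' Y' \<sigma> \<tau>"
  unfolding frame_def by blast

lemma frame_sem: "frame (wregs p) (warrs p) \<sigma> (sem p \<sigma>)"
proof (induction p arbitrary: \<sigma>)
  case (PSeq p q)
  show ?case using frame_trans[of "wregs (p ;; q)" "warrs (p ;; q)" \<sigma> "sem p \<sigma>"]
      frame_mono[OF PSeq(1)] frame_mono[OF PSeq(2)] by simp
next
  case (PFor i n p)
  let ?f = "\<lambda>\<tau>. setr i (Suc (regs \<tau> i)) (sem p \<tau>)"
  have "frame (insert i (wregs p)) (warrs p) \<tau> (?f \<tau>)" for \<tau>
    using PFor[of \<tau>] by (simp add: frame_def)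
  then have "frame (insert i (wregs p)) (warrs p) \<tau> ((?f ^^ m) \<tau>)" for m \<tau>
    by (induction m) (auto simp: frame_refl intro: frame_trans)
  from this[of "setr i 0 \<sigma>" "regs \<sigma> n"] show ?case by (simp add: frame_def)
qed (auto simp: frame_def)

lemma regs_sem [simp]: "x \<notin> wregs p \<Longrightarrow> regs (sem p \<sigma>) x = regs \<sigma> x"
  and mem_sem [simp]: "A \<notin> warrs p \<Longrightarrow> mem (sem p \<sigma>) A = mem \<sigma> A"
  using frame_sem[of p \<sigma>] by (simp_all add: frame_def)

text \<open>Invariant rule for counted loops. The frame relative to the initial state comes for
  free, so an invariant needs to mention only what the body changes.\<close>

lemma For_inv:
  assumes i: "i \<notin> wregs p"
    and base: "I 0 (setr i 0 \<sigma>)"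
    and step: "\<And>c \<tau>. c < regs \<sigma> n \<Longrightarrow> frame (insert i (wregs p)) (warrs p) \<sigma> \<tau> \<Longrightarrow> regs \<tau> i = c \<Longrightarrow>
      I c \<tau> \<Longrightarrow> I (Suc c) (setr i (Suc c) (sem p \<tau>))"
  shows "I (regs \<sigma> n) (sem (PFor i n p) \<sigma>)"
proof -
  define f where "f = (\<lambda>\<tau>. setr i (Suc (regs \<tau> i)) (sem p \<tau>))"
  define \<sigma>' where "\<sigma>' = setr i 0 \<sigma>"
  have "frame (insert i (wregs p)) (warrs p) \<sigma> ((f ^^ c) \<sigma>') \<and>
      regs ((f ^^ c) \<sigma>') i = c \<and> I c ((f ^^ c) \<sigma>')" if "c \<le> regs \<sigma> n" for c
    using that
  proof (induction c)
    case 0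
    have "frame (insert i (wregs p)) (warrs p) \<sigma> \<sigma>'" "regs \<sigma>' i = 0" "I 0 \<sigma>'"
      using base by (simp_all add: frame_def \<sigma>'_def)
    then show ?case by simp
  next
    case (Suc c)
    let ?\<tau> = "(f ^^ c) \<sigma>'"
    have h: "frame (insert i (wregs p)) (warrs p) \<sigma> ?\<tau>" "regs ?\<tau> i = c" "I c ?\<tau>"
      using Suc by auto
    have "f \<tau> = setr i (Suc (regs \<tau> i)) (sem p \<tau>)" for \<tau> by (simp add: f_def)
    from this[of ?\<tau>] have "f ?\<tau> = setr i (Suc c) (sem p ?\<tau>)" by (simp only: h(2))
    moreover from this have "I (Suc c) (f ?\<tau>)" using step[OF _ h] Suc.prems by simp
    moreover have "frame (insert i (wregs p)) (warrs p) \<sigma> (f ?\<tau>)"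
      using h(1) frame_sem[of p ?\<tau>] by (simp add: frame_def f_def)
    ultimately show ?case by simp
  qed
  then show ?thesis by (simp add: f_def \<sigma>'_def)
qed

lemma cost_cong: "(\<And>x. x \<in> bounds p \<Longrightarrow> \<rho> x = \<rho>' x) \<Longrightarrow> cost p \<rho> = cost p \<rho>'"
  by (induction p) auto

text \<open>Registers used as loop bounds are never written, so they keep their initial values and
  \<open>cost\<close> may be evaluated in the initial state, even for the later parts of a
  program.\<close>

lemma exec_sem:
  assumes "counters_ok p" "bounds p \<inter> wregs p = {}"
  shows "\<exists>t \<le> cost p (regs \<sigma>). exec (compile p) \<sigma> t (sem p \<sigma>)"
  using assms
proof (induction p arbitrary: \<sigma>)
  case (PAsg x e)
  then show ?case using exec.Assign[of x e \<sigma>] by (auto simp: setr_def)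
next
  case (PSto A i e)
  then show ?case using exec.Store[of A i e \<sigma>] by (auto simp: setm_def)
next
  case (PSeq p q)
  obtain t1 where t1: "t1 \<le> cost p (regs \<sigma>)" "exec (compile p) \<sigma> t1 (sem p \<sigma>)"
    using PSeq.IH(1)[of \<sigma>] PSeq.prems by auto
  obtain t2 where t2: "t2 \<le> cost q (regs (sem p \<sigma>))" "exec (compile q) (sem p \<sigma>) t2 (sem q (sem p \<sigma>))"
    using PSeq.IH(2)[of "sem p \<sigma>"] PSeq.prems by auto
  have "cost q (regs (sem p \<sigma>)) = cost q (regs \<sigma>)"
    using PSeq.prems by (intro cost_cong regs_sem) auto
  then show ?case using t1 t2 exec.Seq[OF t1(2) t2(2)] by (intro exI[of _ "t1 + t2"]) simp
next
  case (PWhen e p)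
  show ?case
  proof (cases "aval e \<sigma> = 0")
    case True
    then show ?thesis using exec.CondFalse[OF True exec.Skip, of "compile p"]
      by (intro exI[of _ "1 + ecost e + 1"]) simp
  next
    case False
    obtain t where t: "t \<le> cost p (regs \<sigma>)" "exec (compile p) \<sigma> t (sem p \<sigma>)"
      using PWhen.IH[of \<sigma>] PWhen.prems by auto
    show ?thesis using exec.CondTrue[OF False t(2), of Skip] t(1) False
      by (intro exI[of _ "1 + ecost e + t"]) simp
  qed
next
  case (PFor i n p)
  let ?e = "Sub (Reg n) (Reg i)" and ?c = "Seq (compile p) (Assign i (Add (Reg i) (Const 1)))"
  let ?f = "\<lambda>\<tau>. setr i (Suc (regs \<tau> i)) (sem p \<tau>)"
  have n: "n \<noteq> i" "n \<notin> wregs p" and i: "i \<notin> wregs p" and p: "bounds p \<inter> wregs p = {}" "i \<notin> bounds p"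
    using PFor.prems by auto
  \<comment> \<open>Induction on the number \<open>d\<close> of remaining iterations, from an
    arbitrary value of the counter.\<close>
  have loop: "\<exists>t \<le> 4 + d * (8 + cost p (regs \<tau>)). exec (While ?e ?c) \<tau> t ((?f ^^ d) \<tau>)"
    if "regs \<tau> n = regs \<tau> i + d" for d \<tau>
    using that
  proof (induction d arbitrary: \<tau>)
    case 0
    then show ?case using exec.WhileFalse[of ?e \<tau> ?c] by (intro exI[of _ "1 + ecost ?e"]) simp
  next
    case (Suc d)
    obtain t1 where t1: "t1 \<le> cost p (regs \<tau>)" "exec (compile p) \<tau> t1 (sem p \<tau>)"
      using PFor.IH[of \<tau>] PFor.prems by auto
    have "exec (Assign i (Add (Reg i) (Const 1))) (sem p \<tau>) 4 (?f \<tau>)"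
      using exec.Assign[of i "Add (Reg i) (Const 1)" "sem p \<tau>"] i by (simp add: numeral_eq_Suc setr_def)
    then have body: "exec ?c \<tau> (t1 + 4) (?f \<tau>)" using exec.Seq[OF t1(2)] by blast
    have eq: "cost p (regs (?f \<tau>)) = cost p (regs \<tau>)"
      using p by (intro cost_cong) (auto intro!: regs_sem)
    have "regs (?f \<tau>) n = regs (?f \<tau>) i + d" using Suc.prems n by simp
    from Suc.IH[OF this, unfolded eq] obtain t2 where t2: "t2 \<le> 4 + d * (8 + cost p (regs \<tau>))"
      "exec (While ?e ?c) (?f \<tau>) t2 ((?f ^^ d) (?f \<tau>))"
      by blast
    have "exec (While ?e ?c) \<tau> (1 + ecost ?e + (t1 + 4) + t2) ((?f ^^ d) (?f \<tau>))"
      using exec.WhileTrue[OF _ body t2(2)] Suc.prems by simp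
    moreover have "(?f ^^ Suc d) \<tau> = (?f ^^ d) (?f \<tau>)" by (simp only: funpow_Suc_right o_apply)
    moreover have "1 + ecost ?e + (t1 + 4) + t2 \<le> 4 + Suc d * (8 + cost p (regs \<tau>))"
      using t1 t2 by simp
    ultimately show ?case by metis
  qed
  have eq: "cost p (regs (setr i 0 \<sigma>)) = cost p (regs \<sigma>)" using p by (intro cost_cong) auto
  have "regs (setr i 0 \<sigma>) n = regs (setr i 0 \<sigma>) i + regs \<sigma> n" using n by simp
  from loop[OF this, unfolded eq] obtain t where t: "t \<le> 4 + regs \<sigma> n * (8 + cost p (regs \<sigma>))"
    "exec (While ?e ?c) (setr i 0 \<sigma>) t ((?f ^^ regs \<sigma> n) (setr i 0 \<sigma>))"
    by blast
  have "exec (Assign i (Const 0)) \<sigma> 2 (setr i 0 \<sigma>)" using exec.Assign[of i "Const 0" \<sigma>] by (simp add: numeral_eq_Suc setr_def)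
  from exec.Seq[OF this t(2)] t(1) show ?case by (intro exI[of _ "2 + t"]) simp
qed

declare sem.simps(5) [simp del]

subsection \<open>Arithmetic tables\<close>

text \<open>Without multiplication, rows of two-dimensional arrays are addressed through tables of
  multiples: \<open>mN\<close>, \<open>mb\<close> and \<open>mV\<close> hold the multiples of \<open>N\<close>, \<open>b\<close> and \<open>V = (b + 1) N\<close>. Column \<open>0\<close>
  of the table \<open>T\<close> is constantly one and column \<open>l + 1\<close> holds bit \<open>l\<close> of every mask, so that
  membership of an element of rank \<open>r\<close> in the prefix of length \<open>i\<close> is read off column \<open>r + k - i\<close>, with
  truncated subtraction.\<close>

definition pScal :: prog where
  "pScal =
     PAsg ''z'' (Const 1) ;;
     PFor ''c'' ''k'' (PAsg ''z'' (Add (Reg ''z'') (Reg ''z''))) ;;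
     PAsg ''N'' (Reg ''z'') ;;
     PFor ''c'' ''k'' (PAsg ''N'' (Add (Reg ''N'') (Reg ''N''))) ;;
     PAsg ''z'' (Sub (Reg ''z'') (Const 1)) ;;
     PAsg ''U'' (Reg ''N'') ;;
     PFor ''c'' ''a'' (PAsg ''U'' (Add (Reg ''U'') (Reg ''N''))) ;;
     PAsg ''V'' (Reg ''N'') ;;
     PFor ''c'' ''b'' (PAsg ''V'' (Add (Reg ''V'') (Reg ''N''))) ;;
     PAsg ''A'' (Add (Reg ''a'') (Const 1)) ;;
     PAsg ''B'' (Add (Reg ''b'') (Const 1)) ;;
     PAsg ''w'' (Add (Reg ''k'') (Reg ''k'')) ;;
     PAsg ''n'' (Add (Reg ''a'') (Reg ''b'')) ;;
     PAsg ''R'' (Add (Add (Reg ''U'') (Reg ''V'')) (Add (Reg ''w'') (Const 1)))"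

definition pMul :: "vname \<Rightarrow> vname \<Rightarrow> prog" where
  "pMul A x =
     PAsg ''e'' (Const 0) ;;
     PFor ''c'' ''R'' (PSto A (Reg ''c'') (Reg ''e'') ;; PAsg ''e'' (Add (Reg ''e'') (Reg x)))"

text \<open>Bits without division: for \<open>m\<close> at least \<open>2 ^ l\<close>, bit
  \<open>l\<close> of \<open>m\<close> is the complement of bit \<open>l\<close> of
  \<open>m - 2 ^ l\<close>, which stands earlier in the same column; for smaller \<open>m\<close> it
  is \<open>0\<close>, the initial content. Register \<open>e\<close> holds
  \<open>2 ^ l\<close>.\<close>

definition pTrow :: prog where
  "pTrow = PFor ''m'' ''N'' (PWhen (Sub (Add (Reg ''m'') (Const 1)) (Reg ''e''))
     (PSto ''T'' (Add (Cell ''mN'' (Add (Reg ''i'') (Const 1))) (Reg ''m''))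
       (Sub (Const 1) (Cell ''T''
         (Sub (Add (Cell ''mN'' (Add (Reg ''i'') (Const 1))) (Reg ''m'')) (Reg ''e''))))))"

definition pT :: prog where
  "pT =
     PFor ''m'' ''N'' (PSto ''T'' (Reg ''m'') (Const 1)) ;;
     PAsg ''e'' (Const 1) ;;
     PFor ''i'' ''w'' (pTrow ;; PAsg ''e'' (Add (Reg ''e'') (Reg ''e'')))"

section \<open>Correctness of the arithmetic tables\<close>

lemma sem_double:
  assumes "c \<noteq> x"
  shows "regs (sem (PFor c n (PAsg x (Add (Reg x) (Reg x)))) \<sigma>) x = 2 ^ regs \<sigma> n * regs \<sigma> x"
  using assms
  by (intro For_inv[where I = "\<lambda>c \<tau>. regs \<tau> x = 2 ^ c * regs \<sigma> x"]) auto

lemma sem_sum: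
  assumes "c \<noteq> x" "y \<noteq> x" "y \<noteq> c"
  shows "regs (sem (PFor c n (PAsg x (Add (Reg x) (Reg y)))) \<sigma>) x = regs \<sigma> x + regs \<sigma> n * regs \<sigma> y"
  using assms
  by (intro For_inv[where I = "\<lambda>c \<tau>. regs \<tau> x = regs \<sigma> x + c * regs \<sigma> y"]) (auto simp: frame_def)

lemma sem_pMul:
  assumes "x \<notin> {''e'', ''c''}"
  shows "\<forall>i<regs \<sigma> ''R''. mem (sem (pMul A x) \<sigma>) A i = i * regs \<sigma> x"
proof -
  have x: "x \<noteq> ''e''" "x \<noteq> ''c''" using assms by auto
  let ?\<sigma> = "setr ''e'' 0 \<sigma>"
  have "(\<lambda>n \<tau>. regs \<tau> ''e'' = n * regs \<sigma> x \<and> (\<forall>i<n. mem \<tau> A i = i * regs \<sigma> x))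
    (regs ?\<sigma> ''R'') (sem (PFor ''c'' ''R'' (PSto A (Reg ''c'') (Reg ''e'') ;;
      PAsg ''e'' (Add (Reg ''e'') (Reg x)))) ?\<sigma>)"
    by (rule For_inv) (use x in \<open>auto simp: frame_def less_Suc_eq\<close>)
  then show ?thesis by (simp add: pMul_def)
qed

lemma wregs_pTrow [simp]: "wregs pTrow = {''m''}" and warrs_pTrow [simp]: "warrs pTrow = {''T''}"
  by (simp_all add: pTrow_def)

lemma bit_shift_down: "2 ^ l \<le> (m::nat) \<Longrightarrow> bit m l \<longleftrightarrow> \<not> bit (m - 2 ^ l) l"
  by (simp add: bit_iff_odd le_div_geq)

lemma bit_less: "(m::nat) < 2 ^ l \<Longrightarrow> l \<le> l' \<Longrightarrow> \<not> bit m l'"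
  using less_le_trans[OF _ power_increasing[of l l' "2::nat"], of m] by (simp add: bit_iff_odd)

lemma index_inj:
  fixes x y c d n :: nat
  assumes "c < n" "d < n"
  shows "x * n + c = y * n + d \<longleftrightarrow> x = y \<and> c = d"
proof
  assume h: "x * n + c = y * n + d"
  have "(x * n + c) div n = x" "(y * n + d) div n = y" using assms by auto
  then show "x = y \<and> c = d" using h by auto
qed auto

lemma sem_pTrow:
  assumes mN: "mem \<sigma> ''mN'' (Suc l) = Suc l * n" and n: "regs \<sigma> ''N'' = n" and l: "regs \<sigma> ''i'' = l"
    and e: "regs \<sigma> ''e'' = 2 ^ l" and zero: "\<forall>m<n. mem \<sigma> ''T'' (Suc l * n + m) = 0"
  shows "\<forall>x. mem (sem pTrow \<sigma>) ''T'' x =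
    (if \<exists>m<n. x = Suc l * n + m then of_bool (bit (x - Suc l * n) l) else mem \<sigma> ''T'' x)"
proof -
  let ?o = "Suc l * n"
  let ?p = "PWhen (Sub (Add (Reg ''m'') (Const 1)) (Reg ''e''))
     (PSto ''T'' (Add (Cell ''mN'' (Add (Reg ''i'') (Const 1))) (Reg ''m''))
       (Sub (Const 1) (Cell ''T''
         (Sub (Add (Cell ''mN'' (Add (Reg ''i'') (Const 1))) (Reg ''m'')) (Reg ''e'')))))"
  have "(\<lambda>c \<tau>. \<forall>x. mem \<tau> ''T'' x =
    (if \<exists>m<c. x = ?o + m then of_bool (bit (x - ?o) l) else mem \<sigma> ''T'' x)) (regs \<sigma> ''N'') (sem pTrow \<sigma>)"
    unfolding pTrow_def
  proof (rule For_inv)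
    fix c \<tau>
    assume c: "c < regs \<sigma> ''N''" and fr: "frame (insert ''m'' (wregs ?p))
      (warrs ?p) \<sigma> \<tau>"
      and rc: "regs \<tau> ''m'' = c"
      and I: "\<forall>x. mem \<tau> ''T'' x =
        (if \<exists>m<c. x = ?o + m then of_bool (bit (x - ?o) l) else mem \<sigma> ''T'' x)"
    have f: "regs \<tau> ''e'' = 2 ^ l" "regs \<tau> ''i'' = l" "mem \<tau> ''mN'' (Suc l) = ?o"
      using fr mN e l by (simp_all add: frame_def)
    have ex: "(\<exists>m<Suc c. x = ?o + m) \<longleftrightarrow> x = ?o + c \<or> (\<exists>m<c. x = ?o + m)" for x
      by (auto simp: less_Suc_eq)
    show "\<forall>x. mem (setr ''m'' (Suc c) (sem ?p \<tau>)) ''T'' x =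
      (if \<exists>m<Suc c. x = ?o + m then of_bool (bit (x - ?o) l) else mem \<sigma> ''T'' x)"
    proof (cases "2 ^ l \<le> c")
      case True
      moreover have "(0::nat) < 2 ^ l" by simp
      ultimately have "?o + c - 2 ^ l = ?o + (c - 2 ^ l)" "c - 2 ^ l < c" by linarith+
      then have "mem \<tau> ''T'' (?o + c - 2 ^ l) = of_bool (bit (c - 2 ^ l) l)" using I by auto
      then have "1 - mem \<tau> ''T'' (?o + c - 2 ^ l) = of_bool (bit c l)"
        using bit_shift_down[OF True] by simp
      then show ?thesis using True f rc I ex by (auto simp: Suc_diff_le)
    next
      case False
      then have "\<not> bit c l" using bit_less[of c l l] by simp
      moreover have "mem \<tau> ''T'' (?o + c) = 0" using I zero c n by auto
      ultimately show ?thesis using False f rc I ex by auto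
    qed
  qed auto
  then show ?thesis using n by simp
qed

lemma sem_pT:
  assumes R: "regs \<sigma> ''w'' < regs \<sigma> ''R''" and n: "regs \<sigma> ''N'' = n" and n2: "n = 2 ^ regs \<sigma> ''w''"
    and mN: "\<forall>x<regs \<sigma> ''R''. mem \<sigma> ''mN'' x = x * n"
    and zero: "mem \<sigma> ''T'' = (\<lambda>_. 0)" and m: "m < n"
  shows "mem (sem pT \<sigma>) ''T'' (x * n + m) = of_bool (x = 0 \<or> bit m (x - 1))"
proof -
  let ?p = "PFor ''m'' ''N'' (PSto ''T'' (Reg ''m'') (Const 1))"
  have "(\<lambda>c \<tau>. \<forall>x. mem \<tau> ''T'' x = of_bool (x < c)) (regs \<sigma> ''N'') (sem ?p \<sigma>)"
    by (rule For_inv) (use zero in \<open>auto simp: less_Suc_eq\<close>)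
  then have one: "mem (sem ?p \<sigma>) ''T'' x = of_bool (x < n)" for x using n by simp
  let ?\<sigma> = "setr ''e'' 1 (sem ?p \<sigma>)"
  let ?q = "pTrow ;; PAsg ''e'' (Add (Reg ''e'') (Reg ''e''))"
  have "(\<lambda>c \<tau>. regs \<tau> ''e'' = 2 ^ c \<and> (\<forall>x m. m < n \<longrightarrow>
      mem \<tau> ''T'' (x * n + m) = of_bool (x = 0 \<or> x \<le> c \<and> bit m (x - 1))))
    (regs ?\<sigma> ''w'') (sem (PFor ''i'' ''w'' ?q) ?\<sigma>)"
  proof (rule For_inv)
    have "x * n + m < n \<longleftrightarrow> x = 0" if "m < n" for x m using that by (cases x) auto
    then show "regs (setr ''i'' 0 ?\<sigma>) ''e'' = 2 ^ 0 \<and> (\<forall>x m. m < n \<longrightarrow>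
      mem (setr ''i'' 0 ?\<sigma>) ''T'' (x * n + m) = of_bool (x = 0 \<or> x \<le> 0 \<and> bit m (x - 1)))"
      using one by simp
  next
    fix c \<tau>
    assume c: "c < regs ?\<sigma> ''w''" and fr: "frame (insert ''i'' (wregs ?q)) (warrs ?q) ?\<sigma> \<tau>"
      and i: "regs \<tau> ''i'' = c" and I: "regs \<tau> ''e'' = 2 ^ c \<and> (\<forall>x m. m < n \<longrightarrow>
      mem \<tau> ''T'' (x * n + m) = of_bool (x = 0 \<or> x \<le> c \<and> bit m (x - 1)))"
    have f: "regs \<tau> ''N'' = n" "mem \<tau> ''mN'' (Suc c) = Suc c * n"
      using fr n mN R c by (simp_all add: frame_def)
    have "\<forall>m<n. mem \<tau> ''T'' (Suc c * n + m) = 0" using I by (simp del: mult_Suc)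
    note row = sem_pTrow[OF f(2,1) i conjunct1[OF I] this]
    have "mem (sem pTrow \<tau>) ''T'' (x * n + m) = of_bool (x = 0 \<or> x \<le> Suc c \<and> bit m (x - 1))"
      if m: "m < n" for x m
    proof (cases "x = Suc c")
      case True
      then show ?thesis using row m by (auto simp del: mult_Suc)
    next
      case False
      then have "\<not> (\<exists>m'<n. x * n + m = Suc c * n + m')"
        using index_inj[of m n _ x "Suc c"] m by blast
      then show ?thesis using row I m False by (auto simp del: mult_Suc simp: le_Suc_eq)
    qed
    then show "regs (setr ''i'' (Suc c) (sem ?q \<tau>)) ''e'' = 2 ^ Suc c \<and> (\<forall>x m. m < n \<longrightarrow>
      mem (setr ''i'' (Suc c) (sem ?q \<tau>)) ''T'' (x * n + m) = of_bool (x = 0 \<or> x \<le> Suc c \<and> bit m (x - 1)))"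
      using I by simp
  qed simp
  then have "mem (sem pT \<sigma>) ''T'' (x * n + m) =
      of_bool (x = 0 \<or> x \<le> regs \<sigma> ''w'' \<and> bit m (x - 1))"
    using m by (simp add: pT_def)
  \<comment> \<open>Columns beyond the last one filled still hold \<open>0\<close>, which is right
    because masks have only \<open>w\<close> bits.\<close>
  moreover have "\<not> bit m (x - 1)" if "\<not> x \<le> regs \<sigma> ''w''"
    using that m n2 by (intro bit_less[of m "regs \<sigma> ''w''"]) auto
  ultimately show ?thesis by auto
qed

definition pSetup :: prog where
  "pSetup = pMul ''mN'' ''N'' ;; pMul ''mb'' ''b'' ;; pMul ''mV'' ''V'' ;; pT"

lemma wregs_pMul [simp]: "wregs (pMul A x) = {''e'', ''c''}"
  and warrs_pMul [simp]: "warrs (pMul A x) = {A}"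
  by (auto simp: pMul_def)

lemma wregs_pT [simp]: "wregs pT = {''m'', ''e'', ''i''}" and warrs_pT [simp]: "warrs pT = {''T''}"
  by (auto simp: pT_def)

text \<open>Registers and, below, arrays that are read-only after the setup; any program that avoids
  them preserves \<open>ctx\<close>.\<close>

definition ctx_regs :: "vname set" where
  "ctx_regs = {''a'', ''b'', ''k'', ''z'', ''N'', ''A'', ''B'', ''n''}"

definition ctx_arrs :: "vname set" where
  "ctx_arrs = {''alpha'', ''gamma'', ''E'', ''mN'', ''mb'', ''mV'', ''T''}"

context chain_inst
begin

definition N :: nat where "N = 2 ^ (k + k)"
definition z :: nat where "z = 2 ^ k - 1"
definition V :: nat where "V = Suc b * N"
text \<open>Exceeds every index at which a table of multiples is consulted: numbers
  \<open>i * N + m\<close> of prefixes on either side, sums of a rank and \<open>k\<close>, and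
  student labels.\<close>

definition R :: nat where "R = Suc a * N + Suc b * N + (k + k) + 1"

lemma N_pos [simp]: "0 < N" by (simp add: N_def)

lemma z_less: "z < N"
proof -
  have "(1::nat) \<le> 2 ^ k" "(2::nat) ^ k \<le> 2 ^ (k + k)" by (auto intro: power_increasing)
  then show ?thesis unfolding z_def N_def by linarith
qed

definition ctx :: "state \<Rightarrow> bool" where
  "ctx \<sigma> \<longleftrightarrow> regs \<sigma> ''a'' = a \<and> regs \<sigma> ''b'' = b \<and> regs \<sigma> ''k'' = k \<and> regs \<sigma> ''z'' = z \<and>
     regs \<sigma> ''N'' = N \<and> regs \<sigma> ''A'' = Suc a \<and> regs \<sigma> ''B'' = Suc b \<and> regs \<sigma> ''n'' = a + b \<and>
     (\<forall>s<a. mem \<sigma> ''alpha'' s = \<alpha> s) \<and> (\<forall>q<b. mem \<sigma> ''gamma'' q = \<gamma> q) \<and>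
     (\<forall>s<a. \<forall>q<b. mem \<sigma> ''E'' (s * b + q) = of_bool ((s, q) \<in> E)) \<and>
     (\<forall>x<R. mem \<sigma> ''mN'' x = x * N) \<and> (\<forall>x<R. mem \<sigma> ''mb'' x = x * b) \<and>
     (\<forall>x<R. mem \<sigma> ''mV'' x = x * V) \<and>
     (\<forall>x m. m < N \<longrightarrow> mem \<sigma> ''T'' (x * N + m) = of_bool (x = 0 \<or> bit m (x - 1)))"

lemma ctxD:
  assumes "ctx \<sigma>"
  shows "regs \<sigma> ''a'' = a" "regs \<sigma> ''b'' = b" "regs \<sigma> ''k'' = k" "regs \<sigma> ''z'' = z" "regs \<sigma> ''N'' = N"
    "regs \<sigma> ''A'' = Suc a" "regs \<sigma> ''B'' = Suc b" "regs \<sigma> ''n'' = a + b"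
    "s < a \<Longrightarrow> mem \<sigma> ''alpha'' s = \<alpha> s" "q < b \<Longrightarrow> mem \<sigma> ''gamma'' q = \<gamma> q"
    "s < a \<Longrightarrow> q < b \<Longrightarrow> mem \<sigma> ''E'' (s * b + q) = of_bool ((s, q) \<in> E)"
    "x < R \<Longrightarrow> mem \<sigma> ''mN'' x = x * N" "x < R \<Longrightarrow> mem \<sigma> ''mb'' x = x * b"
    "x < R \<Longrightarrow> mem \<sigma> ''mV'' x = x * V"
    "m < N \<Longrightarrow> mem \<sigma> ''T'' (x * N + m) = of_bool (x = 0 \<or> bit m (x - 1))"
  using assms by (simp_all add: ctx_def)

lemma ctx_frame:
  assumes "ctx \<sigma>" "frame X Y \<sigma> \<tau>" "X \<inter> ctx_regs = {}" "Y \<inter> ctx_arrs = {}"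
  shows "ctx \<tau>"
proof -
  have "regs \<tau> x = regs \<sigma> x" if "x \<in> ctx_regs" for x using assms that by (auto simp: frame_def)
  moreover have "mem \<tau> A = mem \<sigma> A" if "A \<in> ctx_arrs" for A using assms that by (auto simp: frame_def)
  ultimately show ?thesis using assms(1) by (simp add: ctx_def ctx_regs_def ctx_arrs_def)
qed

lemma ctx_setr [simp]: "x \<notin> ctx_regs \<Longrightarrow> ctx \<sigma> \<Longrightarrow> ctx (setr x v \<sigma>)"
  by (rule ctx_frame[of \<sigma> "{x}" "{}"]) (auto simp: frame_def)

lemma ctx_setm [simp]: "A \<notin> ctx_arrs \<Longrightarrow> ctx \<sigma> \<Longrightarrow> ctx (setm A i v \<sigma>)"
  by (rule ctx_frame[of \<sigma> "{}" "{A}"]) (auto simp: frame_def)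

lemma ctx_sem: "ctx \<sigma> \<Longrightarrow> wregs p \<inter> ctx_regs = {} \<Longrightarrow> warrs p \<inter> ctx_arrs = {} \<Longrightarrow> ctx (sem p \<sigma>)"
  using ctx_frame frame_sem by blast

lemma T_lookup:
  assumes "ctx \<sigma>" "\<omega> x + k < R" "x < n" "m < N"
  shows "mem \<sigma> ''T'' (mem \<sigma> ''mN'' (\<omega> x + k - i) + m) = of_bool (x \<in> sel \<omega> k n i m)"
proof -
  have "\<omega> x + k - i < R" using assms by linarith
  then show ?thesis using assms ctxD(12,15)[OF assms(1)] by (auto simp: sel_def)
qed

lemma N_mult_ge: "x \<le> x * N" by (simp add: N_def)

lemma R_bound: "Suc a * N + Suc b * N + k + k < R" by (simp add: R_def)

lemma alpha_k_R: "s < a \<Longrightarrow> \<alpha> s + k < R"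
  using ordering_range[OF \<alpha>, of s] N_mult_ge[of "Suc a"] R_bound by linarith

lemma gamma_k_R: "q < b \<Longrightarrow> \<gamma> q + k < R"
  using ordering_range[OF \<gamma>, of q] N_mult_ge[of "Suc b"] R_bound by linarith

lemma T_gamma: "ctx \<sigma> \<Longrightarrow> q < b \<Longrightarrow> m < N \<Longrightarrow>
    mem \<sigma> ''T'' (mem \<sigma> ''mN'' (mem \<sigma> ''gamma'' q + k - i) + m) = of_bool (q \<in> sel \<gamma> k b i m)"
  using T_lookup[of \<sigma> \<gamma> q] gamma_k_R by (simp add: ctxD)

abbreviation input :: state where "input \<equiv> input_state a b E \<alpha> \<gamma> k"

lemma regs_pScal:
  assumes i: "regs \<sigma> ''a'' = a" "regs \<sigma> ''b'' = b" "regs \<sigma> ''k'' = k"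
  shows "regs (sem pScal \<sigma>) ''a'' = a" "regs (sem pScal \<sigma>) ''b'' = b" "regs (sem pScal \<sigma>) ''k'' = k"
    "regs (sem pScal \<sigma>) ''z'' = z" "regs (sem pScal \<sigma>) ''N'' = N" "regs (sem pScal \<sigma>) ''A'' = Suc a"
    "regs (sem pScal \<sigma>) ''B'' = Suc b" "regs (sem pScal \<sigma>) ''n'' = a + b" "regs (sem pScal \<sigma>) ''V'' = V"
    "regs (sem pScal \<sigma>) ''w'' = k + k" "regs (sem pScal \<sigma>) ''R'' = R"
  unfolding pScal_def using i
  by (simp_all add: sem_double sem_sum N_def z_def V_def R_def power_add)

lemma warrs_pScal [simp]: "warrs pScal = {}" by (simp add: pScal_def)

lemma input_regs: "regs input ''a'' = a" "regs input ''b'' = b" "regs input ''k'' = k"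
  by (simp_all add: input_state_def)

lemma ctx_setup: "ctx (sem pSetup (sem pScal input))"
proof -
  define \<sigma>0 where "\<sigma>0 = sem pScal input"
  define \<sigma>1 where "\<sigma>1 = sem (pMul ''mN'' ''N'') \<sigma>0"
  define \<sigma>2 where "\<sigma>2 = sem (pMul ''mb'' ''b'') \<sigma>1"
  define \<sigma>3 where "\<sigma>3 = sem (pMul ''mV'' ''V'') \<sigma>2"
  have m0: "mem \<sigma>0 = mem input" by (rule ext) (simp add: \<sigma>0_def)
  note r0 = regs_pScal[OF input_regs, folded \<sigma>0_def]
  have r: "regs \<sigma>3 x = regs \<sigma>0 x" "regs \<sigma>2 x = regs \<sigma>0 x" "regs \<sigma>1 x = regs \<sigma>0 x"
    if "x \<notin> {''e'', ''c''}" for x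
    using that by (simp_all add: \<sigma>3_def \<sigma>2_def \<sigma>1_def)
  have "\<forall>x<R. mem \<sigma>1 ''mN'' x = x * N"
    using sem_pMul[of "''N''" \<sigma>0 "''mN''"] r0 by (simp add: \<sigma>1_def)
  then have mN: "\<forall>x<R. mem \<sigma>3 ''mN'' x = x * N" by (simp add: \<sigma>3_def \<sigma>2_def)
  have "\<forall>x<R. mem \<sigma>2 ''mb'' x = x * b"
    using sem_pMul[of "''b''" \<sigma>1 "''mb''"] r0 r by (simp add: \<sigma>2_def)
  then have mb: "\<forall>x<R. mem \<sigma>3 ''mb'' x = x * b" by (simp add: \<sigma>3_def)
  have mV: "\<forall>x<R. mem \<sigma>3 ''mV'' x = x * V"
    using sem_pMul[of "''V''" \<sigma>2 "''mV''"] r0 r by (simp add: \<sigma>3_def)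
  have m: "mem \<sigma>3 A = mem input A" if "A \<notin> {''mN'', ''mb'', ''mV''}" for A
    using that m0 by (simp add: \<sigma>3_def \<sigma>2_def \<sigma>1_def)
  have "mem \<sigma>3 ''T'' = (\<lambda>_. 0)" by (simp add: m) (simp add: input_state_def)
  then have T: "mem (sem pT \<sigma>3) ''T'' (x * N + m) = of_bool (x = 0 \<or> bit m (x - 1))" if "m < N" for x m
    using sem_pT[of \<sigma>3 N m x] that r r0 mN by (simp add: N_def R_def)
  have "s * b + q < a * b" if "s < a" "q < b" for s q
  proof -
    have "s * b + q < Suc s * b" using that by simp
    also have "\<dots> \<le> a * b" using that by (intro mult_le_mono1) simp
    finally show ?thesis .
  qed
  then have "ctx (sem pT \<sigma>3)"
    unfolding ctx_def using r r0 T mN mb mV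
    by (simp add: m del: One_nat_def) (simp add: input_state_def)
  then show ?thesis by (simp add: pSetup_def \<sigma>3_def \<sigma>2_def \<sigma>1_def \<sigma>0_def)
qed

end

subsection \<open>Transition tables\<close>

definition eT :: "vname \<Rightarrow> exp \<Rightarrow> exp \<Rightarrow> exp \<Rightarrow> exp" where
  "eT arr x i m = Cell ''T'' (Add (Cell ''mN'' (Sub (Add (Cell arr x) (Reg ''k'')) i)) m)"

text \<open>Absolute difference: at least one of the two truncated differences is
  \<open>0\<close>.\<close>

definition eDiff :: "exp \<Rightarrow> exp \<Rightarrow> exp" where
  "eDiff e f = Add (Sub e f) (Sub f e)"

lemma aval_eDiff: "aval (eDiff e f) \<sigma> = 0 \<longleftrightarrow> aval e \<sigma> = aval f \<sigma>"
  by (auto simp: eDiff_def)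

text \<open>The registers \<open>t\<close> and \<open>m\<close> hold masks of prefixes of length \<open>i\<close> and \<open>i + 1\<close>. The flag \<open>g\<close> stays
  \<open>1\<close> iff the second prefix arises from the first by adding the single new element \<open>s\<close>.\<close>

definition pMatch :: "vname \<Rightarrow> vname \<Rightarrow> prog" where
  "pMatch nr arr = PFor ''r'' nr (PAsg ''g'' (Sub (Reg ''g'')
     (eDiff (eT arr (Reg ''r'') (Add (Reg ''i'') (Const 1)) (Reg ''m''))
       (Add (eT arr (Reg ''r'') (Reg ''i'') (Reg ''t'')) (Sub (Const 1) (eDiff (Reg ''s'') (Reg ''r'')))))))"

definition pEntry :: "vname \<Rightarrow> vname \<Rightarrow> vname \<Rightarrow> prog" where
  "pEntry nr arr tab =
     PAsg ''g'' (Sub (Const 1) (Add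
       (Sub (Cell arr (Reg ''s'')) (Add (Add (Reg ''i'') (Const 1)) (Reg ''k'')))
       (Sub (Add (Reg ''i'') (Const 1)) (Add (Cell arr (Reg ''s'')) (Reg ''k''))))) ;;
     pMatch nr arr ;;
     PWhen (Reg ''g'') (PSto tab
       (Add (Cell ''mN'' (Add (Cell ''mN'' (Add (Reg ''i'') (Const 1))) (Reg ''m''))) (Reg ''t''))
       (Add (Reg ''s'') (Const 1)))"

definition pStep :: "vname \<Rightarrow> vname \<Rightarrow> vname \<Rightarrow> prog" where
  "pStep nr arr tab =
     PFor ''i'' nr (PFor ''m'' ''N'' (PFor ''t'' ''N'' (PFor ''s'' nr (pEntry nr arr tab))))"

lemma wregs_pMatch [simp]: "wregs (pMatch nr arr) = {''r'', ''g''}"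
  and warrs_pMatch [simp]: "warrs (pMatch nr arr) = {}"
  and wregs_pEntry [simp]: "wregs (pEntry nr arr tab) = {''r'', ''g''}"
  and warrs_pEntry [simp]: "warrs (pEntry nr arr tab) = {tab}"
  by (auto simp: pMatch_def pEntry_def)

lemma wregs_pStep [simp]: "wregs (pStep nr arr tab) = {''i'', ''m'', ''t'', ''s'', ''r'', ''g''}"
  and warrs_pStep [simp]: "warrs (pStep nr arr tab) = {tab}"
  by (auto simp: pStep_def)

text \<open>The transition tables of students and questions come from the same code; this locale
  treats both at once.\<close>

locale side = chain_inst +
  fixes nr arr tab :: vname and n :: nat and \<omega> :: "nat \<Rightarrow> nat"
  assumes side: "nr = ''a'' \<and> arr = ''alpha'' \<and> tab = ''tS'' \<and> n = a \<and> \<omega> = \<alpha> \<or>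
    nr = ''b'' \<and> arr = ''gamma'' \<and> tab = ''tQ'' \<and> n = b \<and> \<omega> = \<gamma>"
begin

lemma nr_neq [simp]: "nr \<noteq> ''r''" "nr \<noteq> ''g''" "nr \<noteq> ''i''" "nr \<noteq> ''m''" "nr \<noteq> ''t''" "nr \<noteq> ''s''"
  and tab_notin [simp]: "tab \<notin> ctx_arrs"
  using side by (auto simp: ctx_arrs_def)

lemma side_ctx:
  assumes "ctx \<sigma>"
  shows "regs \<sigma> nr = n" "x < n \<Longrightarrow> mem \<sigma> arr x = \<omega> x"
  using side ctxD[OF assms] by auto

lemma side_R: "Suc n * N \<le> Suc a * N + Suc b * N" "x < n \<Longrightarrow> \<omega> x + k < R"
  using side alpha_k_R gamma_k_R by auto

text \<open>Adding \<open>s\<close> as a numerical equation per element. At \<open>r = s\<close> it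
  also forces \<open>s\<close> to be new, because the right-hand side would otherwise be
  \<open>2\<close>; at all other \<open>r\<close> it says that membership is unchanged.\<close>

definition hit :: "nat \<Rightarrow> nat \<Rightarrow> nat \<Rightarrow> nat \<Rightarrow> nat \<Rightarrow> bool" where
  "hit i t m s r \<longleftrightarrow>
     of_bool (r \<in> sel \<omega> k n (Suc i) m) = (of_bool (r \<in> sel \<omega> k n i t) + of_bool (r = s) :: nat)"

lemma step_iff_hits:
  assumes "s < n"
  shows "step \<omega> k n (Suc i) t m s \<longleftrightarrow> \<omega> s \<le> Suc i + k \<and> Suc i \<le> \<omega> s + k \<and> (\<forall>r<n. hit i t m s r)"
proof
  assume h: "step \<omega> k n (Suc i) t m s"
  then show "\<omega> s \<le> Suc i + k \<and> Suc i \<le> \<omega> s + k \<and> (\<forall>r<n. hit i t m s r)"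
    by (auto simp: step_def hit_def)
next
  assume h: "\<omega> s \<le> Suc i + k \<and> Suc i \<le> \<omega> s + k \<and> (\<forall>r<n. hit i t m s r)"
  have "hit i t m s s" using h assms by blast
  then have "s \<notin> sel \<omega> k n i t"
    by (cases "s \<in> sel \<omega> k n i t"; cases "s \<in> sel \<omega> k n (Suc i) m") (simp_all add: hit_def)
  moreover have "r \<in> sel \<omega> k n (Suc i) m \<longleftrightarrow> r \<in> insert s (sel \<omega> k n i t)" for r
  proof (cases "r < n")
    case True
    then have "hit i t m s r" using h by blast
    then show ?thesis by (cases "r = s"; cases "r \<in> sel \<omega> k n i t"; cases "r \<in> sel \<omega> k n (Suc i) m") (simp_all add: hit_def)
  next
    case False
    then show ?thesis using assms by (auto simp: sel_def)
  qed
  ultimately show "step \<omega> k n (Suc i) t m s" using h assms unfolding step_def by auto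
qed

lemma aval_eT:
  assumes "ctx \<sigma>" "aval x \<sigma> < n" "aval m \<sigma> < N"
  shows "aval (eT arr x i m) \<sigma> = of_bool (aval x \<sigma> \<in> sel \<omega> k n (aval i \<sigma>) (aval m \<sigma>))"
  using T_lookup[of \<sigma> \<omega> "aval x \<sigma>" n "aval m \<sigma>" "aval i \<sigma>"] assms side_R side_ctx[OF assms(1)] ctxD(3)[OF assms(1)]
  by (simp add: eT_def)

text \<open>A conjunction without branching: \<open>g\<close> is \<open>0\<close> or
  \<open>1\<close>, so truncated subtraction of a nonzero difference makes it \<open>0\<close> for
  good, and subtraction of \<open>0\<close> keeps it.\<close>

lemma sem_pMatch:
  assumes "ctx \<sigma>" "regs \<sigma> ''i'' = i" "regs \<sigma> ''m'' = m" "regs \<sigma> ''t'' = t" "regs \<sigma> ''s'' = s"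
    "m < N" "t < N" "regs \<sigma> ''g'' = of_bool P"
  shows "regs (sem (pMatch nr arr) \<sigma>) ''g'' = of_bool (P \<and> (\<forall>r<n. hit i t m s r))"
proof -
  let ?e = "eT arr (Reg ''r'') (Add (Reg ''i'') (Const 1)) (Reg ''m'')"
  let ?f = "Add (eT arr (Reg ''r'') (Reg ''i'') (Reg ''t'')) (Sub (Const 1) (eDiff (Reg ''s'') (Reg ''r'')))"
  let ?p = "PAsg ''g'' (Sub (Reg ''g'') (eDiff ?e ?f))"
  have "(\<lambda>c \<tau>. regs \<tau> ''g'' = of_bool (P \<and> (\<forall>r<c. hit i t m s r))) (regs \<sigma> nr) (sem (pMatch nr arr) \<sigma>)"
    unfolding pMatch_def
  proof (rule For_inv)
    fix c \<tau>
    assume c: "c < regs \<sigma> nr" and fr: "frame (insert ''r'' (wregs ?p)) (warrs ?p) \<sigma> \<tau>"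
      and r: "regs \<tau> ''r'' = c" and I: "regs \<tau> ''g'' = of_bool (P \<and> (\<forall>r<c. hit i t m s r))"
    have ctx: "ctx \<tau>" by (rule ctx_frame[OF assms(1) fr]) (auto simp: ctx_regs_def)
    have f: "regs \<tau> ''i'' = i" "regs \<tau> ''m'' = m" "regs \<tau> ''t'' = t" "regs \<tau> ''s'' = s"
      using fr assms by (simp_all add: frame_def)
    have c: "c < n" using c side_ctx assms by simp
    have "aval (Sub (Const 1) (eDiff (Reg ''s'') (Reg ''r''))) \<tau> = of_bool (c = s)"
      using f r by (auto simp: eDiff_def)
    then have "aval (eDiff ?e ?f) \<tau> = 0 \<longleftrightarrow> hit i t m s c"
      using f r c assms by (simp add: aval_eDiff aval_eT[OF ctx] hit_def)
    moreover have "regs (setr ''r'' (Suc c) (sem ?p \<tau>)) ''g'' = regs \<tau> ''g'' - aval (eDiff ?e ?f) \<tau>"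
      by simp
    moreover have "(\<forall>r<Suc c. hit i t m s r) \<longleftrightarrow> (\<forall>r<c. hit i t m s r) \<and> hit i t m s c"
      by (auto simp: less_Suc_eq)
    ultimately show "regs (setr ''r'' (Suc c) (sem ?p \<tau>)) ''g'' = of_bool (P \<and> (\<forall>r<Suc c. hit i t m s r))"
      using I by (cases "hit i t m s c") (auto split: if_splits simp del: sem.simps)
  qed (use assms in auto)
  then show ?thesis using side_ctx assms by simp
qed

lemma sem_pEntry:
  assumes "ctx \<sigma>" "regs \<sigma> ''i'' = i" "regs \<sigma> ''m'' = m" "regs \<sigma> ''t'' = t" "regs \<sigma> ''s'' = s"
    "i < n" "m < N" "t < N" "s < n"
  shows "mem (sem (pEntry nr arr tab) \<sigma>) tab = (if step \<omega> k n (Suc i) t m s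
    then (mem \<sigma> tab)((Suc i * N + m) * N + t := Suc s) else mem \<sigma> tab)"
proof -
  let ?P = "\<omega> s \<le> Suc i + k \<and> Suc i \<le> \<omega> s + k"
  let ?\<sigma> = "setr ''g'' (of_bool ?P) \<sigma>"
  have ctx: "ctx ?\<sigma>" using assms(1) by (simp add: ctx_regs_def)
  have g: "regs (sem (pMatch nr arr) ?\<sigma>) ''g'' = of_bool (step \<omega> k n (Suc i) t m s)"
    using sem_pMatch[OF ctx, of i m t s ?P] assms by (simp add: step_iff_hits)
  have "Suc i * N + m < Suc (Suc i) * N" "Suc (Suc i) * N \<le> Suc n * N"
    using assms mult_le_mono1[of "Suc (Suc i)" "Suc n" N] by auto
  then have u: "Suc i * N + m < R" using side_R(1) R_bound by linarith
  moreover have "Suc i < R" using u N_mult_ge[of "Suc i"] by linarith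
  ultimately have mN: "mem \<sigma> ''mN'' (Suc i) = Suc i * N" "mem \<sigma> ''mN'' (Suc i * N + m) = (Suc i * N + m) * N"
    using ctxD(12)[OF assms(1)] by blast+
  \<comment> \<open>Both truncated excesses vanish iff position \<open>i + 1\<close> is within
    \<open>k\<close> of the rank of \<open>s\<close>, so the flag starts as the nearness
    test.\<close>
  have "sem (PAsg ''g'' (Sub (Const 1) (Add
       (Sub (Cell arr (Reg ''s'')) (Add (Add (Reg ''i'') (Const 1)) (Reg ''k'')))
       (Sub (Add (Reg ''i'') (Const 1)) (Add (Cell arr (Reg ''s'')) (Reg ''k'')))))) \<sigma> = ?\<sigma>"
    using assms side_ctx[OF assms(1)] ctxD(3)[OF assms(1)] by (auto intro!: arg_cong[of _ _ "\<lambda>v. setr ''g'' v \<sigma>"])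
  then have "sem (pEntry nr arr tab) \<sigma> = sem (PWhen (Reg ''g'') (PSto tab
       (Add (Cell ''mN'' (Add (Cell ''mN'' (Add (Reg ''i'') (Const 1))) (Reg ''m''))) (Reg ''t''))
       (Add (Reg ''s'') (Const 1)))) (sem (pMatch nr arr) ?\<sigma>)"
    unfolding pEntry_def sem.simps(3) by (simp only:)
  then show ?thesis using g mN assms by (simp del: mult_Suc)
qed

definition entry_ok :: "nat \<Rightarrow> nat \<Rightarrow> nat \<Rightarrow> nat \<Rightarrow> bool" where
  "entry_ok i m t l \<longleftrightarrow> ((\<exists>x. step \<omega> k n i t m x) \<longrightarrow> l \<noteq> 0) \<and> (l \<noteq> 0 \<longrightarrow> step \<omega> k n i t m (l - 1))"

text \<open>The loops visit the cells in increasing order of index, so a single number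
  \<open>c\<close> measures progress through all of them. Unvisited cells must be \<open>0\<close>,
  since a cell without a transition is never written.\<close>

definition filled :: "nat \<Rightarrow> state \<Rightarrow> bool" where
  "filled c \<tau> \<longleftrightarrow> (\<forall>i m t. m < N \<longrightarrow> t < N \<longrightarrow>
     (if (i * N + m) * N + t < c then entry_ok i m t (mem \<tau> tab ((i * N + m) * N + t))
      else mem \<tau> tab ((i * N + m) * N + t) = 0))"

lemma filled_mem: "mem \<tau> tab = mem \<tau>' tab \<Longrightarrow> filled c \<tau> = filled c \<tau>'"
  by (simp add: filled_def)

lemma index3_inj:
  assumes "m < N" "t < N" "m' < N" "t' < N"
  shows "(i * N + m) * N + t = (i' * N + m') * N + t' \<longleftrightarrow> i = i' \<and> m = m' \<and> t = t'"
  using assms by (simp add: index_inj)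

lemma sem_s_loop:
  assumes ctx: "ctx \<sigma>" and reg: "regs \<sigma> ''i'' = i" "regs \<sigma> ''m'' = m" "regs \<sigma> ''t'' = t"
    and rng: "i < n" "m < N" "t < N" and f: "filled ((Suc i * N + m) * N + t) \<sigma>"
  shows "filled (Suc ((Suc i * N + m) * N + t)) (sem (PFor ''s'' nr (pEntry nr arr tab)) \<sigma>)"
proof -
  let ?y = "(Suc i * N + m) * N + t" and ?p = "pEntry nr arr tab"
  \<comment> \<open>The cell is nonzero once some transition was found, and whatever it holds is a
    valid transition; which \<open>s\<close> was written last does not matter.\<close>
  let ?I = "\<lambda>c \<tau>. (\<forall>x. x \<noteq> ?y \<longrightarrow> mem \<tau> tab x = mem \<sigma> tab x) \<and>
    ((\<exists>s<c. step \<omega> k n (Suc i) t m s) \<longrightarrow> mem \<tau> tab ?y \<noteq> 0) \<and>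
    (mem \<tau> tab ?y \<noteq> 0 \<longrightarrow> step \<omega> k n (Suc i) t m (mem \<tau> tab ?y - 1))"
  have "?I (regs \<sigma> nr) (sem (PFor ''s'' nr ?p) \<sigma>)"
  proof (rule For_inv)
    have "mem \<sigma> tab ?y = 0" using f rng unfolding filled_def by (meson less_irrefl)
    then show "?I 0 (setr ''s'' 0 \<sigma>)" by simp
  next
    fix c \<tau>
    assume c: "c < regs \<sigma> nr" and fr: "frame (insert ''s'' (wregs ?p)) (warrs ?p) \<sigma> \<tau>"
      and s: "regs \<tau> ''s'' = c" and I: "?I c \<tau>"
    have ctx': "ctx \<tau>" by (rule ctx_frame[OF ctx fr]) (auto simp: ctx_regs_def)
    have f: "regs \<tau> ''i'' = i" "regs \<tau> ''m'' = m" "regs \<tau> ''t'' = t"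
      using fr reg by (simp_all add: frame_def)
    have c: "c < n" using c side_ctx ctx by simp
    note e = sem_pEntry[OF ctx' f s rng c]
    show "?I (Suc c) (setr ''s'' (Suc c) (sem ?p \<tau>))"
    proof (cases "step \<omega> k n (Suc i) t m c")
      case True
      then show ?thesis using I e by (simp del: mult_Suc)
    next
      case False
      then have "(\<exists>s<Suc c. step \<omega> k n (Suc i) t m s) \<longleftrightarrow> (\<exists>s<c. step \<omega> k n (Suc i) t m s)"
        using less_Suc_eq by auto
      then show ?thesis using I e False by (simp del: mult_Suc)
    qed
  qed simp
  moreover have "regs \<sigma> nr = n" using side_ctx ctx by simp
  ultimately have I: "?I n (sem (PFor ''s'' nr ?p) \<sigma>)" by simp
  have "entry_ok (Suc i) m t (mem (sem (PFor ''s'' nr ?p) \<sigma>) tab ?y)"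
    using I unfolding entry_ok_def by (auto simp: step_def)
  then show ?thesis
    using f I rng index3_inj[of m t _ _ "Suc i"] unfolding filled_def
    by (smt (verit) less_Suc_eq)
qed

lemma sem_pStep:
  assumes ctx: "ctx \<sigma>" and zero: "mem \<sigma> tab = (\<lambda>_. 0)"
  shows "filled (Suc n * N * N) (sem (pStep nr arr tab) \<sigma>)"
proof -
  let ?s = "PFor ''s'' nr (pEntry nr arr tab)"
  let ?t = "PFor ''t'' ''N'' ?s"
  let ?m = "PFor ''m'' ''N'' ?t"
  have ws: "wregs ?s = {''s'', ''r'', ''g''}" "warrs ?s = {tab}" by auto
  have wt: "wregs ?t = {''t'', ''s'', ''r'', ''g''}" "warrs ?t = {tab}" by auto
  have wm: "wregs ?m = {''m'', ''t'', ''s'', ''r'', ''g''}" "warrs ?m = {tab}" by auto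
  have t: "filled ((Suc i * N + Suc m) * N) (sem ?t \<tau>)"
    if ctx: "ctx \<tau>" and reg: "regs \<tau> ''i'' = i" "regs \<tau> ''m'' = m" and rng: "i < n" "m < N"
      and f: "filled ((Suc i * N + m) * N) \<tau>" for \<tau> i m
  proof -
    have "(\<lambda>c \<tau>. filled ((Suc i * N + m) * N + c) \<tau>) (regs \<tau> ''N'') (sem ?t \<tau>)"
    proof (rule For_inv)
      fix c \<tau>'
      assume c: "c < regs \<tau> ''N''" and fr: "frame (insert ''t'' (wregs ?s)) (warrs ?s) \<tau> \<tau>'"
        and t: "regs \<tau>' ''t'' = c" and I: "filled ((Suc i * N + m) * N + c) \<tau>'"
      have ctx': "ctx \<tau>'" by (rule ctx_frame[OF ctx fr]) (auto simp: ctx_regs_def ws)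
      have r: "regs \<tau>' ''i'' = i" "regs \<tau>' ''m'' = m" "c < N"
        using fr reg c ctxD(5)[OF ctx] unfolding ws by (simp_all add: frame_def)
      show "filled ((Suc i * N + m) * N + Suc c) (setr ''t'' (Suc c) (sem ?s \<tau>'))"
        using sem_s_loop[OF ctx' r(1,2) t rng r(3) I]
        by (simp add: filled_mem[of "setr x v \<sigma>" \<sigma> for x v \<sigma>] del: mult_Suc)
    qed (use f in \<open>simp_all add: filled_mem[of "setr x v \<sigma>" \<sigma> for x v \<sigma>]\<close>)
    then show ?thesis using ctxD(5)[OF ctx] by (simp add: algebra_simps)
  qed
  have m: "filled (Suc (Suc i) * N * N) (sem ?m \<tau>)"
    if ctx: "ctx \<tau>" and reg: "regs \<tau> ''i'' = i" and rng: "i < n"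
      and f: "filled (Suc i * N * N) \<tau>" for \<tau> i
  proof -
    have "(\<lambda>c \<tau>. filled ((Suc i * N + c) * N) \<tau>) (regs \<tau> ''N'') (sem ?m \<tau>)"
    proof (rule For_inv)
      fix c \<tau>'
      assume c: "c < regs \<tau> ''N''" and fr: "frame (insert ''m'' (wregs ?t)) (warrs ?t) \<tau> \<tau>'"
        and m: "regs \<tau>' ''m'' = c" and I: "filled ((Suc i * N + c) * N) \<tau>'"
      have ctx': "ctx \<tau>'" by (rule ctx_frame[OF ctx fr]) (auto simp: ctx_regs_def wt)
      have r: "regs \<tau>' ''i'' = i" "c < N"
        using fr reg c ctxD(5)[OF ctx] unfolding wt by (simp_all add: frame_def)
      show "filled ((Suc i * N + Suc c) * N) (setr ''m'' (Suc c) (sem ?t \<tau>'))"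
        using t[OF ctx' r(1) m rng r(2) I]
        by (simp add: filled_mem[of "setr x v \<sigma>" \<sigma> for x v \<sigma>] del: mult_Suc add_Suc_right)
    qed (use f in \<open>simp_all add: filled_mem[of "setr x v \<sigma>" \<sigma> for x v \<sigma>]\<close>)
    then show ?thesis using ctxD(5)[OF ctx] by (simp add: algebra_simps)
  qed
  have "(\<lambda>c \<tau>. filled (Suc c * N * N) \<tau>) (regs \<sigma> nr) (sem (pStep nr arr tab) \<sigma>)"
    unfolding pStep_def
  proof (rule For_inv)
    \<comment> \<open>The indices below \<open>N * N\<close> belong to prefix length
      \<open>0\<close>, for which no transition exists. The loops write from length \<open>1\<close>
      on, and the initial zeros are already correct here.\<close>
    have "entry_ok i m t 0" if "m < N" "(i * N + m) * N + t < N * N" for i m t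
    proof -
      have "(i * N + m) * N < N * N" using that by linarith
      then have "i * N + m < N" by simp
      then have "i = 0" by (cases i) auto
      then show ?thesis by (simp add: entry_ok_def step_def)
    qed
    then show "filled (Suc 0 * N * N) (setr ''i'' 0 \<sigma>)" using zero by (simp add: filled_def)
  next
    fix c \<tau>
    assume c: "c < regs \<sigma> nr" and fr: "frame (insert ''i'' (wregs ?m)) (warrs ?m) \<sigma> \<tau>"
      and i: "regs \<tau> ''i'' = c" and I: "filled (Suc c * N * N) \<tau>"
    have ctx': "ctx \<tau>" by (rule ctx_frame[OF ctx fr]) (auto simp: ctx_regs_def wm)
    have c: "c < n" using c side_ctx ctx by simp
    show "filled (Suc (Suc c) * N * N) (setr ''i'' (Suc c) (sem ?m \<tau>))"
      using m[OF ctx' i c I] by (simp add: filled_mem[of "setr x v \<sigma>" \<sigma> for x v \<sigma>] del: mult_Suc)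
  qed simp
  then show ?thesis using side_ctx(1)[OF ctx] by simp
qed

end

text \<open>Row \<open>s + 1\<close> of \<open>ok\<close> tells which question prefixes contain all neighbours of student \<open>s\<close>. Row \<open>0\<close>
  is zero, so the entry \<open>0\<close> of \<open>tS\<close> (no transition) never passes the test.\<close>

definition pOkCell :: prog where
  "pOkCell =
     PAsg ''y'' (Add (Cell ''mV'' (Add (Reg ''s'') (Const 1))) (Add (Cell ''mN'' (Reg ''j'')) (Reg ''p''))) ;;
     PSto ''ok'' (Reg ''y'') (Const 1) ;;
     PFor ''q'' ''b'' (PSto ''ok'' (Reg ''y'') (Sub (Cell ''ok'' (Reg ''y''))
       (Sub (Cell ''E'' (Add (Cell ''mb'' (Reg ''s'')) (Reg ''q'')))
         (eT ''gamma'' (Reg ''q'') (Reg ''j'') (Reg ''p'')))))"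

definition pOk :: prog where
  "pOk = PFor ''s'' ''a'' (PFor ''j'' ''B'' (PFor ''p'' ''N'' pOkCell))"

lemma wregs_pOkCell [simp]: "wregs pOkCell = {''y'', ''q''}"
  and warrs_pOkCell [simp]: "warrs pOkCell = {''ok''}"
  by (auto simp: pOkCell_def)

lemma wregs_pOk [simp]: "wregs pOk = {''s'', ''j'', ''p'', ''y'', ''q''}"
  and warrs_pOk [simp]: "warrs pOk = {''ok''}"
  by (auto simp: pOk_def)

lemma index_less:
  fixes i n m d :: nat
  assumes "i \<le> n" "m < d"
  shows "i * d + m < Suc n * d"
  using mult_le_mono1[OF assms(1), of d] assms(2) unfolding mult_Suc by linarith

section \<open>Tabulated neighbourhood tests\<close>

context chain_inst
begin

lemma small_R: "i \<le> a \<Longrightarrow> i < R" "j \<le> b \<Longrightarrow> j < R"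
  and node_R: "i \<le> a \<Longrightarrow> m < N \<Longrightarrow> i * N + m < R" "j \<le> b \<Longrightarrow> m < N \<Longrightarrow> j * N + m < R"
proof -
  note l = index_less[of _ _ _ N]
  show "i \<le> a \<Longrightarrow> m < N \<Longrightarrow> i * N + m < R" using l[of i a m] R_bound by linarith
  show "j \<le> b \<Longrightarrow> m < N \<Longrightarrow> j * N + m < R" using l[of j b m] R_bound by linarith
  show "i \<le> a \<Longrightarrow> i < R" using N_mult_ge[of "Suc a"] R_bound by linarith
  show "j \<le> b \<Longrightarrow> j < R" using N_mult_ge[of "Suc b"] R_bound by linarith
qed

lemma node_V: "j \<le> b \<Longrightarrow> p < N \<Longrightarrow> j * N + p < V"
  unfolding V_def by (rule index_less)

lemma nbhd_E_subset_iff: "nbhd E s \<subseteq> sel \<gamma> k b j p \<longleftrightarrow> (\<forall>q<b. (s, q) \<in> E \<longrightarrow> q \<in> sel \<gamma> k b j p)"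
  using E_sub by (auto simp: nbhd_def)

lemma aval_eT_gamma:
  assumes "ctx \<sigma>" "aval x \<sigma> < b" "aval m \<sigma> < N"
  shows "aval (eT ''gamma'' x i m) \<sigma> = of_bool (aval x \<sigma> \<in> sel \<gamma> k b (aval i \<sigma>) (aval m \<sigma>))"
  using T_gamma[OF assms] ctxD(3)[OF assms(1)] by (simp add: eT_def)

lemma sem_pOkCell:
  assumes ctx: "ctx \<sigma>" and reg: "regs \<sigma> ''s'' = s" "regs \<sigma> ''j'' = j" "regs \<sigma> ''p'' = p"
    and rng: "s < a" "j \<le> b" "p < N"
  shows "mem (sem pOkCell \<sigma>) ''ok'' =
    (mem \<sigma> ''ok'')(Suc s * V + (j * N + p) := of_bool (nbhd E s \<subseteq> sel \<gamma> k b j p))"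
proof -
  let ?y = "Suc s * V + (j * N + p)"
  let ?\<sigma> = "setm ''ok'' ?y 1 (setr ''y'' ?y \<sigma>)"
  let ?e = "Sub (Cell ''E'' (Add (Cell ''mb'' (Reg ''s'')) (Reg ''q'')))
         (eT ''gamma'' (Reg ''q'') (Reg ''j'') (Reg ''p''))"
  let ?p = "PSto ''ok'' (Reg ''y'') (Sub (Cell ''ok'' (Reg ''y'')) ?e)"
  have "mem \<sigma> ''mV'' (Suc s) = Suc s * V" "mem \<sigma> ''mN'' j = j * N"
    using ctxD(12,14)[OF ctx] rng small_R by simp_all
  then have eq: "sem pOkCell \<sigma> = sem (PFor ''q'' ''b'' ?p) ?\<sigma>"
    using reg by (simp add: pOkCell_def)
  have ctx1: "ctx ?\<sigma>" using ctx by (simp add: ctx_regs_def ctx_arrs_def)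
  have "(\<lambda>c \<tau>. mem \<tau> ''ok'' = (mem \<sigma> ''ok'')(?y := of_bool (\<forall>q<c. (s, q) \<in> E \<longrightarrow> q \<in> sel \<gamma> k b j p)))
    (regs ?\<sigma> ''b'') (sem (PFor ''q'' ''b'' ?p) ?\<sigma>)"
  proof (rule For_inv)
    fix c \<tau>
    assume c: "c < regs ?\<sigma> ''b''" and fr: "frame (insert ''q'' (wregs ?p)) (warrs ?p) ?\<sigma> \<tau>"
      and q: "regs \<tau> ''q'' = c"
      and I: "mem \<tau> ''ok'' = (mem \<sigma> ''ok'')(?y := of_bool (\<forall>q<c. (s, q) \<in> E \<longrightarrow> q \<in> sel \<gamma> k b j p))"
    have ctx': "ctx \<tau>" by (rule ctx_frame[OF ctx1 fr]) (auto simp: ctx_regs_def ctx_arrs_def)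
    have f: "regs \<tau> ''s'' = s" "regs \<tau> ''j'' = j" "regs \<tau> ''p'' = p" "regs \<tau> ''y'' = ?y"
      using fr reg by (simp_all add: frame_def)
    have c: "c < b" using c ctxD(2)[OF ctx1] by simp
    have "mem \<tau> ''mb'' s = s * b" using ctxD(13)[OF ctx'] rng small_R by simp
    then have e: "aval ?e \<tau> = of_bool (\<not> ((s, c) \<in> E \<longrightarrow> c \<in> sel \<gamma> k b j p))"
      using ctxD(11)[OF ctx' rng(1) c] f q c rng by (simp add: aval_eT_gamma[OF ctx'])
    have "(\<forall>q<Suc c. (s, q) \<in> E \<longrightarrow> q \<in> sel \<gamma> k b j p) \<longleftrightarrow>
        (\<forall>q<c. (s, q) \<in> E \<longrightarrow> q \<in> sel \<gamma> k b j p) \<and> ((s, c) \<in> E \<longrightarrow> c \<in> sel \<gamma> k b j p)"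
      by (auto simp: less_Suc_eq)
    moreover have "mem (setr ''q'' (Suc c) (sem ?p \<tau>)) ''ok'' = (mem \<tau> ''ok'')(?y := mem \<tau> ''ok'' ?y - aval ?e \<tau>)"
      using f by simp
    ultimately show "mem (setr ''q'' (Suc c) (sem ?p \<tau>)) ''ok'' =
        (mem \<sigma> ''ok'')(?y := of_bool (\<forall>q<Suc c. (s, q) \<in> E \<longrightarrow> q \<in> sel \<gamma> k b j p))"
      unfolding e I by auto
  qed (use reg in auto)
  then show ?thesis using eq ctxD(2)[OF ctx1] nbhd_E_subset_iff by simp
qed

text \<open>Progress is again one index. Unlike \<open>filled\<close>, nothing is claimed at or
  above \<open>c\<close>, because \<open>pOkCell\<close> starts by overwriting its cell with
  \<open>1\<close>.\<close>

definition okfilled :: "nat \<Rightarrow> state \<Rightarrow> bool" where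
  "okfilled c \<tau> \<longleftrightarrow> (\<forall>x<V. mem \<tau> ''ok'' x = 0) \<and>
     (\<forall>s<a. \<forall>j\<le>b. \<forall>p<N. Suc s * V + (j * N + p) < c \<longrightarrow>
        mem \<tau> ''ok'' (Suc s * V + (j * N + p)) = of_bool (nbhd E s \<subseteq> sel \<gamma> k b j p))"

lemma okfilled_setr [simp]: "okfilled c (setr x v \<tau>) = okfilled c \<tau>" by (simp add: okfilled_def)

lemma okfilled_cell:
  assumes ctx: "ctx \<sigma>" and reg: "regs \<sigma> ''s'' = s" "regs \<sigma> ''j'' = j" "regs \<sigma> ''p'' = p"
    and rng: "s < a" "j \<le> b" "p < N" and f: "okfilled (Suc s * V + (j * N + p)) \<sigma>"
  shows "okfilled (Suc (Suc s * V + (j * N + p))) (sem pOkCell \<sigma>)"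
proof -
  note e = sem_pOkCell[OF ctx reg rng]
  show ?thesis unfolding okfilled_def
  proof (intro conjI allI impI)
    fix x assume "x < V"
    then have "x \<noteq> Suc s * V + (j * N + p)" by auto
    then show "mem (sem pOkCell \<sigma>) ''ok'' x = 0" using f \<open>x < V\<close> e by (simp add: okfilled_def)
  next
    fix s' j' p' assume r: "s' < a" "j' \<le> b" "p' < N"
      and lt: "Suc s' * V + (j' * N + p') < Suc (Suc s * V + (j * N + p))"
    have eqv: "Suc s' * V + (j' * N + p') = Suc s * V + (j * N + p) \<longleftrightarrow> s' = s \<and> j' = j \<and> p' = p"
      using index_inj[OF node_V node_V, of j' p' j p "Suc s'" "Suc s"] index_inj[of p' N p j' j] r rng by simp
    show "mem (sem pOkCell \<sigma>) ''ok'' (Suc s' * V + (j' * N + p')) = of_bool (nbhd E s' \<subseteq> sel \<gamma> k b j' p')"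
    proof (cases "Suc s' * V + (j' * N + p') = Suc s * V + (j * N + p)")
      case True
      then show ?thesis using e eqv by (simp del: mult_Suc)
    next
      case False
      then show ?thesis using e f r lt unfolding okfilled_def by (simp del: mult_Suc)
    qed
  qed
qed

lemma sem_pOk:
  assumes ctx: "ctx \<sigma>" and zero: "mem \<sigma> ''ok'' = (\<lambda>_. 0)"
  shows "okfilled (Suc a * V) (sem pOk \<sigma>)"
proof -
  let ?p = "PFor ''p'' ''N'' pOkCell"
  let ?j = "PFor ''j'' ''B'' ?p"
  have p: "okfilled (Suc s * V + Suc j * N) (sem ?p \<tau>)"
    if ctx: "ctx \<tau>" and reg: "regs \<tau> ''s'' = s" "regs \<tau> ''j'' = j" and rng: "s < a" "j \<le> b"
      and f: "okfilled (Suc s * V + j * N) \<tau>" for \<tau> s j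
  proof -
    have "(\<lambda>c \<tau>. okfilled (Suc s * V + (j * N + c)) \<tau>) (regs \<tau> ''N'') (sem ?p \<tau>)"
    proof (rule For_inv)
      fix c \<tau>'
      assume c: "c < regs \<tau> ''N''" and fr: "frame (insert ''p'' (wregs pOkCell)) (warrs pOkCell) \<tau> \<tau>'"
        and p: "regs \<tau>' ''p'' = c" and I: "okfilled (Suc s * V + (j * N + c)) \<tau>'"
      have ctx': "ctx \<tau>'" by (rule ctx_frame[OF ctx fr]) (auto simp: ctx_regs_def ctx_arrs_def)
      have r: "regs \<tau>' ''s'' = s" "regs \<tau>' ''j'' = j" "c < N"
        using fr reg c ctxD(5)[OF ctx] by (simp_all add: frame_def)
      show "okfilled (Suc s * V + (j * N + Suc c)) (setr ''p'' (Suc c) (sem pOkCell \<tau>'))"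
        using okfilled_cell[OF ctx' r(1,2) p rng r(3) I] by simp
    qed (use f in simp_all)
    then show ?thesis using ctxD(5)[OF ctx] by (simp add: algebra_simps)
  qed
  have j: "okfilled (Suc (Suc s) * V) (sem ?j \<tau>)"
    if ctx: "ctx \<tau>" and reg: "regs \<tau> ''s'' = s" and rng: "s < a"
      and f: "okfilled (Suc s * V) \<tau>" for \<tau> s
  proof -
    have "(\<lambda>c \<tau>. okfilled (Suc s * V + c * N) \<tau>) (regs \<tau> ''B'') (sem ?j \<tau>)"
    proof (rule For_inv)
      fix c \<tau>'
      assume c: "c < regs \<tau> ''B''" and fr: "frame (insert ''j'' (wregs ?p)) (warrs ?p) \<tau> \<tau>'"
        and j: "regs \<tau>' ''j'' = c" and I: "okfilled (Suc s * V + c * N) \<tau>'"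
      have ctx': "ctx \<tau>'" by (rule ctx_frame[OF ctx fr]) (auto simp: ctx_regs_def ctx_arrs_def)
      have r: "regs \<tau>' ''s'' = s" "c \<le> b"
        using fr reg c ctxD(7)[OF ctx] by (simp_all add: frame_def)
      show "okfilled (Suc s * V + Suc c * N) (setr ''j'' (Suc c) (sem ?p \<tau>'))"
        using p[OF ctx' r(1) j rng r(2) I] by simp
    qed (use f in simp_all)
    then show ?thesis using ctxD(7)[OF ctx] by (simp add: V_def algebra_simps)
  qed
  have "(\<lambda>c \<tau>. okfilled (Suc c * V) \<tau>) (regs \<sigma> ''a'') (sem pOk \<sigma>)"
    unfolding pOk_def
  proof (rule For_inv)
    show "okfilled (Suc 0 * V) (setr ''s'' 0 \<sigma>)" using zero by (auto simp: okfilled_def)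
  next
    fix c \<tau>
    assume c: "c < regs \<sigma> ''a''" and fr: "frame (insert ''s'' (wregs ?j)) (warrs ?j) \<sigma> \<tau>"
      and s: "regs \<tau> ''s'' = c" and I: "okfilled (Suc c * V) \<tau>"
    have ctx': "ctx \<tau>" by (rule ctx_frame[OF ctx fr]) (auto simp: ctx_regs_def ctx_arrs_def)
    have c: "c < a" using c ctxD(1)[OF ctx] by simp
    show "okfilled (Suc (Suc c) * V) (setr ''s'' (Suc c) (sem ?j \<tau>))"
      using j[OF ctx' s c I] by simp
  qed simp
  then show ?thesis using ctxD(1)[OF ctx] by simp
qed

definition tabs :: "state \<Rightarrow> bool" where
  "tabs \<sigma> \<longleftrightarrow>
     (\<forall>i\<le>a. \<forall>m<N. \<forall>t<N. ((\<exists>x. step \<alpha> k a i t m x) \<longrightarrow> mem \<sigma> ''tS'' ((i * N + m) * N + t) \<noteq> 0) \<and>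
        (mem \<sigma> ''tS'' ((i * N + m) * N + t) \<noteq> 0 \<longrightarrow>
           step \<alpha> k a i t m (mem \<sigma> ''tS'' ((i * N + m) * N + t) - 1))) \<and>
     (\<forall>i\<le>b. \<forall>m<N. \<forall>t<N. ((\<exists>x. step \<gamma> k b i t m x) \<longrightarrow> mem \<sigma> ''tQ'' ((i * N + m) * N + t) \<noteq> 0) \<and>
        (mem \<sigma> ''tQ'' ((i * N + m) * N + t) \<noteq> 0 \<longrightarrow>
           step \<gamma> k b i t m (mem \<sigma> ''tQ'' ((i * N + m) * N + t) - 1))) \<and>
     (\<forall>x<V. mem \<sigma> ''ok'' x = 0) \<and>
     (\<forall>s<a. \<forall>j\<le>b. \<forall>p<N.
        mem \<sigma> ''ok'' (Suc s * V + (j * N + p)) = of_bool (nbhd E s \<subseteq> sel \<gamma> k b j p))"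

lemma tabs_frame:
  assumes "tabs \<sigma>" "frame X Y \<sigma> \<tau>" "Y \<inter> {''tS'', ''tQ'', ''ok''} = {}"
  shows "tabs \<tau>"
proof -
  have "mem \<tau> A = mem \<sigma> A" if "A \<in> {''tS'', ''tQ'', ''ok''}" for A using assms that unfolding frame_def by blast
  then show ?thesis using assms(1) by (simp add: tabs_def)
qed

end

definition pTabs :: prog where
  "pTabs = pStep ''a'' ''alpha'' ''tS'' ;; pStep ''b'' ''gamma'' ''tQ'' ;; pOk"

context chain_inst
begin

lemma tabs_pTabs:
  assumes ctx: "ctx \<sigma>" and zero: "mem \<sigma> ''tS'' = (\<lambda>_. 0)" "mem \<sigma> ''tQ'' = (\<lambda>_. 0)" "mem \<sigma> ''ok'' = (\<lambda>_. 0)"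
  shows "tabs (sem pTabs \<sigma>)"
proof -
  interpret S: side a b E \<alpha> \<gamma> k "''a''" "''alpha''" "''tS''" a \<alpha> by unfold_locales simp
  interpret Q: side a b E \<alpha> \<gamma> k "''b''" "''gamma''" "''tQ''" b \<gamma> by unfold_locales simp
  define \<sigma>1 where "\<sigma>1 = sem (pStep ''a'' ''alpha'' ''tS'') \<sigma>"
  define \<sigma>2 where "\<sigma>2 = sem (pStep ''b'' ''gamma'' ''tQ'') \<sigma>1"
  have c1: "ctx \<sigma>1" unfolding \<sigma>1_def by (rule ctx_sem[OF ctx]) (auto simp: ctx_regs_def ctx_arrs_def)
  have c2: "ctx \<sigma>2" unfolding \<sigma>2_def by (rule ctx_sem[OF c1]) (auto simp: ctx_regs_def ctx_arrs_def)
  have s: "S.filled (Suc a * N * N) (sem pOk \<sigma>2)"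
    using S.sem_pStep[OF ctx zero(1)] S.filled_mem[of "sem pOk \<sigma>2" \<sigma>1] by (simp add: \<sigma>1_def \<sigma>2_def)
  have "mem \<sigma>1 ''tQ'' = (\<lambda>_. 0)" using zero by (simp add: \<sigma>1_def)
  then have q: "Q.filled (Suc b * N * N) (sem pOk \<sigma>2)"
    using Q.sem_pStep[OF c1] Q.filled_mem[of "sem pOk \<sigma>2" \<sigma>2] by (simp add: \<sigma>2_def)
  have "mem \<sigma>2 ''ok'' = (\<lambda>_. 0)" using zero by (simp add: \<sigma>1_def \<sigma>2_def)
  then have o: "okfilled (Suc a * V) (sem pOk \<sigma>2)" using sem_pOk[OF c2] by simp
  have lt: "(i * N + m) * N + t < Suc n * N * N" if "i \<le> n" "m < N" "t < N" for i m t n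
    using index_less[OF _ that(3), of "i * N + m" "Suc n * N - 1"] index_less[OF that(1,2)]
    by (simp add: algebra_simps)
  have ltV: "Suc s * V + (j * N + p) < Suc a * V" if "s < a" "j \<le> b" "p < N" for s j p
    using index_less[OF _ node_V[OF that(2,3)], of "Suc s" a] that(1) by simp
  have "tabs (sem pOk \<sigma>2)"
    unfolding tabs_def
  proof (intro conjI)
    show "\<forall>x<V. mem (sem pOk \<sigma>2) ''ok'' x = 0" using o by (simp add: okfilled_def)
    show "\<forall>s<a. \<forall>j\<le>b. \<forall>p<N. mem (sem pOk \<sigma>2) ''ok'' (Suc s * V + (j * N + p)) =
        of_bool (nbhd E s \<subseteq> sel \<gamma> k b j p)"
      using o ltV by (simp add: okfilled_def del: mult_Suc)
    show "\<forall>i\<le>a. \<forall>m<N. \<forall>t<N. ((\<exists>x. step \<alpha> k a i t m x) \<longrightarrow> mem (sem pOk \<sigma>2) ''tS'' ((i * N + m) * N + t) \<noteq> 0) \<and>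
        (mem (sem pOk \<sigma>2) ''tS'' ((i * N + m) * N + t) \<noteq> 0 \<longrightarrow>
           step \<alpha> k a i t m (mem (sem pOk \<sigma>2) ''tS'' ((i * N + m) * N + t) - 1))"
    proof (intro allI impI)
      fix i m t assume r: "i \<le> a" "m < N" "t < N"
      show "((\<exists>x. step \<alpha> k a i t m x) \<longrightarrow> mem (sem pOk \<sigma>2) ''tS'' ((i * N + m) * N + t) \<noteq> 0) \<and>
        (mem (sem pOk \<sigma>2) ''tS'' ((i * N + m) * N + t) \<noteq> 0 \<longrightarrow>
           step \<alpha> k a i t m (mem (sem pOk \<sigma>2) ''tS'' ((i * N + m) * N + t) - 1))"
        using s[unfolded S.filled_def, rule_format, OF r(2,3), of i] lt[OF r]
        by (simp add: S.entry_ok_def del: mult_Suc)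
    qed
    show "\<forall>i\<le>b. \<forall>m<N. \<forall>t<N. ((\<exists>x. step \<gamma> k b i t m x) \<longrightarrow> mem (sem pOk \<sigma>2) ''tQ'' ((i * N + m) * N + t) \<noteq> 0) \<and>
        (mem (sem pOk \<sigma>2) ''tQ'' ((i * N + m) * N + t) \<noteq> 0 \<longrightarrow>
           step \<gamma> k b i t m (mem (sem pOk \<sigma>2) ''tQ'' ((i * N + m) * N + t) - 1))"
    proof (intro allI impI)
      fix i m t assume r: "i \<le> b" "m < N" "t < N"
      show "((\<exists>x. step \<gamma> k b i t m x) \<longrightarrow> mem (sem pOk \<sigma>2) ''tQ'' ((i * N + m) * N + t) \<noteq> 0) \<and>
        (mem (sem pOk \<sigma>2) ''tQ'' ((i * N + m) * N + t) \<noteq> 0 \<longrightarrow>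
           step \<gamma> k b i t m (mem (sem pOk \<sigma>2) ''tQ'' ((i * N + m) * N + t) - 1))"
        using q[unfolded Q.filled_def, rule_format, OF r(2,3), of i] lt[OF r]
        by (simp add: Q.entry_ok_def del: mult_Suc)
    qed
  qed
  then show ?thesis by (simp add: pTabs_def \<sigma>1_def \<sigma>2_def)
qed

end

subsection \<open>Dynamic programming\<close>

text \<open>\<open>G\<close> stores \<open>a b + 1\<close> minus the length of the best known path, so that the initial value \<open>0\<close> means
  unreachable. The arrays \<open>P\<close>, \<open>L\<close>, \<open>J\<close>, \<open>M\<close> store the predecessor on that path, its label (\<open>s + 1\<close> if
  student \<open>s\<close> was placed, \<open>0\<close> for a question), and the number and mask of the placed questions.\<close>

definition pRelax :: "exp \<Rightarrow> exp \<Rightarrow> exp \<Rightarrow> exp \<Rightarrow> prog" where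
  "pRelax g x c l = PWhen g (PAsg ''x'' x ;;
     PWhen (Sub (Sub (Cell ''G'' (Reg ''x'')) c) (Cell ''G'' (Reg ''y'')))
       (PSto ''P'' (Reg ''y'') (Reg ''x'') ;;
        PSto ''L'' (Reg ''y'') l ;;
        PSto ''J'' (Reg ''y'') (Reg ''j'') ;;
        PSto ''M'' (Reg ''y'') (Reg ''p'') ;;
        PSto ''G'' (Reg ''y'') (Sub (Cell ''G'' (Reg ''x'')) c)))"

definition pRelaxS :: prog where
  "pRelaxS = pRelax
     (Cell ''ok'' (Add (Cell ''mV'' (Cell ''tS'' (Add (Cell ''mN'' (Reg ''u'')) (Reg ''t'')))) (Reg ''v'')))
     (Add (Cell ''mV'' (Add (Cell ''mN'' (Sub (Reg ''i'') (Const 1))) (Reg ''t''))) (Reg ''v''))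
     (Reg ''j'')
     (Cell ''tS'' (Add (Cell ''mN'' (Reg ''u'')) (Reg ''t'')))"

definition pRelaxQ :: prog where
  "pRelaxQ = pRelax
     (Cell ''tQ'' (Add (Cell ''mN'' (Reg ''v'')) (Reg ''t'')))
     (Add (Cell ''mV'' (Reg ''u'')) (Add (Cell ''mN'' (Sub (Reg ''j'') (Const 1))) (Reg ''t'')))
     (Const 0)
     (Const 0)"

definition pCell :: prog where
  "pCell =
     PAsg ''u'' (Add (Cell ''mN'' (Reg ''i'')) (Reg ''m'')) ;;
     PAsg ''v'' (Add (Cell ''mN'' (Reg ''j'')) (Reg ''p'')) ;;
     PAsg ''y'' (Add (Cell ''mV'' (Reg ''u'')) (Reg ''v'')) ;;
     PFor ''t'' ''N'' pRelaxS ;;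
     PFor ''t'' ''N'' pRelaxQ"

definition pDP :: prog where
  "pDP =
     PSto ''G'' (Add (Cell ''mV'' (Reg ''z'')) (Reg ''z'')) (Add (Cell ''mb'' (Reg ''a'')) (Const 1)) ;;
     PFor ''i'' ''A'' (PFor ''m'' ''N'' (PFor ''j'' ''B'' (PFor ''p'' ''N'' pCell)))"

definition dp_arrs :: "vname set" where "dp_arrs = {''G'', ''P'', ''L'', ''J'', ''M''}"

lemma wregs_pRelax [simp]: "wregs (pRelax g x c l) = {''x''}"
  and warrs_pRelax [simp]: "warrs (pRelax g x c l) = dp_arrs"
  and wregs_pCell [simp]: "wregs pCell = {''u'', ''v'', ''y'', ''t'', ''x''}"
  and warrs_pCell [simp]: "warrs pCell = dp_arrs"
  by (auto simp: pRelax_def pCell_def pRelaxS_def pRelaxQ_def dp_arrs_def)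

lemma wregs_pDP [simp]: "wregs pDP = {''i'', ''m'', ''j'', ''p'', ''u'', ''v'', ''y'', ''t'', ''x''}"
  and warrs_pDP [simp]: "warrs pDP = dp_arrs"
  by (auto simp: pDP_def) (auto simp: dp_arrs_def)

lemma step_unique: "step \<omega> k n i m' m x \<Longrightarrow> step \<omega> k n i m' m x' \<Longrightarrow> x = x'"
  by (auto simp: step_def)

section \<open>Invariants of the table of path lengths\<close>

context chain_inst
begin

definition ix :: "nat \<Rightarrow> nat \<Rightarrow> nat \<Rightarrow> nat \<Rightarrow> nat" where
  "ix i m j p = (i * N + m) * V + (j * N + p)"

lemma ix_inj:
  assumes "m < N" "j \<le> b" "p < N" "m' < N" "j' \<le> b" "p' < N"
  shows "ix i m j p = ix i' m' j' p' \<longleftrightarrow> i = i' \<and> m = m' \<and> j = j' \<and> p = p'"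
  using assms by (simp add: ix_def index_inj node_V)

definition pred :: "nat \<Rightarrow> nat \<Rightarrow> nat \<Rightarrow> nat \<Rightarrow> nat \<Rightarrow> nat \<Rightarrow> nat \<Rightarrow> bool" where
  "pred i m j p x c l \<longleftrightarrow> i \<le> a \<and> m < N \<and> j \<le> b \<and> p < N \<and>
     ((\<exists>m' s. step \<alpha> k a i m' m s \<and> m' < N \<and> nbhd E s \<subseteq> sel \<gamma> k b j p \<and>
         x = ix (i - 1) m' j p \<and> c = j \<and> l = Suc s) \<or>
      (\<exists>p' q. step \<gamma> k b j p' p q \<and> p' < N \<and> x = ix i m (j - 1) p' \<and> c = 0 \<and> l = 0))"

text \<open>Lexicographic order of the nodes is a topological order. Visiting them by increasing
  index therefore finds every predecessor cell in its final state, and relaxing a cell never changes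
  the value it is relaxed from.\<close>

lemma pred_less: "pred i m j p x c l \<Longrightarrow> x < ix i m j p"
proof -
  assume h: "pred i m j p x c l"
  then have r: "m < N" "j \<le> b" "p < N" by (auto simp: pred_def)
  from h consider (1) m' s where "step \<alpha> k a i m' m s" "m' < N" "x = ix (i - 1) m' j p"
    | (2) p' q where "step \<gamma> k b j p' p q" "p' < N" "x = ix i m (j - 1) p'"
    unfolding pred_def by blast
  then show ?thesis
  proof cases
    case 1
    then have "i > 0" by (simp add: step_def)
    then have "(i - 1) * N + m' < i * N" using index_less[of "i - 1" "i - 1" m' N] 1 by simp
    then have "(i - 1) * N + m' < i * N + m" by linarith
    then have "((i - 1) * N + m') * V < (i * N + m) * V" using r by (simp add: V_def)
    then show ?thesis using 1 by (simp add: ix_def)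
  next
    case 2
    then have "j > 0" by (simp add: step_def)
    then have "(j - 1) * N + p' < j * N" using index_less[of "j - 1" "j - 1" p' N] 2 by simp
    then show ?thesis using 2 by (simp add: ix_def)
  qed
qed

text \<open>One more than the number of edges of the complete graph, so that the path of the
  complete addition leaves a positive value at the end node.\<close>

definition cap :: nat where "cap = a * b + 1"

text \<open>Each recorded predecessor accounts for the value of its cell. An inequality is enough
  for the trace, and unlike an equation it survives a later increase at the predecessor.\<close>

definition sound :: "(vname \<Rightarrow> nat \<Rightarrow> nat) \<Rightarrow> bool" where
  "sound \<mu> \<longleftrightarrow> (\<forall>i m j p. i \<le> a \<longrightarrow> m < N \<longrightarrow> j \<le> b \<longrightarrow> p < N \<longrightarrow> \<mu> ''G'' (ix i m j p) \<noteq> 0 \<longrightarrow>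
     i = 0 \<and> m = z \<and> j = 0 \<and> p = z \<and> \<mu> ''G'' (ix i m j p) = cap \<or>
     (\<exists>c. pred i m j p (\<mu> ''P'' (ix i m j p)) c (\<mu> ''L'' (ix i m j p)) \<and> \<mu> ''J'' (ix i m j p) = j \<and>
        \<mu> ''M'' (ix i m j p) = p \<and> \<mu> ''G'' (ix i m j p) + c \<le> \<mu> ''G'' (\<mu> ''P'' (ix i m j p))))"

text \<open>All transitions into nodes of index below \<open>B\<close> are relaxed. Once
  \<open>B\<close> exceeds every index, \<open>G\<close> is a potential as required by
  \<open>addition_lower_bound\<close>.\<close>

definition closed :: "nat \<Rightarrow> (nat \<Rightarrow> nat) \<Rightarrow> bool" where
  "closed B G \<longleftrightarrow> (\<forall>i m j p x c l. pred i m j p x c l \<longrightarrow> ix i m j p < B \<longrightarrow> G x \<le> G (ix i m j p) + c)"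

lemma sound_update:
  assumes s: "sound \<mu>" and pr: "pred i m j p x c l" and y: "y = ix i m j p" and lt: "\<mu> ''G'' y < \<mu> ''G'' x - c"
    and \<nu>: "\<nu> ''G'' = (\<mu> ''G'')(y := \<mu> ''G'' x - c)" "\<nu> ''P'' = (\<mu> ''P'')(y := x)" "\<nu> ''L'' = (\<mu> ''L'')(y := l)"
      "\<nu> ''J'' = (\<mu> ''J'')(y := j)" "\<nu> ''M'' = (\<mu> ''M'')(y := p)"
  shows "sound \<nu>"
  unfolding sound_def
proof (intro allI impI)
  fix i' m' j' p'
  assume r: "i' \<le> a" "m' < N" "j' \<le> b" "p' < N" and nz: "\<nu> ''G'' (ix i' m' j' p') \<noteq> 0"
  let ?y = "ix i' m' j' p'"
  have pr': "m < N" "j \<le> b" "p < N" using pr by (simp_all add: pred_def)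
  have xy: "x \<noteq> y" using pred_less[OF pr] y by simp
  show "i' = 0 \<and> m' = z \<and> j' = 0 \<and> p' = z \<and> \<nu> ''G'' ?y = cap \<or>
     (\<exists>c. pred i' m' j' p' (\<nu> ''P'' ?y) c (\<nu> ''L'' ?y) \<and> \<nu> ''J'' ?y = j' \<and> \<nu> ''M'' ?y = p' \<and>
        \<nu> ''G'' ?y + c \<le> \<nu> ''G'' (\<nu> ''P'' ?y))"
  proof (cases "?y = y")
    case True
    then have "i' = i" "m' = m" "j' = j" "p' = p" using ix_inj y r pr' by auto
    then show ?thesis using True pr xy lt by (intro disjI2 exI[of _ c]) (simp add: \<nu>)
  next
    case False
    then have "\<mu> ''G'' ?y \<noteq> 0" using nz by (simp add: \<nu>)
    then consider "i' = 0 \<and> m' = z \<and> j' = 0 \<and> p' = z \<and> \<mu> ''G'' ?y = cap"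
      | d where "pred i' m' j' p' (\<mu> ''P'' ?y) d (\<mu> ''L'' ?y)" "\<mu> ''J'' ?y = j'" "\<mu> ''M'' ?y = p'"
        "\<mu> ''G'' ?y + d \<le> \<mu> ''G'' (\<mu> ''P'' ?y)"
      using s[unfolded sound_def, rule_format, OF r] by blast
    then show ?thesis
    proof cases
      case 1
      then show ?thesis using False by (intro disjI1) (auto simp: \<nu>)
    next
      case 2
      \<comment> \<open>If the recorded predecessor is the updated cell, its value has grown, which
        only strengthens the inequality.\<close>
      then show ?thesis using False lt by (intro disjI2 exI[of _ d]) (auto simp: \<nu>)
    qed
  qed
qed

text \<open>Serves both kinds of transitions. The values of the four expressions are required in
  every state that differs only in \<open>t\<close>, \<open>x\<close> and the arrays of the dynamic
  program, because \<open>pRelax\<close> evaluates them between its own stores.\<close>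

lemma sem_relax_loop:
  assumes ctx: "ctx \<sigma>" and y: "regs \<sigma> ''y'' = ix i m j p" and jp: "regs \<sigma> ''j'' = j" "regs \<sigma> ''p'' = p"
    and s: "sound (mem \<sigma>)"
    and ev: "\<And>\<tau> t. frame {''t'', ''x''} dp_arrs \<sigma> \<tau> \<Longrightarrow> regs \<tau> ''t'' = t \<Longrightarrow> t < N \<Longrightarrow>
      aval ge \<tau> = gf t \<and> aval xe \<tau> = xf t \<and> aval ce \<tau> = c \<and> aval le \<tau> = lf t"
    and pr: "\<And>t. t < N \<Longrightarrow> gf t \<noteq> 0 \<Longrightarrow> pred i m j p (xf t) c (lf t)"
  defines "\<sigma>' \<equiv> sem (PFor ''t'' ''N'' (pRelax ge xe ce le)) \<sigma>"
  shows "sound (mem \<sigma>') \<and> (\<forall>x. x \<noteq> ix i m j p \<longrightarrow> mem \<sigma>' ''G'' x = mem \<sigma> ''G'' x) \<and>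
    mem \<sigma> ''G'' (ix i m j p) \<le> mem \<sigma>' ''G'' (ix i m j p) \<and>
    (\<forall>t<N. gf t \<noteq> 0 \<longrightarrow> mem \<sigma>' ''G'' (xf t) \<le> mem \<sigma>' ''G'' (ix i m j p) + c)"
proof -
  let ?y = "ix i m j p" and ?p = "pRelax ge xe ce le"
  let ?I = "\<lambda>n \<tau>. sound (mem \<tau>) \<and> (\<forall>x. x \<noteq> ?y \<longrightarrow> mem \<tau> ''G'' x = mem \<sigma> ''G'' x) \<and>
    mem \<sigma> ''G'' ?y \<le> mem \<tau> ''G'' ?y \<and>
    (\<forall>t<n. gf t \<noteq> 0 \<longrightarrow> mem \<tau> ''G'' (xf t) \<le> mem \<tau> ''G'' ?y + c)"
  have "?I (regs \<sigma> ''N'') (sem (PFor ''t'' ''N'' ?p) \<sigma>)"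
  proof (rule For_inv)
    show "?I 0 (setr ''t'' 0 \<sigma>)" using s by simp
  next
    fix t \<tau>
    assume t: "t < regs \<sigma> ''N''" and fr: "frame (insert ''t'' (wregs ?p)) (warrs ?p) \<sigma> \<tau>"
      and rt: "regs \<tau> ''t'' = t" and I: "?I t \<tau>"
    have t: "t < N" using t ctxD(5)[OF ctx] by simp
    have fr: "frame {''t'', ''x''} dp_arrs \<sigma> \<tau>" using fr by simp
    have r: "regs \<tau> ''y'' = ?y" "regs \<tau> ''j'' = j" "regs \<tau> ''p'' = p"
      using fr y jp by (simp_all add: frame_def)
    have step: "aval ge \<upsilon> = gf t \<and> aval xe \<upsilon> = xf t \<and> aval ce \<upsilon> = c \<and> aval le \<upsilon> = lf t"
      if "frame {''x''} dp_arrs \<tau> \<upsilon>" for \<upsilon>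
      using ev[of \<upsilon> t] frame_trans[OF fr frame_mono[OF that]] that rt t by (simp add: frame_def)
    have st: "aval ge \<tau> = gf t" "aval xe \<tau> = xf t" using step[OF frame_refl] by simp_all
    show "?I (Suc t) (setr ''t'' (Suc t) (sem ?p \<tau>))"
    proof (cases "gf t \<noteq> 0 \<and> mem \<tau> ''G'' ?y < mem \<tau> ''G'' (xf t) - c")
      case False
      have "mem (sem ?p \<tau>) = mem \<tau>"
        using False st step[of "setr ''x'' (xf t) \<tau>"] r by (auto simp: pRelax_def frame_def)
      moreover have "gf t \<noteq> 0 \<Longrightarrow> mem \<tau> ''G'' (xf t) \<le> mem \<tau> ''G'' ?y + c" using False by linarith
      ultimately show ?thesis using I by (simp add: less_Suc_eq)
    next
      case True
      let ?\<upsilon> = "sem ?p \<tau>"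
      \<comment> \<open>The store to cell \<open>?y\<close> leaves the value at the predecessor
        intact.\<close>
      have xy: "xf t \<noteq> ?y" using pred_less[OF pr[OF t]] True by fastforce
      have ce: "aval ce (setr ''x'' (xf t) \<tau>) = c" using step[of "setr ''x'' (xf t) \<tau>"] by (simp add: frame_def)
      let ?\<tau>1 = "setm ''P'' ?y (xf t) (setr ''x'' (xf t) \<tau>)"
      have le: "aval le ?\<tau>1 = lf t" using step[of ?\<tau>1] by (simp add: frame_def dp_arrs_def)
      let ?\<tau>4 = "setm ''M'' ?y p (setm ''J'' ?y j (setm ''L'' ?y (lf t) ?\<tau>1))"
      have ce': "aval ce ?\<tau>4 = c" using step[of ?\<tau>4] by (simp add: frame_def dp_arrs_def)
      have up: "?\<upsilon> = setm ''G'' ?y (mem \<tau> ''G'' (xf t) - c) ?\<tau>4"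
        using True st r ce le ce' by (auto simp: pRelax_def)
      have snd: "sound (mem ?\<upsilon>)"
        by (rule sound_update[OF conjunct1[OF I] pr[OF t] refl, of "mem ?\<upsilon>"])
          (use True in \<open>simp_all add: up\<close>)
      have G: "mem ?\<upsilon> ''G'' = (mem \<tau> ''G'')(?y := mem \<tau> ''G'' (xf t) - c)" by (simp add: up)
      have "mem ?\<upsilon> ''G'' (xf t') \<le> mem ?\<upsilon> ''G'' ?y + c" if t': "t' < Suc t" "gf t' \<noteq> 0" for t'
      proof (cases "t' = t")
        case True
        then show ?thesis using xy by (simp add: G)
      next
        case False
        then have "t' < t" using t' by simp
        then have "mem \<tau> ''G'' (xf t') \<le> mem \<tau> ''G'' ?y + c" using I t' by blast
        moreover have "xf t' \<noteq> ?y" using pred_less[OF pr[of t']] t' t by fastforce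
        ultimately show ?thesis using True by (simp add: G)
      qed
      moreover have "\<forall>x. x \<noteq> ?y \<longrightarrow> mem ?\<upsilon> ''G'' x = mem \<sigma> ''G'' x" using I by (simp add: G)
      moreover have "mem \<sigma> ''G'' ?y \<le> mem ?\<upsilon> ''G'' ?y" using I True by (simp add: G)
      ultimately show ?thesis using snd by simp
    qed
  qed simp
  then show ?thesis using ctxD(5)[OF ctx] by (simp add: \<sigma>'_def)
qed

text \<open>The third conjunct keeps the potential of the start node at \<open>cap\<close> or more;
  relaxation only ever raises cells.\<close>

definition dp_inv :: "nat \<Rightarrow> state \<Rightarrow> bool" where
  "dp_inv B \<tau> \<longleftrightarrow> sound (mem \<tau>) \<and> closed B (mem \<tau> ''G'') \<and> cap \<le> mem \<tau> ''G'' (ix 0 z 0 z)"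

lemma dp_inv_setr [simp]: "dp_inv B (setr x v \<tau>) = dp_inv B \<tau>" by (simp add: dp_inv_def)

lemma sem_pCell:
  assumes ctx: "ctx \<sigma>" and tabs: "tabs \<sigma>"
    and reg: "regs \<sigma> ''i'' = i" "regs \<sigma> ''m'' = m" "regs \<sigma> ''j'' = j" "regs \<sigma> ''p'' = p"
    and rng: "i \<le> a" "m < N" "j \<le> b" "p < N" and inv: "dp_inv (ix i m j p) \<sigma>"
  shows "dp_inv (Suc (ix i m j p)) (sem pCell \<sigma>)"
proof -
  let ?y = "ix i m j p" and ?u = "i * N + m" and ?v = "j * N + p"
  define \<sigma>0 where "\<sigma>0 = setr ''y'' ?y (setr ''v'' ?v (setr ''u'' ?u \<sigma>))"
  define \<sigma>1 where "\<sigma>1 = sem (PFor ''t'' ''N'' pRelaxS) \<sigma>0"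
  define \<sigma>2 where "\<sigma>2 = sem (PFor ''t'' ''N'' pRelaxQ) \<sigma>1"
  have mul: "mem \<sigma> ''mN'' i = i * N" "mem \<sigma> ''mN'' j = j * N" "mem \<sigma> ''mV'' ?u = ?u * V"
    using ctxD(12,14)[OF ctx] small_R node_R rng by simp_all
  have eq: "sem pCell \<sigma> = \<sigma>2"
    using reg mul by (simp add: pCell_def \<sigma>2_def \<sigma>1_def \<sigma>0_def ix_def)
  have ctx0: "ctx \<sigma>0" using ctx by (simp add: \<sigma>0_def ctx_regs_def)
  have tabs0: "tabs \<sigma>0" by (rule tabs_frame[OF tabs, of "{''y'', ''v'', ''u''}" "{}"]) (auto simp: \<sigma>0_def frame_def)
  have reg0: "regs \<sigma>0 ''i'' = i" "regs \<sigma>0 ''j'' = j" "regs \<sigma>0 ''p'' = p" "regs \<sigma>0 ''u'' = ?u"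
    "regs \<sigma>0 ''v'' = ?v" "regs \<sigma>0 ''y'' = ?y"
    using reg by (simp_all add: \<sigma>0_def)
  have disj: "{''t'', ''x''} \<inter> ctx_regs = {}" "dp_arrs \<inter> ctx_arrs = {}" "dp_arrs \<inter> {''tS'', ''tQ'', ''ok''} = {}"
    by (auto simp: ctx_regs_def ctx_arrs_def dp_arrs_def)
  have vV: "?v < V" using node_V rng by simp

  define lf where "lf t = mem \<sigma>0 ''tS'' (?u * N + t)" for t
  define gf where "gf t = mem \<sigma>0 ''ok'' (lf t * V + ?v)" for t
  have lf: "((\<exists>x. step \<alpha> k a i t m x) \<longrightarrow> lf t \<noteq> 0) \<and> (lf t \<noteq> 0 \<longrightarrow> step \<alpha> k a i t m (lf t - 1))"
    if "t < N" for t
    using tabs0 rng that unfolding tabs_def lf_def by blast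
  have lfa: "lf t \<le> a" if "t < N" for t using lf[OF that] by (cases "lf t = 0") (auto simp: step_def)
  have gf: "gf t = of_bool (lf t \<noteq> 0 \<and> nbhd E (lf t - 1) \<subseteq> sel \<gamma> k b j p)" if "t < N" for t
  proof (cases "lf t")
    case 0
    then show ?thesis using tabs0 vV by (simp add: gf_def tabs_def)
  next
    case (Suc s)
    then have "s < a" using lfa[OF that] by simp
    then have "mem \<sigma>0 ''ok'' (Suc s * V + ?v) = of_bool (nbhd E s \<subseteq> sel \<gamma> k b j p)"
      using tabs0 rng unfolding tabs_def by blast
    then show ?thesis using Suc by (simp add: gf_def)
  qed
  have S: "sound (mem \<sigma>1) \<and> (\<forall>x. x \<noteq> ?y \<longrightarrow> mem \<sigma>1 ''G'' x = mem \<sigma>0 ''G'' x) \<and>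
    mem \<sigma>0 ''G'' ?y \<le> mem \<sigma>1 ''G'' ?y \<and>
    (\<forall>t<N. gf t \<noteq> 0 \<longrightarrow> mem \<sigma>1 ''G'' (ix (i - 1) t j p) \<le> mem \<sigma>1 ''G'' ?y + j)"
    unfolding \<sigma>1_def pRelaxS_def
  proof (rule sem_relax_loop[OF ctx0 reg0(6,2,3), where lf = lf])
    show "sound (mem \<sigma>0)" using inv by (simp add: dp_inv_def \<sigma>0_def)
  next
    fix \<tau> t assume fr: "frame {''t'', ''x''} dp_arrs \<sigma>0 \<tau>" and t: "regs \<tau> ''t'' = t" "t < N"
    have c: "ctx \<tau>" by (rule ctx_frame[OF ctx0 fr disj(1,2)])
    have r: "regs \<tau> ''i'' = i" "regs \<tau> ''j'' = j" "regs \<tau> ''u'' = ?u" "regs \<tau> ''v'' = ?v"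
      using fr reg0 by (simp_all add: frame_def)
    have mm: "mem \<tau> ''tS'' = mem \<sigma>0 ''tS''" "mem \<tau> ''ok'' = mem \<sigma>0 ''ok''"
      using fr by (simp_all add: frame_def dp_arrs_def)
    have "mem \<tau> ''mN'' ?u = ?u * N" "mem \<tau> ''mV'' (lf t) = lf t * V" "mem \<tau> ''mN'' (i - 1) = (i - 1) * N"
      "mem \<tau> ''mV'' ((i - 1) * N + t) = ((i - 1) * N + t) * V"
      using ctxD(12,14)[OF c] small_R node_R rng t lfa by simp_all
    then show "aval (Cell ''ok'' (Add (Cell ''mV'' (Cell ''tS'' (Add (Cell ''mN'' (Reg ''u'')) (Reg ''t'')))) (Reg ''v''))) \<tau> = gf t \<and>
      aval (Add (Cell ''mV'' (Add (Cell ''mN'' (Sub (Reg ''i'') (Const 1))) (Reg ''t''))) (Reg ''v'')) \<tau> = ix (i - 1) t j p \<and>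
      aval (Reg ''j'') \<tau> = j \<and>
      aval (Cell ''tS'' (Add (Cell ''mN'' (Reg ''u'')) (Reg ''t''))) \<tau> = lf t"
      using r t mm by (simp add: gf_def ix_def flip: lf_def)
  next
    fix t assume t: "t < N" "gf t \<noteq> 0"
    then show "pred i m j p (ix (i - 1) t j p) j (lf t)"
      using lf[OF t(1)] gf[OF t(1)] rng unfolding pred_def
      by (intro conjI disjI1 exI[of _ t] exI[of _ "lf t - 1"]) (auto split: if_splits)
  qed

  have f1: "frame {''t'', ''x''} dp_arrs \<sigma>0 \<sigma>1"
    using frame_sem[of "PFor ''t'' ''N'' pRelaxS" \<sigma>0] by (simp add: \<sigma>1_def pRelaxS_def)
  have ctx1: "ctx \<sigma>1" by (rule ctx_frame[OF ctx0 f1 disj(1,2)])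
  have tabs1: "tabs \<sigma>1" by (rule tabs_frame[OF tabs0 f1 disj(3)])
  have reg1: "regs \<sigma>1 ''i'' = i" "regs \<sigma>1 ''j'' = j" "regs \<sigma>1 ''p'' = p" "regs \<sigma>1 ''u'' = ?u"
    "regs \<sigma>1 ''v'' = ?v" "regs \<sigma>1 ''y'' = ?y"
    using reg0 f1 by (simp_all add: frame_def)
  define hf where "hf t = mem \<sigma>1 ''tQ'' (?v * N + t)" for t
  have hf: "((\<exists>x. step \<gamma> k b j t p x) \<longrightarrow> hf t \<noteq> 0) \<and> (hf t \<noteq> 0 \<longrightarrow> step \<gamma> k b j t p (hf t - 1))"
    if "t < N" for t
    using tabs1 rng that unfolding tabs_def hf_def by blast
  have Q: "sound (mem \<sigma>2) \<and> (\<forall>x. x \<noteq> ?y \<longrightarrow> mem \<sigma>2 ''G'' x = mem \<sigma>1 ''G'' x) \<and>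
    mem \<sigma>1 ''G'' ?y \<le> mem \<sigma>2 ''G'' ?y \<and>
    (\<forall>t<N. hf t \<noteq> 0 \<longrightarrow> mem \<sigma>2 ''G'' (ix i m (j - 1) t) \<le> mem \<sigma>2 ''G'' ?y + 0)"
    unfolding \<sigma>2_def pRelaxQ_def
  proof (rule sem_relax_loop[OF ctx1 reg1(6,2,3) conjunct1[OF S], where lf = "\<lambda>_. 0"])
    fix \<tau> t assume fr: "frame {''t'', ''x''} dp_arrs \<sigma>1 \<tau>" and t: "regs \<tau> ''t'' = t" "t < N"
    have c: "ctx \<tau>" by (rule ctx_frame[OF ctx1 fr disj(1,2)])
    have r: "regs \<tau> ''j'' = j" "regs \<tau> ''u'' = ?u" "regs \<tau> ''v'' = ?v"
      using fr reg1 by (simp_all add: frame_def)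
    have mm: "mem \<tau> ''tQ'' = mem \<sigma>1 ''tQ''" using fr by (simp add: frame_def dp_arrs_def)
    have "mem \<tau> ''mN'' ?v = ?v * N" "mem \<tau> ''mV'' ?u = ?u * V" "mem \<tau> ''mN'' (j - 1) = (j - 1) * N"
      using ctxD(12,14)[OF c] small_R node_R rng t by simp_all
    then show "aval (Cell ''tQ'' (Add (Cell ''mN'' (Reg ''v'')) (Reg ''t''))) \<tau> = hf t \<and>
      aval (Add (Cell ''mV'' (Reg ''u'')) (Add (Cell ''mN'' (Sub (Reg ''j'') (Const 1))) (Reg ''t''))) \<tau> = ix i m (j - 1) t \<and>
      aval (Const 0) \<tau> = 0 \<and> aval (Const 0) \<tau> = 0"
      using r t mm by (simp add: hf_def ix_def)
  next
    fix t assume t: "t < N" "hf t \<noteq> 0"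
    then show "pred i m j p (ix i m (j - 1) t) 0 0"
      using hf[OF t(1)] rng unfolding pred_def by blast
  qed

  have G: "mem \<sigma>2 ''G'' x = mem \<sigma> ''G'' x" if "x \<noteq> ?y" for x using S Q that by (simp add: \<sigma>0_def)
  have Gy: "mem \<sigma> ''G'' ?y \<le> mem \<sigma>2 ''G'' ?y" using S Q by (simp add: \<sigma>0_def)
  have "closed (Suc ?y) (mem \<sigma>2 ''G'')"
    unfolding closed_def
  proof (intro allI impI)
    fix i' m' j' p' x c l
    assume pr: "pred i' m' j' p' x c l" and lt: "ix i' m' j' p' < Suc ?y"
    have r': "m' < N" "j' \<le> b" "p' < N" using pr by (simp_all add: pred_def)
    show "mem \<sigma>2 ''G'' x \<le> mem \<sigma>2 ''G'' (ix i' m' j' p') + c"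
    proof (cases "ix i' m' j' p' = ?y")
      case False
      then have "mem \<sigma> ''G'' x \<le> mem \<sigma> ''G'' (ix i' m' j' p') + c"
        using inv pr lt unfolding dp_inv_def closed_def by (meson less_Suc_eq)
      then show ?thesis using G False pred_less[OF pr] lt by simp
    next
      case True
      then have e: "i' = i" "m' = m" "j' = j" "p' = p" using ix_inj r' rng by auto
      have xy: "x \<noteq> ?y" using pred_less[OF pr] e by simp
      from pr[unfolded e pred_def] consider
        (1) t s where "step \<alpha> k a i t m s" "t < N" "nbhd E s \<subseteq> sel \<gamma> k b j p" "x = ix (i - 1) t j p" "c = j"
        | (2) t q where "step \<gamma> k b j t p q" "t < N" "x = ix i m (j - 1) t" "c = 0"
        by blast
      then show ?thesis
      proof cases
        case 1
        then have "lf t \<noteq> 0" "step \<alpha> k a i t m (lf t - 1)" using lf by blast+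
        \<comment> \<open>The table stores one label per pair of masks. As the added element is
          unique, that label is \<open>s\<close>, and the neighbourhood test was made for the right
          student.\<close>
        then have "gf t \<noteq> 0" using gf[OF 1(2)] step_unique[OF 1(1)] 1(3) by auto
        then have "mem \<sigma>1 ''G'' x \<le> mem \<sigma>1 ''G'' ?y + c" using S 1 by blast
        \<comment> \<open>The second loop can only raise cell \<open>?y\<close> and leaves
          \<open>x\<close> alone, so inequalities gained in the first loop persist.\<close>
        then show ?thesis using Q xy e by fastforce
      next
        case 2
        then have "hf t \<noteq> 0" using hf by blast
        then show ?thesis using Q 2 e by auto
      qed
    qed
  qed
  moreover have "cap \<le> mem \<sigma>2 ''G'' (ix 0 z 0 z)"
    using inv G[of "ix 0 z 0 z"] Gy unfolding dp_inv_def by (cases "ix 0 z 0 z = ?y") auto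
  ultimately show ?thesis unfolding eq dp_inv_def using Q by simp
qed

lemma sem_pDP:
  assumes ctx: "ctx \<sigma>" and tabs: "tabs \<sigma>" and zero: "mem \<sigma> ''G'' = (\<lambda>_. 0)"
  shows "dp_inv (Suc a * N * V) (sem pDP \<sigma>)"
proof -
  let ?p = "PFor ''p'' ''N'' pCell"
  let ?j = "PFor ''j'' ''B'' ?p"
  let ?m = "PFor ''m'' ''N'' ?j"
  have disj: "dp_arrs \<inter> ctx_arrs = {}" "dp_arrs \<inter> {''tS'', ''tQ'', ''ok''} = {}"
    by (auto simp: ctx_arrs_def dp_arrs_def)
  have p: "dp_inv ((i * N + m) * V + Suc j * N) (sem ?p \<tau>)"
    if ctx: "ctx \<tau>" and tabs: "tabs \<tau>"
      and reg: "regs \<tau> ''i'' = i" "regs \<tau> ''m'' = m" "regs \<tau> ''j'' = j"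
      and rng: "i \<le> a" "m < N" "j \<le> b" and f: "dp_inv ((i * N + m) * V + j * N) \<tau>" for \<tau> i m j
  proof -
    have "(\<lambda>c \<tau>. dp_inv (ix i m j c) \<tau>) (regs \<tau> ''N'') (sem ?p \<tau>)"
    proof (rule For_inv)
      fix c \<tau>'
      assume c: "c < regs \<tau> ''N''" and fr: "frame (insert ''p'' (wregs pCell)) (warrs pCell) \<tau> \<tau>'"
        and p: "regs \<tau>' ''p'' = c" and I: "dp_inv (ix i m j c) \<tau>'"
      have ctx': "ctx \<tau>'" by (rule ctx_frame[OF ctx fr]) (auto simp: ctx_regs_def disj)
      have tabs': "tabs \<tau>'" by (rule tabs_frame[OF tabs fr]) (simp add: disj del: Int_insert_right)
      have r: "regs \<tau>' ''i'' = i" "regs \<tau>' ''m'' = m" "regs \<tau>' ''j'' = j" "c < N"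
        using fr reg c ctxD(5)[OF ctx] by (simp_all add: frame_def)
      have "ix i m j (Suc c) = Suc (ix i m j c)" by (simp add: ix_def)
      then show "dp_inv (ix i m j (Suc c)) (setr ''p'' (Suc c) (sem pCell \<tau>'))"
        using sem_pCell[OF ctx' tabs' r(1-3) p rng r(4) I] by simp
    qed (use f in \<open>simp_all add: ix_def\<close>)
    then show ?thesis using ctxD(5)[OF ctx] by (simp add: ix_def algebra_simps)
  qed
  have j: "dp_inv ((i * N + Suc m) * V) (sem ?j \<tau>)"
    if ctx: "ctx \<tau>" and tabs: "tabs \<tau>" and reg: "regs \<tau> ''i'' = i" "regs \<tau> ''m'' = m"
      and rng: "i \<le> a" "m < N" and f: "dp_inv ((i * N + m) * V) \<tau>" for \<tau> i m
  proof -
    have "(\<lambda>c \<tau>. dp_inv ((i * N + m) * V + c * N) \<tau>) (regs \<tau> ''B'') (sem ?j \<tau>)"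
    proof (rule For_inv)
      fix c \<tau>'
      assume c: "c < regs \<tau> ''B''" and fr: "frame (insert ''j'' (wregs ?p)) (warrs ?p) \<tau> \<tau>'"
        and j: "regs \<tau>' ''j'' = c" and I: "dp_inv ((i * N + m) * V + c * N) \<tau>'"
      have ctx': "ctx \<tau>'" by (rule ctx_frame[OF ctx fr]) (auto simp: ctx_regs_def disj)
      have tabs': "tabs \<tau>'" by (rule tabs_frame[OF tabs fr]) (simp add: disj del: Int_insert_right)
      have r: "regs \<tau>' ''i'' = i" "regs \<tau>' ''m'' = m" "c \<le> b"
        using fr reg c ctxD(7)[OF ctx] by (simp_all add: frame_def)
      show "dp_inv ((i * N + m) * V + Suc c * N) (setr ''j'' (Suc c) (sem ?p \<tau>'))"
        using p[OF ctx' tabs' r(1,2) j rng r(3) I] by simp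
    qed (use f in simp_all)
    then show ?thesis using ctxD(7)[OF ctx] by (simp add: V_def algebra_simps)
  qed
  have m: "dp_inv (Suc i * N * V) (sem ?m \<tau>)"
    if ctx: "ctx \<tau>" and tabs: "tabs \<tau>" and reg: "regs \<tau> ''i'' = i"
      and rng: "i \<le> a" and f: "dp_inv (i * N * V) \<tau>" for \<tau> i
  proof -
    have "(\<lambda>c \<tau>. dp_inv ((i * N + c) * V) \<tau>) (regs \<tau> ''N'') (sem ?m \<tau>)"
    proof (rule For_inv)
      fix c \<tau>'
      assume c: "c < regs \<tau> ''N''" and fr: "frame (insert ''m'' (wregs ?j)) (warrs ?j) \<tau> \<tau>'"
        and m: "regs \<tau>' ''m'' = c" and I: "dp_inv ((i * N + c) * V) \<tau>'"
      have ctx': "ctx \<tau>'" by (rule ctx_frame[OF ctx fr]) (auto simp: ctx_regs_def disj)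
      have tabs': "tabs \<tau>'" by (rule tabs_frame[OF tabs fr]) (simp add: disj del: Int_insert_right)
      have r: "regs \<tau>' ''i'' = i" "c < N"
        using fr reg c ctxD(5)[OF ctx] by (simp_all add: frame_def)
      show "dp_inv ((i * N + Suc c) * V) (setr ''m'' (Suc c) (sem ?j \<tau>'))"
        using j[OF ctx' tabs' r(1) m rng r(2) I] by simp
    qed (use f in simp_all)
    then show ?thesis using ctxD(5)[OF ctx] by (simp add: algebra_simps)
  qed
  have za: "z < R" "a < R" using z_less node_R(1)[of 0 z] small_R by simp_all
  define \<sigma>0 where "\<sigma>0 = setm ''G'' (ix 0 z 0 z) cap \<sigma>"
  have eq: "sem pDP \<sigma> = sem (PFor ''i'' ''A'' ?m) \<sigma>0"
    using ctxD(1,4)[OF ctx] ctxD(13)[OF ctx za(2)] ctxD(14)[OF ctx za(1)]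
    by (simp add: pDP_def \<sigma>0_def ix_def cap_def)
  have ctx0: "ctx \<sigma>0" using ctx by (simp add: \<sigma>0_def ctx_arrs_def)
  have tabs0: "tabs \<sigma>0" by (rule tabs_frame[OF tabs, of "{}" "{''G''}"]) (auto simp: \<sigma>0_def frame_def)
  have "(\<lambda>c \<tau>. dp_inv (c * N * V) \<tau>) (regs \<sigma>0 ''A'') (sem (PFor ''i'' ''A'' ?m) \<sigma>0)"
  proof (rule For_inv)
    have "sound (mem \<sigma>0)" unfolding sound_def
    proof (intro allI impI)
      fix i m j p
      assume r: "i \<le> a" "m < N" "j \<le> b" "p < N" and nz: "mem \<sigma>0 ''G'' (ix i m j p) \<noteq> 0"
      then have "ix i m j p = ix 0 z 0 z" using zero by (auto simp: \<sigma>0_def split: if_splits)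
      then have "i = 0 \<and> m = z \<and> j = 0 \<and> p = z" using ix_inj[of m j p z 0 z i 0] r z_less by simp
      then show "i = 0 \<and> m = z \<and> j = 0 \<and> p = z \<and> mem \<sigma>0 ''G'' (ix i m j p) = cap \<or>
         (\<exists>c. pred i m j p (mem \<sigma>0 ''P'' (ix i m j p)) c (mem \<sigma>0 ''L'' (ix i m j p)) \<and>
           mem \<sigma>0 ''J'' (ix i m j p) = j \<and> mem \<sigma>0 ''M'' (ix i m j p) = p \<and>
           mem \<sigma>0 ''G'' (ix i m j p) + c \<le> mem \<sigma>0 ''G'' (mem \<sigma>0 ''P'' (ix i m j p)))"
        by (intro disjI1) (simp add: \<sigma>0_def)
    qed
    then show "dp_inv (0 * N * V) (setr ''i'' 0 \<sigma>0)" by (simp add: dp_inv_def closed_def) (simp add: \<sigma>0_def)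
  next
    fix c \<tau>
    assume c: "c < regs \<sigma>0 ''A''" and fr: "frame (insert ''i'' (wregs ?m)) (warrs ?m) \<sigma>0 \<tau>"
      and i: "regs \<tau> ''i'' = c" and I: "dp_inv (c * N * V) \<tau>"
    have ctx': "ctx \<tau>" by (rule ctx_frame[OF ctx0 fr]) (auto simp: ctx_regs_def disj)
    have tabs': "tabs \<tau>" by (rule tabs_frame[OF tabs0 fr]) (simp add: disj del: Int_insert_right)
    have c: "c \<le> a" using c ctxD(6)[OF ctx0] by simp
    show "dp_inv (Suc c * N * V) (setr ''i'' (Suc c) (sem ?m \<tau>))"
      using m[OF ctx' tabs' i c I] by simp
  qed simp
  then show ?thesis using eq ctxD(6)[OF ctx0] by simp
qed

end

subsection \<open>Tracing back an optimal path\<close>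

text \<open>The length and mask of the question prefix are read from \<open>J\<close> and
  \<open>M\<close>: recovering them from the node index \<open>x\<close> would require
  division.\<close>

definition pRow :: prog where
  "pRow = PFor ''q'' ''b'' (PSto ''F''
     (Add (Cell ''mb'' (Sub (Cell ''L'' (Reg ''x'')) (Const 1))) (Reg ''q''))
     (Sub (eT ''gamma'' (Reg ''q'') (Cell ''J'' (Reg ''x'')) (Cell ''M'' (Reg ''x'')))
       (Cell ''E'' (Add (Cell ''mb'' (Sub (Cell ''L'' (Reg ''x'')) (Const 1))) (Reg ''q'')))))"

definition pBack :: prog where
  "pBack = PWhen (Cell ''L'' (Reg ''x'')) pRow ;; PAsg ''x'' (Cell ''P'' (Reg ''x''))"

definition pTrace :: prog where
  "pTrace =
     PAsg ''x'' (Add (Cell ''mV'' (Add (Cell ''mN'' (Reg ''a'')) (Reg ''z'')))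
       (Add (Cell ''mN'' (Reg ''b'')) (Reg ''z''))) ;;
     PFor ''c'' ''n'' pBack"

lemma wregs_pRow [simp]: "wregs pRow = {''q''}" and warrs_pRow [simp]: "warrs pRow = {''F''}"
  and wregs_pBack [simp]: "wregs pBack = {''q'', ''x''}" and warrs_pBack [simp]: "warrs pBack = {''F''}"
  by (auto simp: pRow_def pBack_def)

text \<open>The loop body together with its counter, so that the trace is a plain iterate and can be
  unwound from its first step.\<close>

definition backstep :: "state \<Rightarrow> state" where
  "backstep \<tau> = setr ''c'' (Suc (regs \<tau> ''c'')) (sem pBack \<tau>)"

context chain_inst
begin

lemma sem_pRow:
  assumes ctx: "ctx \<sigma>" and x: "regs \<sigma> ''x'' = x" "mem \<sigma> ''L'' x = Suc s" "mem \<sigma> ''J'' x = j" "mem \<sigma> ''M'' x = p"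
    and rng: "s < a" "p < N" and r: "s' < a" "q < b"
  shows "mem (sem pRow \<sigma>) ''F'' (s' * b + q) =
    (if s' = s then of_bool (q \<in> sel \<gamma> k b j p \<and> (s, q) \<notin> E) else mem \<sigma> ''F'' (s' * b + q))"
proof -
  let ?i = "Add (Cell ''mb'' (Sub (Cell ''L'' (Reg ''x'')) (Const 1))) (Reg ''q'')"
  let ?e = "Sub (eT ''gamma'' (Reg ''q'') (Cell ''J'' (Reg ''x'')) (Cell ''M'' (Reg ''x''))) (Cell ''E'' ?i)"
  let ?p = "PSto ''F'' ?i ?e"
  have "(\<lambda>c \<tau>. \<forall>s'<a. \<forall>q<b. mem \<tau> ''F'' (s' * b + q) = (if s' = s \<and> q < c
      then of_bool (q \<in> sel \<gamma> k b j p \<and> (s, q) \<notin> E) else mem \<sigma> ''F'' (s' * b + q)))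
    (regs \<sigma> ''b'') (sem pRow \<sigma>)"
    unfolding pRow_def
  proof (rule For_inv)
    fix c \<tau>
    assume c: "c < regs \<sigma> ''b''" and fr: "frame (insert ''q'' (wregs ?p)) (warrs ?p) \<sigma> \<tau>"
      and q: "regs \<tau> ''q'' = c"
      and I: "\<forall>s'<a. \<forall>q<b. mem \<tau> ''F'' (s' * b + q) = (if s' = s \<and> q < c
        then of_bool (q \<in> sel \<gamma> k b j p \<and> (s, q) \<notin> E) else mem \<sigma> ''F'' (s' * b + q))"
    have ctx': "ctx \<tau>" by (rule ctx_frame[OF ctx fr]) (auto simp: ctx_regs_def ctx_arrs_def)
    have f: "regs \<tau> ''x'' = x" "mem \<tau> ''L'' x = Suc s" "mem \<tau> ''J'' x = j" "mem \<tau> ''M'' x = p"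
      using fr x by (simp_all add: frame_def)
    have c: "c < b" using c ctxD(2)[OF ctx] by simp
    have i: "aval ?i \<tau> = s * b + c" using ctxD(13)[OF ctx'] rng small_R f q by simp
    have e: "aval ?e \<tau> = of_bool (c \<in> sel \<gamma> k b j p \<and> (s, c) \<notin> E)"
      using i ctxD(11)[OF ctx' rng(1) c] f q c rng by (simp add: aval_eT_gamma[OF ctx'])
    have F: "mem (setr ''q'' (Suc c) (sem ?p \<tau>)) ''F'' =
        (mem \<tau> ''F'')(s * b + c := of_bool (c \<in> sel \<gamma> k b j p \<and> (s, c) \<notin> E))"
      using i e by simp
    show "\<forall>s'<a. \<forall>q<b. mem (setr ''q'' (Suc c) (sem ?p \<tau>)) ''F'' (s' * b + q) =
      (if s' = s \<and> q < Suc c then of_bool (q \<in> sel \<gamma> k b j p \<and> (s, q) \<notin> E) else mem \<sigma> ''F'' (s' * b + q))"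
      unfolding F
    proof (intro allI impI)
      fix s' q assume "s' < a" "q < b"
      then show "((mem \<tau> ''F'')(s * b + c := of_bool (c \<in> sel \<gamma> k b j p \<and> (s, c) \<notin> E))) (s' * b + q) =
        (if s' = s \<and> q < Suc c then of_bool (q \<in> sel \<gamma> k b j p \<and> (s, q) \<notin> E) else mem \<sigma> ''F'' (s' * b + q))"
        using I index_inj[of q b c s' s] c by (auto simp: less_Suc_eq)
    qed
  qed auto
  then show ?thesis using ctxD(2)[OF ctx] r by simp
qed

lemma frame_back: "frame {''c'', ''q'', ''x''} {''F''} \<tau> (backstep \<tau>)"
  using frame_sem[of pBack \<tau>] by (simp add: frame_def backstep_def)

lemma reach_subset: "reach i A j B c H \<Longrightarrow> H \<subseteq> A \<times> B"
  using reach_realizes unfolding realizes_def by blast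

text \<open>Each predecessor step removes one element, so \<open>i + j\<close> steps lead to the
  start node, and the costs on the way add up to at most the drop from \<open>cap\<close>. Rows of
  students outside the prefix are claimed unchanged, which protects the rows written before the
  induction hypothesis applies.\<close>

lemma trace:
  assumes sound: "sound \<mu>"
  shows "ctx \<tau> \<Longrightarrow> (\<And>A. A \<in> dp_arrs \<Longrightarrow> mem \<tau> A = \<mu> A) \<Longrightarrow> regs \<tau> ''x'' = ix i m j p \<Longrightarrow>
    i \<le> a \<Longrightarrow> m < N \<Longrightarrow> j \<le> b \<Longrightarrow> p < N \<Longrightarrow> \<mu> ''G'' (ix i m j p) \<noteq> 0 \<Longrightarrow> n = i + j \<Longrightarrow>
    \<exists>c H. reach i (sel \<alpha> k a i m) j (sel \<gamma> k b j p) c H \<and> c + \<mu> ''G'' (ix i m j p) \<le> cap \<and>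
      (\<forall>s<a. \<forall>q<b. mem ((backstep ^^ n) \<tau>) ''F'' (s * b + q) =
        (if s \<in> sel \<alpha> k a i m then of_bool ((s, q) \<in> H - E) else mem \<tau> ''F'' (s * b + q)))"
proof (induction n arbitrary: i m j p \<tau>)
  case 0
  then have e: "i = 0" "j = 0" by simp_all
  \<comment> \<open>Nothing can be removed from empty prefixes, so soundness leaves only the start
    node.\<close>
  have "\<not> pred i m j p x c l" for x c l using e by (auto simp: pred_def step_def)
  then have "i = 0 \<and> m = z \<and> j = 0 \<and> p = z \<and> \<mu> ''G'' (ix i m j p) = cap"
    using sound[unfolded sound_def, rule_format, OF 0(4-8)] by blast
  then show ?case using sel_start[OF \<alpha>, of k] sel_start[OF \<gamma>, of k] reach.start
    by (intro exI[of _ 0] exI[of _ "{}"]) (auto simp: z_def)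
next
  case (Suc n)
  let ?y = "ix i m j p"
  obtain d where d: "pred i m j p (\<mu> ''P'' ?y) d (\<mu> ''L'' ?y)" "\<mu> ''J'' ?y = j" "\<mu> ''M'' ?y = p"
      "\<mu> ''G'' ?y + d \<le> \<mu> ''G'' (\<mu> ''P'' ?y)"
  proof -
    have "\<not> (i = 0 \<and> j = 0)" using Suc.prems(9) by (cases i) auto
    with sound[unfolded sound_def, rule_format, OF Suc.prems(4-8)] show thesis
      by (elim disjE exE conjE) (rule that | simp)+
  qed
  have ar: "mem \<tau> ''L'' = \<mu> ''L''" "mem \<tau> ''J'' = \<mu> ''J''" "mem \<tau> ''M'' = \<mu> ''M''" "mem \<tau> ''P'' = \<mu> ''P''"
    using Suc.prems(2) by (simp_all add: dp_arrs_def)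
  have ctx: "ctx (backstep \<tau>)"
    by (rule ctx_frame[OF Suc.prems(1) frame_back]) (auto simp: ctx_regs_def ctx_arrs_def)
  have arr: "mem (backstep \<tau>) A = \<mu> A" if "A \<in> dp_arrs" for A
  proof -
    have "A \<notin> {''F''}" using that by (auto simp: dp_arrs_def)
    then have "mem (backstep \<tau>) A = mem \<tau> A" using frame_back[of \<tau>] unfolding frame_def by blast
    then show ?thesis using Suc.prems(2)[OF that] by (rule trans)
  qed
  have x: "regs (backstep \<tau>) ''x'' = \<mu> ''P'' ?y"
    using Suc.prems(3) ar by (auto simp: backstep_def pBack_def)
  have bk: "(backstep ^^ Suc n) \<tau> = (backstep ^^ n) (backstep \<tau>)" by (simp only: funpow_Suc_right o_apply)
  have nz: "\<mu> ''G'' (\<mu> ''P'' ?y) \<noteq> 0" using d Suc.prems(8) by simp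
  from d(1) consider
    (S) m' s where "step \<alpha> k a i m' m s" "m' < N" "nbhd E s \<subseteq> sel \<gamma> k b j p"
      "\<mu> ''P'' ?y = ix (i - 1) m' j p" "d = j" "\<mu> ''L'' ?y = Suc s"
    | (Q) p' q where "step \<gamma> k b j p' p q" "p' < N" "\<mu> ''P'' ?y = ix i m (j - 1) p'" "d = 0" "\<mu> ''L'' ?y = 0"
    unfolding pred_def by blast
  then show ?case
  proof cases
    case S
    have st: "i > 0" "s < a" "\<alpha> s \<le> i + k" "i \<le> \<alpha> s + k" "s \<notin> sel \<alpha> k a (i - 1) m'"
      "sel \<alpha> k a i m = insert s (sel \<alpha> k a (i - 1) m')" using S(1) by (simp_all add: step_def)
    note prev = x[unfolded S(4)] nz[unfolded S(4)]
    have "i - 1 \<le> a" "n = i - 1 + j" using Suc.prems(4,9) st(1) by linarith+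
    from Suc.IH[OF ctx arr prev(1) this(1) S(2) Suc.prems(6,7) prev(2) this(2)]
    obtain c H where cR: "reach (i - 1) (sel \<alpha> k a (i - 1) m') j (sel \<gamma> k b j p) c H"
      "c + \<mu> ''G'' (ix (i - 1) m' j p) \<le> cap"
      "\<And>s q. s < a \<Longrightarrow> q < b \<Longrightarrow> mem ((backstep ^^ n) (backstep \<tau>)) ''F'' (s * b + q) =
        (if s \<in> sel \<alpha> k a (i - 1) m' then of_bool ((s, q) \<in> H - E) else mem (backstep \<tau>) ''F'' (s * b + q))"
      by blast
    let ?H = "H \<union> {s} \<times> sel \<gamma> k b j p"
    have "reach i (sel \<alpha> k a i m) j (sel \<gamma> k b j p) (c + j) ?H"
      using reach.student[OF cR(1) st(2,5)] st S by simp
    moreover have "c + j + \<mu> ''G'' ?y \<le> cap" using cR(2) d(4) S by simp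
    moreover have "mem ((backstep ^^ Suc n) \<tau>) ''F'' (s' * b + q) =
        (if s' \<in> sel \<alpha> k a i m then of_bool ((s', q) \<in> ?H - E) else mem \<tau> ''F'' (s' * b + q))"
      if r: "s' < a" "q < b" for s' q
    proof -
      have "mem (backstep \<tau>) ''F'' (s' * b + q) = (if s' = s then of_bool (q \<in> sel \<gamma> k b j p \<and> (s, q) \<notin> E)
          else mem \<tau> ''F'' (s' * b + q))"
        using sem_pRow[OF Suc.prems(1,3) _ _ _ st(2) Suc.prems(7) r, of j] ar d S Suc.prems(3)
        by (simp add: backstep_def pBack_def)
      moreover have "(s', q) \<in> H \<Longrightarrow> s' \<in> sel \<alpha> k a (i - 1) m'" using reach_subset[OF cR(1)] by blast
      \<comment> \<open>The row of \<open>s\<close> is written in this step. Later steps leave it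
        alone because \<open>s\<close> is not in the shorter prefix, and \<open>H\<close> has no
        edge at \<open>s\<close>.\<close>
      ultimately show ?thesis using cR(3)[OF r] st(5,6) unfolding bk by (cases "s' = s") auto
    qed
    ultimately show ?thesis by blast
  next
    case Q
    have st: "j > 0" "q < b" "\<gamma> q \<le> j + k" "j \<le> \<gamma> q + k" "q \<notin> sel \<gamma> k b (j - 1) p'"
      "sel \<gamma> k b j p = insert q (sel \<gamma> k b (j - 1) p')" using Q(1) by (simp_all add: step_def)
    have F: "mem (backstep \<tau>) ''F'' = mem \<tau> ''F''" using Q(5) ar Suc.prems(3) by (simp add: backstep_def pBack_def)
    note prev = x[unfolded Q(3)] nz[unfolded Q(3)]
    have "j - 1 \<le> b" "n = i + (j - 1)" using Suc.prems(6,9) st(1) by linarith+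
    from Suc.IH[OF ctx arr prev(1) Suc.prems(4,5) this(1) Q(2) prev(2) this(2)]
    obtain c H where cR: "reach i (sel \<alpha> k a i m) (j - 1) (sel \<gamma> k b (j - 1) p') c H"
      "c + \<mu> ''G'' (ix i m (j - 1) p') \<le> cap"
      "\<And>s q. s < a \<Longrightarrow> q < b \<Longrightarrow> mem ((backstep ^^ n) (backstep \<tau>)) ''F'' (s * b + q) =
        (if s \<in> sel \<alpha> k a i m then of_bool ((s, q) \<in> H - E) else mem (backstep \<tau>) ''F'' (s * b + q))"
      by blast
    have "reach i (sel \<alpha> k a i m) j (sel \<gamma> k b j p) c H"
      using reach.question[OF cR(1) st(2,5)] st by simp
    moreover have "c + \<mu> ''G'' ?y \<le> cap" using cR(2) d(4) Q by simp
    moreover have "\<forall>s<a. \<forall>q<b. mem ((backstep ^^ Suc n) \<tau>) ''F'' (s * b + q) =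
        (if s \<in> sel \<alpha> k a i m then of_bool ((s, q) \<in> H - E) else mem \<tau> ''F'' (s * b + q))"
      using cR(3) unfolding bk F by blast
    ultimately show ?thesis by blast
  qed
qed

text \<open>A feasible solution always exists: in the complete graph all neighbourhoods coincide, so
  the initial orderings themselves are admissible. Through the lower bound, this makes the value at
  the end node positive.\<close>

lemma complete_addition:
  shows "both_near_addition {..<a} {..<b} E \<alpha> \<gamma> k ({..<a} \<times> {..<b} - E)"
    and "card E + card ({..<a} \<times> {..<b} - E) = a * b"
proof -
  let ?H = "{..<a} \<times> {..<b}"
  have un: "E \<union> (?H - E) = ?H" using E_sub by auto
  have "nested {..<a} ?H \<alpha>" by (auto simp: nested_def nbhd_def)
  moreover have "interval_property {..<a} {..<b} ?H \<gamma>"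
    unfolding interval_property_def
  proof
    fix s assume "s \<in> {..<a}"
    moreover have "inv_into {..<b} \<gamma> ` {1..b} = {..<b}"
      using inv_into_image_eq[of \<gamma> "{..<b}" b] \<gamma> ordering_range[OF \<gamma>] by (auto simp: is_ordering_def)
    ultimately show "\<exists>j\<in>{0..card {..<b}}. nbhd ?H s = inv_into {..<b} \<gamma> ` {1..j}"
      by (intro bexI[of _ b]) (auto simp: nbhd_def)
  qed
  moreover have "near k X f f" for X :: "nat set" and f by (simp add: near_def)
  ultimately show "both_near_addition {..<a} {..<b} E \<alpha> \<gamma> k (?H - E)"
    unfolding both_near_addition_def un using \<alpha> \<gamma> by blast
  show "card E + card (?H - E) = a * b"
    using E_sub finite_E card_mono[of ?H E] by (simp add: card_Diff_subset)
qed

lemma sem_pTrace: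
  assumes ctx: "ctx \<sigma>" and inv: "dp_inv (Suc a * N * V) \<sigma>" and zero: "mem \<sigma> ''F'' = (\<lambda>_. 0)"
  shows "min_both_near_addition {..<a} {..<b} E \<alpha> \<gamma> k (output_edges a b (sem pTrace \<sigma>))"
proof -
  let ?G = "mem \<sigma> ''G''" and ?y = "ix a z b z"
  have lt: "ix i m j p < Suc a * N * V" if "i \<le> a" "m < N" "j \<le> b" "p < N" for i m j p
    using index_less[OF _ node_V[OF that(3,4)], of "i * N + m" "Suc a * N - 1"] index_less[OF that(1,2)]
    by (simp add: ix_def)
  have closed: "?G x \<le> ?G (ix i m j p) + c" if "pred i m j p x c l" for i m j p x c l
    using inv that lt[of i m j p] unfolding dp_inv_def closed_def pred_def by blast
  have lower: "cap \<le> ?G ?y + (card E + card F)" if "both_near_addition {..<a} {..<b} E \<alpha> \<gamma> k F" for F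
  proof (rule addition_lower_bound[OF that, of cap "\<lambda>i m j p. ?G (ix i m j p)", folded N_def z_def])
    show "cap \<le> ?G (ix 0 z 0 z)" using inv by (simp add: dp_inv_def)
  next
    fix i m' m j p s
    assume "step \<alpha> k a i m' m s" "i \<le> a" "j \<le> b" "m' < N" "m < N" "p < N" "nbhd E s \<subseteq> sel \<gamma> k b j p"
    then have "pred i m j p (ix (i - 1) m' j p) j (Suc s)" unfolding pred_def by blast
    then show "?G (ix (i - 1) m' j p) \<le> ?G (ix i m j p) + j" by (rule closed)
  next
    fix i m j p' p q
    assume "step \<gamma> k b j p' p q" "i \<le> a" "j \<le> b" "p' < N" "m < N" "p < N"
    then have "pred i m j p (ix i m (j - 1) p') 0 0" unfolding pred_def by blast
    then show "?G (ix i m (j - 1) p') \<le> ?G (ix i m j p)" using closed by fastforce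
  qed
  have nz: "?G ?y \<noteq> 0" using lower[OF complete_addition(1)] complete_addition(2) by (simp add: cap_def)
  let ?\<sigma> = "setr ''c'' 0 (setr ''x'' ?y \<sigma>)"
  have z: "z < N" by (rule z_less)
  have "mem \<sigma> ''mN'' a = a * N" "mem \<sigma> ''mN'' b = b * N" "mem \<sigma> ''mV'' (a * N + z) = (a * N + z) * V"
    using ctxD(12,14)[OF ctx] small_R node_R z by simp_all
  then have eq: "sem pTrace \<sigma> = (backstep ^^ (a + b)) ?\<sigma>"
    using ctxD(1,2,4,8)[OF ctx] by (simp add: pTrace_def sem.simps(5) ix_def flip: backstep_def)
  have snd: "sound (mem \<sigma>)" using inv by (simp add: dp_inv_def)
  have ctx': "ctx ?\<sigma>" using ctx by (simp add: ctx_regs_def)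
  have "sel \<alpha> k a a z = {..<a}" "sel \<gamma> k b b z = {..<b}" using sel_end \<alpha> \<gamma> by (auto simp: z_def)
  then obtain c H where cR: "reach a {..<a} b {..<b} c H" "c + ?G ?y \<le> cap"
    "\<And>s q. s < a \<Longrightarrow> q < b \<Longrightarrow> mem (sem pTrace \<sigma>) ''F'' (s * b + q) = of_bool ((s, q) \<in> H - E)"
    using trace[OF snd ctx', of a z b z "a + b"] z nz eq by auto
  have "output_edges a b (sem pTrace \<sigma>) = H - E"
  proof -
    have "mem (sem pTrace \<sigma>) ''F'' (s * b + q) = 1 \<longleftrightarrow> (s, q) \<in> H - E" if "s < a" "q < b" for s q
      using cR(3)[OF that] by (cases "(s, q) \<in> H - E") simp_all
    then show ?thesis using reach_subset[OF cR(1)] unfolding output_edges_def by blast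
  qed
  moreover have "card (H - E) \<le> card F" if "both_near_addition {..<a} {..<b} E \<alpha> \<gamma> k F" for F
    \<comment> \<open>The certificates meet: \<open>card (H - E) + card E = c\<close>, where
      \<open>c\<close> is at most \<open>cap\<close> minus the value at the end node, and that is at
      most \<open>card E + card F\<close>.\<close>
    using lower[OF that] cR(2) reach_final(2)[OF cR(1)] by linarith
  ultimately show ?thesis
    unfolding min_both_near_addition_def using reach_final(1)[OF cR(1)] by simp
qed

end

text \<open>Kept apart from \<open>pScal\<close>, which computes registers that serve as loop bounds
  here; the cost bound requires that no program writes its own loop bounds.\<close>

definition pMain :: prog where
  "pMain = pSetup ;; pTabs ;; pDP ;; pTrace"

context chain_inst
begin

lemma sem_pMain:
  "min_both_near_addition {..<a} {..<b} E \<alpha> \<gamma> k (output_edges a b (sem pMain (sem pScal input)))"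
proof -
  define \<sigma>1 where "\<sigma>1 = sem pSetup (sem pScal input)"
  define \<sigma>2 where "\<sigma>2 = sem pTabs \<sigma>1"
  define \<sigma>3 where "\<sigma>3 = sem pDP \<sigma>2"
  have w: "warrs pTabs = {''tS'', ''tQ'', ''ok''}" "wregs pTabs \<inter> ctx_regs = {}"
    by (auto simp: pTabs_def ctx_regs_def)
  have m1: "mem \<sigma>1 A = (\<lambda>_. 0)" if "A \<in> {''tS'', ''tQ'', ''ok'', ''G'', ''F''}" for A
    using that by (auto simp: \<sigma>1_def pSetup_def input_state_def)
  have c1: "ctx \<sigma>1" unfolding \<sigma>1_def by (rule ctx_setup)
  have t2: "tabs \<sigma>2" unfolding \<sigma>2_def by (rule tabs_pTabs[OF c1]) (simp_all add: m1)
  have c2: "ctx \<sigma>2" unfolding \<sigma>2_def by (rule ctx_sem[OF c1 w(2)]) (auto simp: w ctx_arrs_def)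
  have i3: "dp_inv (Suc a * N * V) \<sigma>3" unfolding \<sigma>3_def
    by (rule sem_pDP[OF c2 t2]) (simp add: \<sigma>2_def w m1)
  have c3: "ctx \<sigma>3" unfolding \<sigma>3_def
    by (rule ctx_sem[OF c2]) (auto simp: ctx_arrs_def ctx_regs_def dp_arrs_def)
  have "mem \<sigma>3 ''F'' = (\<lambda>_. 0)" by (simp add: \<sigma>3_def \<sigma>2_def w m1 dp_arrs_def)
  from sem_pTrace[OF c3 i3 this] show ?thesis
    by (simp add: pMain_def \<sigma>3_def \<sigma>2_def \<sigma>1_def)
qed

end

subsection \<open>Running time\<close>

text \<open>The cost is bounded by a constant depending only on the program text times the largest
  product of bounds of nested loops.\<close>

primrec size_const :: "prog \<Rightarrow> nat" where
  "size_const (PAsg x e) = 1 + ecost e"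
| "size_const (PSto A i e) = 1 + ecost i + ecost e"
| "size_const (p ;; q) = size_const p + size_const q"
| "size_const (PWhen e p) = 2 + ecost e + size_const p"
| "size_const (PFor i n p) = 14 + size_const p"

text \<open>Taking \<open>max 1\<close> keeps the product positive when a loop is empty, so that it
  still dominates the constant overhead.\<close>

primrec nesting :: "prog \<Rightarrow> (vname \<Rightarrow> nat) \<Rightarrow> nat" where
  "nesting (PAsg x e) \<rho> = 1"
| "nesting (PSto A i e) \<rho> = 1"
| "nesting (p ;; q) \<rho> = max (nesting p \<rho>) (nesting q \<rho>)"
| "nesting (PWhen e p) \<rho> = nesting p \<rho>"
| "nesting (PFor i n p) \<rho> = max 1 (\<rho> n) * nesting p \<rho>"

lemma nesting_pos: "1 \<le> nesting p \<rho>"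
proof (induction p)
  case (PFor i n p)
  have "1 * 1 \<le> max 1 (\<rho> n) * nesting p \<rho>" by (rule mult_le_mono) (use PFor in auto)
  then show ?case by simp
qed auto

lemma cost_le_nesting: "cost p \<rho> \<le> size_const p * nesting p \<rho>"
proof (induction p)
  case (PSeq p q)
  have "size_const p * nesting p \<rho> \<le> size_const p * nesting (p ;; q) \<rho>"
    "size_const q * nesting q \<rho> \<le> size_const q * nesting (p ;; q) \<rho>" by (auto intro!: mult_le_mono2)
  then show ?case using PSeq unfolding cost.simps size_const.simps add_mult_distrib by linarith
next
  case (PWhen e p)
  have "(2 + ecost e) * 1 \<le> (2 + ecost e) * nesting p \<rho>" by (rule mult_le_mono2) (rule nesting_pos)
  then show ?case using PWhen unfolding cost.simps size_const.simps nesting.simps add_mult_distrib by linarith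
next
  case (PFor i n p)
  let ?d = "max 1 (\<rho> n)" and ?X = "nesting p \<rho>"
  have X: "1 \<le> ?X" by (rule nesting_pos)
  \<comment> \<open>Both overheads are charged to the full product, which explains
    \<open>14 = 6 + 8\<close> in \<open>size_const\<close>.\<close>
  have "6 + \<rho> n * (8 + cost p \<rho>) \<le> 6 * (?d * ?X) + ?d * (8 * ?X + size_const p * ?X)"
  proof (rule add_mono)
    have "6 * (1 * 1) \<le> 6 * (?d * ?X)" using X by (intro mult_le_mono) auto
    then show "6 \<le> 6 * (?d * ?X)" by simp
    have "8 * 1 + cost p \<rho> \<le> 8 * ?X + size_const p * ?X" using X PFor by (intro add_mono mult_le_mono) auto
    then show "\<rho> n * (8 + cost p \<rho>) \<le> ?d * (8 * ?X + size_const p * ?X)"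
      by (intro mult_le_mono) auto
  qed
  then show ?case by (simp add: algebra_simps)
qed auto

lemma counters_ok_pScal: "counters_ok pScal" and bounds_pScal: "bounds pScal \<inter> wregs pScal = {}"
  by (simp_all add: pScal_def)

lemmas program_defs = pMain_def pSetup_def pMul_def pT_def pTrow_def pTabs_def pStep_def pEntry_def
  pMatch_def pOk_def pOkCell_def pDP_def pCell_def pRelaxS_def pRelaxQ_def pRelax_def pTrace_def
  pBack_def pRow_def

lemma counters_ok_pMain: "counters_ok pMain" and bounds_pMain: "bounds pMain \<inter> wregs pMain = {}"
  by (simp_all add: program_defs)

text \<open>The left side is \<open>4 ^ (4 * k)\<close>. For \<open>k > 4\<close> the base
  \<open>4\<close> is at most \<open>k\<close>; for \<open>k \<le> 4\<close> the value is at most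
  \<open>4 ^ 16 = 256 ^ 4\<close>, whence the constant.\<close>

lemma mask_count_bound:
  assumes "0 < k"
  shows "((2::nat) ^ (k + k)) ^ 4 \<le> 256 ^ 4 * k ^ (4 * k + 4)"
proof -
  have e: "((2::nat) ^ (k + k)) ^ 4 = 4 ^ (4 * k)"
  proof -
    have "((2::nat) ^ (k + k)) ^ 4 = 2 ^ (2 * (4 * k))" by (simp add: mult.commute flip: power_mult)
    also have "\<dots> = (2 ^ 2) ^ (4 * k)" by (rule power_mult)
    finally show ?thesis by simp
  qed
  show ?thesis
  proof (cases "k \<le> 4")
    case True
    have "(4::nat) ^ (4 * k) \<le> 4 ^ (4 * 4)" using True by (intro power_increasing) auto
    also have "(4::nat) ^ (4 * 4) = 256 ^ 4 * 1" by simp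
    also have "\<dots> \<le> 256 ^ 4 * k ^ (4 * k + 4)" using assms by (intro mult_le_mono2) simp
    finally show ?thesis using e by simp
  next
    case False
    have "(4::nat) ^ (4 * k) \<le> k ^ (4 * k)" using False by (intro power_mono) auto
    also have "\<dots> \<le> k ^ (4 * k + 4)" using assms by (intro power_increasing) auto
    also have "\<dots> \<le> 256 ^ 4 * k ^ (4 * k + 4)" by simp
    finally show ?thesis using e by simp
  qed
qed

context chain_inst
begin

lemma N_ge_1 [simp]: "Suc 0 \<le> N" by (simp add: N_def)

lemma k_less_N: "k + k \<le> N"
proof -
  have "k + k < 2 ^ (k + k)" by (rule less_exp)
  then show ?thesis by (simp add: N_def)
qed

context
  fixes d :: nat
  assumes d: "d = 2 * (a + b)" and pos: "a + b > 0"
begin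

text \<open>A common majorant for all loop nests. The choice \<open>d = 2 * (a + b)\<close>
  dominates \<open>Suc a\<close> and \<open>Suc b\<close> as soon as there is at least one
  vertex.\<close>

lemma mono_bound:
  assumes "x \<le> 4 * (d ^ i * N ^ l)" "i \<le> 3" "l \<le> 4"
  shows "x \<le> 4 * (d ^ 3 * N ^ 4)"
proof -
  have "d ^ i * N ^ l \<le> d ^ 3 * N ^ 4" using assms d pos N_pos by (intro mult_le_mono power_increasing) auto
  then show ?thesis using assms(1) by linarith
qed

lemma nesting_pScal: "nesting pScal (regs input) \<le> 4 * (d ^ 3 * N ^ 4)"
proof -
  have k: "max 1 k \<le> 4 * (d ^ 3 * N ^ 4)"
    by (rule mono_bound[of _ 0 1]) (use k_less_N N_pos in auto)
  have ab: "max 1 a \<le> 4 * (d ^ 3 * N ^ 4)" "max 1 b \<le> 4 * (d ^ 3 * N ^ 4)"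
    by (rule mono_bound[of _ 1 0]; use d pos in auto)+
  show ?thesis using k ab by (simp add: pScal_def input_regs)
qed

lemma nesting_pMain:
  assumes "regs \<sigma> ''a'' = a" "regs \<sigma> ''b'' = b" "regs \<sigma> ''N'' = N" "regs \<sigma> ''A'' = Suc a"
    "regs \<sigma> ''B'' = Suc b" "regs \<sigma> ''n'' = a + b" "regs \<sigma> ''w'' = k + k" "regs \<sigma> ''R'' = R"
  shows "nesting pMain (regs \<sigma>) \<le> 4 * (d ^ 3 * N ^ 4)"
proof -
  let ?X = "4 * (d ^ 3 * N ^ 4)"
  have le: "max 1 a \<le> d" "max 1 b \<le> d" "Suc a \<le> d" "Suc b \<le> d" "max 1 (a + b) \<le> d" "max 1 (k + k) \<le> N"
      "max 1 N \<le> N" "max 1 (Suc a) \<le> d" "max 1 (Suc b) \<le> d"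
    using d pos k_less_N N_pos by auto
  have d1: "1 \<le> d" using le(3) by simp
  have "Suc a * N \<le> d * N" "Suc b * N \<le> d * N" by (intro mult_le_mono1 le(3,4))+
  moreover have "N \<le> d * N" using mult_le_mono1[OF d1, of N] by simp
  moreover have "1 \<le> N" by simp
  \<comment> \<open>Each of the four summands of \<open>R\<close> is at most \<open>d * N\<close>;
    this is the origin of the factor \<open>4\<close>.\<close>
  ultimately have "max 1 R \<le> 4 * (d * N)" unfolding R_def using k_less_N by linarith
  then have "max 1 R \<le> 4 * (d ^ 1 * N ^ 1)" by simp
  then have R: "max 1 R \<le> ?X" by (rule mono_bound) auto
  have N1: "max 1 N \<le> ?X" by (rule mono_bound[of _ 0 1]) (use N_pos in auto)
  have "max 1 (k + k) * max 1 N \<le> N * N" using le by (intro mult_le_mono)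
  then have wN: "max 1 (k + k) * max 1 N \<le> ?X" by (intro mono_bound[of _ 0 2]) (auto simp: power2_eq_square)
  have st: "max 1 x * (max 1 N * (max 1 N * (max 1 x * max 1 x))) \<le> ?X" if "max 1 x \<le> d" for x
  proof (rule mono_bound[of _ 3 2])
    have "max 1 x * (max 1 N * (max 1 N * (max 1 x * max 1 x))) \<le> d * (N * (N * (d * d)))"
      using that le by (intro mult_le_mono)
    then show "max 1 x * (max 1 N * (max 1 N * (max 1 x * max 1 x))) \<le> 4 * (d ^ 3 * N ^ 2)"
      by (simp add: power2_eq_square power3_eq_cube mult_ac)
  qed auto
  have ok: "max 1 a * (max 1 (Suc b) * (max 1 N * max 1 b)) \<le> ?X"
  proof (rule mono_bound[of _ 3 1])
    have "max 1 a * (max 1 (Suc b) * (max 1 N * max 1 b)) \<le> d * (d * (N * d))"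
      using le by (intro mult_le_mono)
    then show "max 1 a * (max 1 (Suc b) * (max 1 N * max 1 b)) \<le> 4 * (d ^ 3 * N ^ 1)"
      by (simp add: power3_eq_cube mult_ac)
  qed auto
  have dp: "max 1 (Suc a) * (max 1 N * (max 1 (Suc b) * (max 1 N * max 1 N))) \<le> ?X"
  proof (rule mono_bound[of _ 2 3])
    have "max 1 (Suc a) * (max 1 N * (max 1 (Suc b) * (max 1 N * max 1 N))) \<le> d * (N * (d * (N * N)))"
      using le by (intro mult_le_mono)
    then show "max 1 (Suc a) * (max 1 N * (max 1 (Suc b) * (max 1 N * max 1 N))) \<le> 4 * (d ^ 2 * N ^ 3)"
      by (simp add: power2_eq_square power3_eq_cube mult_ac)
  qed auto
  have tr: "max 1 (a + b) * max 1 b \<le> ?X"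
  proof (rule mono_bound[of _ 2 0])
    have "max 1 (a + b) * max 1 b \<le> d * d" using le by (intro mult_le_mono)
    then show "max 1 (a + b) * max 1 b \<le> 4 * (d ^ 2 * N ^ 0)" by (simp add: power2_eq_square)
  qed auto
  have m1: "max x 1 = max 1 x" "max 1 (max 1 x) = max 1 x" for x :: nat by auto
  note nest = nesting.simps max.bounded_iff mult_1_right max.idem assms m1
  show ?thesis
    unfolding program_defs nest
    using R N1 wN st[OF le(1)] st[OF le(2)] ok dp tr
    by (simp only: nest)
qed

end
end

theorem theorem6:
  "\<exists>(P :: com) (C :: nat). \<forall>(a :: nat) (b :: nat) (E :: (nat \<times> nat) set)
       (\<alpha> :: nat \<Rightarrow> nat) (\<gamma> :: nat \<Rightarrow> nat) (k :: nat).
     chain_instance {..<a} {..<b} E \<alpha> \<gamma> k \<longrightarrow>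
     (\<exists>t \<tau>. exec P (input_state a b E \<alpha> \<gamma> k) t \<tau> \<and>
        min_both_near_addition {..<a} {..<b} E \<alpha> \<gamma> k (output_edges a b \<tau>) \<and>
        (a + b > 0 \<longrightarrow> t \<le> C * ((a + b) ^ 3 * k ^ (4 * k + 4))))"
proof -
  let ?P = "Seq (compile pScal) (compile pMain)"
  define K where "K = size_const pScal + size_const pMain"
  \<comment> \<open>\<open>32 = 4 * 2 ^ 3\<close> combines the factor \<open>4\<close> of the loop
    bound with the cube of the \<open>2\<close> in \<open>d\<close>; \<open>256 ^ 4\<close> comes
    from \<open>mask_count_bound\<close>.\<close>
  define C where "C = K * (32 * 256 ^ 4)"
  have "\<exists>t \<tau>. exec ?P (input_state a b E \<alpha> \<gamma> k) t \<tau> \<and>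
        min_both_near_addition {..<a} {..<b} E \<alpha> \<gamma> k (output_edges a b \<tau>) \<and>
        (a + b > 0 \<longrightarrow> t \<le> C * ((a + b) ^ 3 * k ^ (4 * k + 4)))"
    if inst: "chain_instance {..<a} {..<b} E \<alpha> \<gamma> k" for a b E \<alpha> \<gamma> k
  proof -
    interpret chain_inst a b E \<alpha> \<gamma> k by unfold_locales (rule inst)
    define \<sigma> where "\<sigma> = sem pScal input"
    obtain t1 where t1: "t1 \<le> cost pScal (regs input)" "exec (compile pScal) input t1 \<sigma>"
      using exec_sem[OF counters_ok_pScal bounds_pScal] \<sigma>_def by blast
    obtain t2 where t2: "t2 \<le> cost pMain (regs \<sigma>)" "exec (compile pMain) \<sigma> t2 (sem pMain \<sigma>)"
      using exec_sem[OF counters_ok_pMain bounds_pMain] by blast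
    have "t1 + t2 \<le> C * ((a + b) ^ 3 * k ^ (4 * k + 4))" if pos: "a + b > 0"
    proof -
      let ?X = "4 * ((2 * (a + b)) ^ 3 * N ^ 4)"
      note r = regs_pScal[OF input_regs, folded \<sigma>_def]
      have "t1 \<le> size_const pScal * ?X"
        using t1(1) cost_le_nesting[of pScal "regs input"] mult_le_mono2[OF nesting_pScal[OF refl pos]]
        by (meson order.trans)
      moreover have "t2 \<le> size_const pMain * ?X"
        using t2(1) cost_le_nesting[of pMain "regs \<sigma>"]
          mult_le_mono2[OF nesting_pMain[OF refl pos r(1,2,5,6,7,8,10,11)]]
        by (meson order.trans)
      ultimately have "t1 + t2 \<le> K * ?X" unfolding K_def add_mult_distrib by linarith
      also have "?X = 32 * ((a + b) ^ 3 * N ^ 4)" unfolding power_mult_distrib by simp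
      also have "K * (32 * ((a + b) ^ 3 * N ^ 4)) \<le> K * (32 * ((a + b) ^ 3 * (256 ^ 4 * k ^ (4 * k + 4))))"
        using mask_count_bound[OF k_pos] unfolding N_def by (intro mult_le_mono2)
      also have "\<dots> = C * ((a + b) ^ 3 * k ^ (4 * k + 4))" unfolding C_def by (simp only: mult_ac)
      finally show ?thesis .
    qed
    then show ?thesis using exec.Seq[OF t1(2) t2(2)] sem_pMain unfolding \<sigma>_def by blast
  qed
  then show ?thesis by blast
qed

end
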